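(* Let $\mathcal A^*$ be an $(r-1)$-connected ($r>1$) Poincaré DGCA of Hodge type of degree $n$ with $n\le 5r-3$. The $A_\infty$-quasi-isomorphism class of $\mathcal A^*$ is completely encoded into the DGCA $(H^*(\mathcal A^* ),\cdot)$ and in the Hochschild class $[\mu_3^{\mathcal A^*}]\in\mathsf{Hoch}^2(H^*(\mathcal A^* ),H^*(\mathcal A^* ))$.
   Context: $\mathbb F$ is a fixed field of characteristic $0$. A DGCA is a (unital) differential graded commutative algebra over $\mathbb F$ with differential $d$ of degree $+1$; $\mathcal A^*_d=\ker d$. A DGCA is connected if $H^0\cong\mathbb F$, and $s$-connected if moreover $H^k=0$ for $1\le k\le s$. The cohomology algebra $(H^*(\mathcal A^* ),\cdot)$ is regarded as a DGCA with zero differential. A DGCA is regarded as an $A_\infty$-algebra with multiplications $m_1=d$, $m_2$ the product, and $m_k=0$ for $k\ge3$. An $A_\infty$-morphism is a family of $k$-linear maps $f_k$ of degree $1-k$, $k\ge1$, satisfying the usual compatibility relations with the multiplications; it is an $A_\infty$-quasi-isomorphism if $f_1$ induces an isomorphism in cohomology. A Poincaré algebra of degree $n$ is a finite dimensional graded commutative algebra $H^*=\bigoplus_{k=0}^nH^k$ with a linear functional $\int\in(H^n)^\vee$ such that the pairing $\langle\alpha^k,\beta^l\rangle=\int\alpha^k\beta^l$ if $k+l=n$, and $0$ otherwise, is non-degenerate. A Poincaré DGCA of degree $n$ is a DGCA $\mathcal A^*=\bigoplus_{k=0}^n\mathcal A^k$ whose cohomology ring is a Poincaré algebra of degree $n$;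 it carries the induced pairing $\langle\alpha^k,\beta^l\rangle=\int[\alpha^k\beta^l]$ if $k+l=n$, and $0$ otherwise. A harmonic subspace is a graded subspace $\mathcal H^*\subseteq\mathcal A^*_d$ complementary to $d\mathcal A^{*-1}$ in $\mathcal A^*_d$. A Hodge type decomposition is a direct sum decomposition $\mathcal A^*=d\mathcal A^{*-1}\oplus\mathcal H^*\oplus\mathcal B^*$ with $\mathcal H^*$ a harmonic subspace and $\langle\mathcal H^*\oplus\mathcal B^*,\mathcal B^*\rangle=0$; $\mathcal A^*$ is of Hodge type if such a decomposition exists. Given one, $d:\mathcal B^*\to d\mathcal A^*$ is bijective; $d^-:\mathcal A^*\to\mathcal A^{*-1}$ is its inverse on $d\mathcal A^*$, extended by $0$ on $\mathcal H^*\oplus\mathcal B^*$, and $\pi_{\mathcal H^*}$ is the projection of $\mathcal A^*$ onto $\mathcal H^*$. Let $H^*=H^*(\mathcal A^* )$ and $H^*_+=\bigoplus_{k\ge1}H^k$. A generating subspace is a graded subspace $H^*_{gen}\subseteq H^*_+$ with $H^*_+=H^*_{gen}\oplus(H^*_+\cdot H^*_+)$. A partial splitting map is a linear degree-preserving map $\imath_0:H^*_{gen}\to\mathcal A^*_d$ with $[\imath_0(x)]=x$; it extends to an algebra morphism $\imath_0:S^*(H^*_{gen})\to\mathcal A^*_d$ from the graded symmetric algebra. A harmonic subspace $\mathcal H^*$ is adapted if, for some $H^*_{gen}$ and $\imath_0$, $\mathcal H^*=\imath(H^* )$ for a linear section $\imath:H^*\to\mathcal A^*_d$ of the projection $\mathcal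 A^*_d\to H^*$ with $\imath|_{H^*_{gen}}=\imath_0$ and $\imath(H^* )\subseteq\imath_0(S^*(H^*_{gen}))$. For a Hodge type decomposition with adapted harmonic subspace $\mathcal H^*=\imath(H^* )$ (one always exists when $\mathcal A^*$ is connected and of Hodge type), set $m_3(\alpha,\beta,\gamma)=\pi_{\mathcal H^*}\big(d^-(\alpha\beta)\gamma-(-1)^{\deg\alpha}\alpha\, d^-(\beta\gamma)\big)$ for $\alpha,\beta,\gamma\in\mathcal H^*$, and $\mu_3^{\mathcal A^*}([\alpha],[\beta],[\gamma])=[m_3(\imath[\alpha],\imath[\beta],\imath[\gamma])]$, a degree $-1$ trilinear map on $H^*$. When $\mathcal A^*$ is $(r-1)$-connected with $r>1$ and $n\le5r-3$, it is a Hochschild cocycle whose class $[\mu_3^{\mathcal A^*}]$ does not depend on the choices. $\mathsf{Hoch}^{p,q}(H^*,H^* )$ is Hochschild cohomology represented by $p$-linear maps $(H^* )^{\otimes p}\to H^*$ of degree $q$; it is contained in $\mathsf{Hoch}^{p+q}(H^*,H^* )$. With $m$ the product of $H^*$ and Koszul signs, a trilinear $f$ of degree $-1$ is a cocycle iff $m(f\otimes \mathrm{id})+m(\mathrm{id}\otimes f)-f(m\otimes\mathrm{id}\otimes\mathrm{id})+f(\mathrm{id}\otimes m\otimes\mathrm{id})-f(\mathrm{id}\otimes\mathrm{id}\otimes m)=0$, and coboundaries are the maps $d_{\mathsf{Hoch}}\phi=m(\phi\otimes\mathrm{id})-m(\mathrm{id}\otimes\phi)-\phi(m\otimes\mathrm{id})+\phi(\mathrm{id}\otimes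 m)$ with $\phi$ bilinear of degree $-1$.
   Formalization: The Hochschild coboundary is taken as m(φ⊗id) − m(id⊗φ) + φ(m⊗id) − φ(id⊗m); with the signs −φ(m⊗id) + φ(id⊗m) as given, coboundaries need not satisfy the stated cocycle condition, so the Hochschild class would be ill-defined. *)

theory Defs
  imports Complex_Main
begin

text \<open>
  The ground field is a type of class \<open>field_char_0\<close>. A differential graded algebra lives on a
  whole type of class \<open>ring_1\<close>, which supplies its product and unit; the record supplies the
  scalar multiplication, the grading (over the integers, so that maps of negative degree need
  no case distinction) and the differential. Cohomology is the honest quotient: its elements
  are cosets of the exact elements, so it is a graded algebra with explicit carriers.
\<close>

definition ksgn :: "int \<Rightarrow> 'f::comm_ring_1" where
  "ksgn k = (if even k then 1 else - 1)"


section \<open>Differential graded commutative algebras\<close>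

record ('f, 'a) gspace =
  scal :: "'f \<Rightarrow> 'a \<Rightarrow> 'a"
  gr   :: "int \<Rightarrow> 'a set"

record ('f, 'a) dg_alg = "('f, 'a) gspace" +
  diff :: "'a \<Rightarrow> 'a"

definition graded_space :: "('f::field, 'a::ab_group_add, 'z) gspace_scheme \<Rightarrow> bool" where
  "graded_space V \<longleftrightarrow>
     vector_space (scal V) \<and>
     (\<forall>k. module.subspace (scal V) (gr V k)) \<and>
     (\<forall>x. \<exists>!c. (\<forall>k. c k \<in> gr V k) \<and> finite {k. c k \<noteq> 0} \<and> x = (\<Sum>k | c k \<noteq> 0. c k))"

definition dgca :: "('f::field, 'a::ring_1) dg_alg \<Rightarrow> bool" where
  "dgca A \<longleftrightarrow>
     graded_space A \<and>
     (\<forall>c x y. scal A c (x * y) = scal A c x * y \<and> scal A c (x * y) = x * scal A c y) \<and>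
     1 \<in> gr A 0 \<and>
     (\<forall>i j. \<forall>x\<in>gr A i. \<forall>y\<in>gr A j. x * y \<in> gr A (i + j)) \<and>
     (\<forall>i j. \<forall>x\<in>gr A i. \<forall>y\<in>gr A j. x * y = scal A (ksgn (i * j)) (y * x)) \<and>
     Vector_Spaces.linear (scal A) (scal A) (diff A) \<and>
     (\<forall>k. \<forall>x\<in>gr A k. diff A x \<in> gr A (k + 1)) \<and>
     (\<forall>x. diff A (diff A x) = 0) \<and>
     (\<forall>i. \<forall>x\<in>gr A i. \<forall>y. diff A (x * y) = diff A x * y + scal A (ksgn i) (x * diff A y))"

definition cocycles :: "('f, 'a::ab_group_add) dg_alg \<Rightarrow> 'a set" where
  "cocycles A = {x. diff A x = 0}"

definition cls :: "('f, 'a::ab_group_add) dg_alg \<Rightarrow> 'a \<Rightarrow> 'a set" where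
  "cls A x = {x + diff A y | y. True}"


section \<open>Graded algebras with explicit carriers, and cohomology\<close>

text \<open>Only the homogeneous parts are recorded; (multi)linear maps on such an algebra are given
  by their values on homogeneous elements, and linearity is imposed on each part.\<close>

record ('f, 'v) galg =
  gpart  :: "int \<Rightarrow> 'v set"
  gzero  :: 'v
  gone   :: 'v
  gadd   :: "'v \<Rightarrow> 'v \<Rightarrow> 'v"
  gscale :: "'f \<Rightarrow> 'v \<Rightarrow> 'v"
  gmult  :: "'v \<Rightarrow> 'v \<Rightarrow> 'v"

text \<open>The unions below are unions of equal cosets, i.e. the operations are induced by those on
  representatives.\<close>

definition cohomology :: "('f, 'a::ring_1) dg_alg \<Rightarrow> ('f, 'a set) galg" where
  "cohomology A =
     \<lparr> gpart = (\<lambda>k. cls A ` (cocycles A \<inter> gr A k)),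
       gzero = cls A 0,
       gone = cls A 1,
       gadd = (\<lambda>X Y. \<Union>x\<in>X. \<Union>y\<in>Y. cls A (x + y)),
       gscale = (\<lambda>c X. \<Union>x\<in>X. cls A (scal A c x)),
       gmult = (\<lambda>X Y. \<Union>x\<in>X. \<Union>y\<in>Y. cls A (x * y)) \<rparr>"

definition gsub :: "('f::comm_ring_1, 'v) galg \<Rightarrow> 'v \<Rightarrow> 'v \<Rightarrow> 'v" where
  "gsub H x y = gadd H x (gscale H (- 1) y)"

inductive_set gspan :: "('f, 'v) galg \<Rightarrow> 'v set \<Rightarrow> 'v set" for H S where
  zero: "gzero H \<in> gspan H S"
| base: "x \<in> S \<Longrightarrow> x \<in> gspan H S"
| add: "x \<in> gspan H S \<Longrightarrow> y \<in> gspan H S \<Longrightarrow> gadd H x y \<in> gspan H S"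
| scale: "x \<in> gspan H S \<Longrightarrow> gscale H c x \<in> gspan H S"

definition part_linear ::
  "('f, 'v) galg \<Rightarrow> int \<Rightarrow> ('f, 'w) galg \<Rightarrow> int \<Rightarrow> ('v \<Rightarrow> 'w) \<Rightarrow> bool" where
  "part_linear H k K l g \<longleftrightarrow>
     (\<forall>x\<in>gpart H k. g x \<in> gpart K l) \<and>
     (\<forall>x\<in>gpart H k. \<forall>y\<in>gpart H k. g (gadd H x y) = gadd K (g x) (g y)) \<and>
     (\<forall>c. \<forall>x\<in>gpart H k. g (gscale H c x) = gscale K c (g x))"

text \<open>Isomorphisms of graded algebras; for algebras with zero differential these are the
  isomorphisms of differential graded algebras.\<close>

definition galg_iso :: "('f, 'v) galg \<Rightarrow> ('f, 'w) galg \<Rightarrow> ('v \<Rightarrow> 'w) \<Rightarrow> bool" where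
  "galg_iso H K \<phi> \<longleftrightarrow>
     (\<forall>k. part_linear H k K k \<phi> \<and> bij_betw \<phi> (gpart H k) (gpart K k)) \<and>
     (\<forall>i j. \<forall>x\<in>gpart H i. \<forall>y\<in>gpart H j. \<phi> (gmult H x y) = gmult K (\<phi> x) (\<phi> y)) \<and>
     \<phi> (gone H) = gone K"

text \<open>\<open>H\<^sup>0 \<cong> F\<close> means that the unit map of the algebra \<open>H\<^sup>0\<close> is an isomorphism.\<close>

definition s_connected :: "('f::field, 'a::ring_1) dg_alg \<Rightarrow> nat \<Rightarrow> bool" where
  "s_connected A s \<longleftrightarrow>
     bij_betw (\<lambda>c. gscale (cohomology A) c (gone (cohomology A))) UNIV (gpart (cohomology A) 0) \<and>
     (\<forall>k. 1 \<le> k \<and> k \<le> int s \<longrightarrow> gpart (cohomology A) k = {gzero (cohomology A)})"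


section \<open>Poincare duality and Hodge type decompositions\<close>

definition gpairing ::
  "('f::field, 'v) galg \<Rightarrow> nat \<Rightarrow> ('v \<Rightarrow> 'f) \<Rightarrow> int \<Rightarrow> int \<Rightarrow> 'v \<Rightarrow> 'v \<Rightarrow> 'f" where
  "gpairing H n I k l x y = (if k + l = int n then I (gmult H x y) else 0)"

text \<open>Only to be used for graded commutative algebras \<open>H\<close>.\<close>

definition poincare_algebra :: "('f::field, 'v) galg \<Rightarrow> nat \<Rightarrow> ('v \<Rightarrow> 'f) \<Rightarrow> bool" where
  "poincare_algebra H n I \<longleftrightarrow>
     (\<forall>k. k < 0 \<or> int n < k \<longrightarrow> gpart H k = {gzero H}) \<and>
     (\<forall>k. \<exists>S. finite S \<and> gpart H k = gspan H S) \<and>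
     (\<forall>x\<in>gpart H (int n). \<forall>y\<in>gpart H (int n). I (gadd H x y) = I x + I y) \<and>
     (\<forall>c. \<forall>x\<in>gpart H (int n). I (gscale H c x) = c * I x) \<and>
     (\<forall>k. \<forall>x\<in>gpart H k. (\<forall>l. \<forall>y\<in>gpart H l. gpairing H n I k l x y = 0) \<longrightarrow> x = gzero H) \<and>
     (\<forall>l. \<forall>y\<in>gpart H l. (\<forall>k. \<forall>x\<in>gpart H k. gpairing H n I k l x y = 0) \<longrightarrow> y = gzero H)"

definition poincare_dgca ::
  "('f::field, 'a::ring_1) dg_alg \<Rightarrow> nat \<Rightarrow> ('a set \<Rightarrow> 'f) \<Rightarrow> bool" where
  "poincare_dgca A n I \<longleftrightarrow>
     dgca A \<and>
     (\<forall>k. k < 0 \<or> int n < k \<longrightarrow> gr A k = {0}) \<and>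
     poincare_algebra (cohomology A) n I"

text \<open>The induced pairing of an element of degree \<open>k\<close> with one of degree \<open>l\<close>. When \<open>k + l = n\<close> the
  product is closed because there is nothing in degree \<open>n + 1\<close>.\<close>

definition dg_pairing ::
  "('f::field, 'a::ring_1) dg_alg \<Rightarrow> nat \<Rightarrow> ('a set \<Rightarrow> 'f) \<Rightarrow> int \<Rightarrow> int \<Rightarrow> 'a \<Rightarrow> 'a \<Rightarrow> 'f" where
  "dg_pairing A n I k l x y = (if k + l = int n then I (cls A (x * y)) else 0)"

definition graded_subspace :: "('f::field, 'a::ab_group_add) dg_alg \<Rightarrow> 'a set \<Rightarrow> bool" where
  "graded_subspace A S \<longleftrightarrow>
     module.subspace (scal A) S \<and> S = module.span (scal A) (\<Union>k. S \<inter> gr A k)"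

definition harmonic_subspace :: "('f::field, 'a::ab_group_add) dg_alg \<Rightarrow> 'a set \<Rightarrow> bool" where
  "harmonic_subspace A Hs \<longleftrightarrow>
     graded_subspace A Hs \<and>
     range (diff A) \<inter> Hs = {0} \<and>
     cocycles A = {e + h | e h. e \<in> range (diff A) \<and> h \<in> Hs}"

definition hodge_decomposition ::
  "('f::field, 'a::ring_1) dg_alg \<Rightarrow> nat \<Rightarrow> ('a set \<Rightarrow> 'f) \<Rightarrow> 'a set \<Rightarrow> 'a set \<Rightarrow> bool" where
  "hodge_decomposition A n I Hs Bs \<longleftrightarrow>
     harmonic_subspace A Hs \<and>
     graded_subspace A Bs \<and>
     (\<forall>x. \<exists>!p. p \<in> range (diff A) \<times> Hs \<times> Bs \<and> x = fst p + fst (snd p) + snd (snd p)) \<and>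
     (\<forall>k l. \<forall>x\<in>gr A k. \<forall>y\<in>gr A l.
        x \<in> {h + b | h b. h \<in> Hs \<and> b \<in> Bs} \<longrightarrow> y \<in> Bs \<longrightarrow> dg_pairing A n I k l x y = 0)"

definition hodge_type :: "('f::field, 'a::ring_1) dg_alg \<Rightarrow> nat \<Rightarrow> ('a set \<Rightarrow> 'f) \<Rightarrow> bool" where
  "hodge_type A n I \<longleftrightarrow> (\<exists>Hs Bs. hodge_decomposition A n I Hs Bs)"

definition harm_proj ::
  "('f, 'a::ab_group_add) dg_alg \<Rightarrow> 'a set \<Rightarrow> 'a set \<Rightarrow> 'a \<Rightarrow> 'a" where
  "harm_proj A Hs Bs x =
     (THE h. h \<in> Hs \<and> (\<exists>e\<in>range (diff A). \<exists>b\<in>Bs. x = e + h + b))"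

text \<open>The inverse of the differential \<open>Bs \<rightarrow> range (diff A)\<close>, extended by zero on \<open>Hs + Bs\<close>.\<close>

definition dminus ::
  "('f, 'a::ab_group_add) dg_alg \<Rightarrow> 'a set \<Rightarrow> 'a set \<Rightarrow> 'a \<Rightarrow> 'a" where
  "dminus A Hs Bs x =
     (THE b. b \<in> Bs \<and> (\<exists>h\<in>Hs. \<exists>b'\<in>Bs. x = diff A b + h + b'))"


section \<open>Adapted harmonic subspaces\<close>

definition decomposables :: "('f, 'v) galg \<Rightarrow> int \<Rightarrow> 'v set" where
  "decomposables H k =
     gspan H {gmult H x y | x y i j.
                1 \<le> i \<and> 1 \<le> j \<and> i + j = k \<and> x \<in> gpart H i \<and> y \<in> gpart H j}"

definition generating_subspace :: "('f, 'v) galg \<Rightarrow> (int \<Rightarrow> 'v set) \<Rightarrow> bool" where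
  "generating_subspace H G \<longleftrightarrow>
     (\<forall>k. G k \<subseteq> gpart H k \<and> G k = gspan H (G k)) \<and>
     (\<forall>k\<le>0. G k = {gzero H}) \<and>
     (\<forall>k\<ge>1. \<forall>x\<in>gpart H k. \<exists>!p. p \<in> G k \<times> decomposables H k \<and> x = gadd H (fst p) (snd p))"

text \<open>A linear degree-preserving map, defined on the graded subspace \<open>G\<close> of the cohomology, that
  chooses a closed representative of each class.\<close>

definition splitting_on ::
  "('f, 'a::ring_1) dg_alg \<Rightarrow> (int \<Rightarrow> 'a set set) \<Rightarrow> ('a set \<Rightarrow> 'a) \<Rightarrow> bool" where
  "splitting_on A G i \<longleftrightarrow>
     (\<forall>k. \<forall>x\<in>G k.
        i x \<in> cocycles A \<inter> gr A k \<and> cls A (i x) = x \<and>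
        (\<forall>y\<in>G k. i (gadd (cohomology A) x y) = i x + i y) \<and>
        (\<forall>c. i (gscale (cohomology A) c x) = scal A c (i x)))"

text \<open>The image of the algebra morphism that extends \<open>i\<^sub>0\<close> to the graded symmetric algebra on \<open>G\<close>:
  the symmetric algebra is spanned by the monomials in elements of \<open>G\<close> (the empty one being the
  unit), and these are sent to the products of the values of \<open>i\<^sub>0\<close>.\<close>

definition sym_image ::
  "('f::field, 'a::ring_1) dg_alg \<Rightarrow> (int \<Rightarrow> 'a set set) \<Rightarrow> ('a set \<Rightarrow> 'a) \<Rightarrow> 'a set" where
  "sym_image A G i\<^sub>0 = module.span (scal A) {prod_list xs | xs. set xs \<subseteq> i\<^sub>0 ` (\<Union>k. G k)}"

definition adapted_section ::
  "('f::field, 'a::ring_1) dg_alg \<Rightarrow> ('a set \<Rightarrow> 'a) \<Rightarrow> bool" where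
  "adapted_section A i \<longleftrightarrow>
     splitting_on A (gpart (cohomology A)) i \<and>
     (\<exists>G i\<^sub>0. generating_subspace (cohomology A) G \<and>
             splitting_on A G i\<^sub>0 \<and>
             (\<forall>k. \<forall>x\<in>G k. i x = i\<^sub>0 x) \<and>
             (\<forall>k. \<forall>x\<in>gpart (cohomology A) k. i x \<in> sym_image A G i\<^sub>0))"

definition adapted_hodge_decomposition ::
  "('f::field, 'a::ring_1) dg_alg \<Rightarrow> nat \<Rightarrow> ('a set \<Rightarrow> 'f) \<Rightarrow>
     'a set \<Rightarrow> 'a set \<Rightarrow> ('a set \<Rightarrow> 'a) \<Rightarrow> bool" where
  "adapted_hodge_decomposition A n I Hs Bs i \<longleftrightarrow>
     hodge_decomposition A n I Hs Bs \<and>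
     adapted_section A i \<and>
     Hs = module.span (scal A) (\<Union>k. i ` gpart (cohomology A) k)"


section \<open>The ternary product\<close>

text \<open>The degree of \<open>0\<close> is not determined, which is harmless: it is only used as the exponent of a
  sign in front of a multiple of the element itself.\<close>

definition hdeg :: "('f, 'a) dg_alg \<Rightarrow> 'a \<Rightarrow> int" where
  "hdeg A x = (THE k. x \<in> gr A k)"

definition m3 ::
  "('f::field, 'a::ring_1) dg_alg \<Rightarrow> 'a set \<Rightarrow> 'a set \<Rightarrow> 'a \<Rightarrow> 'a \<Rightarrow> 'a \<Rightarrow> 'a" where
  "m3 A Hs Bs a b c =
     harm_proj A Hs Bs
       (dminus A Hs Bs (a * b) * c - scal A (ksgn (hdeg A a)) (a * dminus A Hs Bs (b * c)))"

definition mu3 ::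
  "('f::field, 'a::ring_1) dg_alg \<Rightarrow> 'a set \<Rightarrow> 'a set \<Rightarrow> ('a set \<Rightarrow> 'a) \<Rightarrow>
     'a set \<Rightarrow> 'a set \<Rightarrow> 'a set \<Rightarrow> 'a set" where
  "mu3 A Hs Bs i X Y Z = cls A (m3 A Hs Bs (i X) (i Y) (i Z))"


section \<open>Hochschild classes in bidegree (3, -1)\<close>

definition bilinear_deg :: "('f, 'v) galg \<Rightarrow> int \<Rightarrow> ('v \<Rightarrow> 'v \<Rightarrow> 'v) \<Rightarrow> bool" where
  "bilinear_deg H q f \<longleftrightarrow>
     (\<forall>i j. \<forall>x\<in>gpart H i. \<forall>y\<in>gpart H j.
        part_linear H i H (i + j + q) (\<lambda>x. f x y) \<and>
        part_linear H j H (i + j + q) (\<lambda>y. f x y))"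

definition trilinear_deg :: "('f, 'v) galg \<Rightarrow> int \<Rightarrow> ('v \<Rightarrow> 'v \<Rightarrow> 'v \<Rightarrow> 'v) \<Rightarrow> bool" where
  "trilinear_deg H q f \<longleftrightarrow>
     (\<forall>i j k. \<forall>x\<in>gpart H i. \<forall>y\<in>gpart H j. \<forall>z\<in>gpart H k.
        part_linear H i H (i + j + k + q) (\<lambda>x. f x y z) \<and>
        part_linear H j H (i + j + k + q) (\<lambda>y. f x y z) \<and>
        part_linear H k H (i + j + k + q) (\<lambda>z. f x y z))"

text \<open>The vanishing of \<open>m(f \<otimes> id) + m(id \<otimes> f) - f(m \<otimes> id \<otimes> id) + f(id \<otimes> m \<otimes> id) - f(id \<otimes> id \<otimes> m)\<close>;
  the Koszul sign comes from moving \<open>f\<close>, of degree -1, past \<open>x\<close>.\<close>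

definition hoch_cocycle ::
  "('f::comm_ring_1, 'v) galg \<Rightarrow> ('v \<Rightarrow> 'v \<Rightarrow> 'v \<Rightarrow> 'v) \<Rightarrow> bool" where
  "hoch_cocycle H f \<longleftrightarrow>
     trilinear_deg H (- 1) f \<and>
     (\<forall>i j k l. \<forall>x\<in>gpart H i. \<forall>y\<in>gpart H j. \<forall>z\<in>gpart H k. \<forall>w\<in>gpart H l.
        gsub H
          (gadd H
            (gsub H
              (gadd H (gmult H (f x y z) w) (gscale H (ksgn i) (gmult H x (f y z w))))
              (f (gmult H x y) z w))
            (f x (gmult H y z) w))
          (f x y (gmult H z w)) = gzero H)"

text \<open>The coboundary \<open>m(\<phi> \<otimes> id) - m(id \<otimes> \<phi>) + \<phi>(m \<otimes> id) - \<phi>(id \<otimes> m)\<close> of a bilinear map of degree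
  -1, at \<open>x, y, z\<close> with \<open>x\<close> of degree \<open>i\<close>. Relative to the terms \<open>m(\<phi> \<otimes> id) - m(id \<otimes> \<phi>)\<close>, the
  signs of the other two are forced by the requirement that coboundaries satisfy the cocycle
  condition above. Equivalently, minus this expression is the difference of the ternary
  products of two minimal A-infinity structures related by a morphism \<open>(id, \<phi>, \<dots>)\<close>.\<close>

definition hoch_d ::
  "('f::comm_ring_1, 'v) galg \<Rightarrow> ('v \<Rightarrow> 'v \<Rightarrow> 'v) \<Rightarrow> int \<Rightarrow> 'v \<Rightarrow> 'v \<Rightarrow> 'v \<Rightarrow> 'v" where
  "hoch_d H \<phi> i x y z =
     gsub H
       (gadd H
         (gsub H (gmult H (\<phi> x y) z) (gscale H (ksgn i) (gmult H x (\<phi> y z))))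
         (\<phi> (gmult H x y) z))
       (\<phi> x (gmult H y z))"

definition hoch_class ::
  "('f::comm_ring_1, 'v) galg \<Rightarrow> ('v \<Rightarrow> 'v \<Rightarrow> 'v \<Rightarrow> 'v) \<Rightarrow> ('v \<Rightarrow> 'v \<Rightarrow> 'v \<Rightarrow> 'v) set" where
  "hoch_class H f =
     {g. hoch_cocycle H g \<and>
         (\<exists>\<phi>. bilinear_deg H (- 1) \<phi> \<and>
              (\<forall>i j k. \<forall>x\<in>gpart H i. \<forall>y\<in>gpart H j. \<forall>z\<in>gpart H k.
                 g x y z = gadd H (f x y z) (hoch_d H \<phi> i x y z)))}"

text \<open>Transport of a class along an isomorphism \<open>\<phi>\<close>: the maps \<open>\<phi> \<circ> f \<circ> (\<phi>\<inverse> \<otimes> \<phi>\<inverse> \<otimes> \<phi>\<inverse>)\<close> with \<open>f\<close> in the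
  class. As in \<open>hoch_class\<close>, values at non-homogeneous arguments are unconstrained.\<close>

definition hoch_push ::
  "('f, 'v) galg \<Rightarrow> ('v \<Rightarrow> 'w) \<Rightarrow> ('v \<Rightarrow> 'v \<Rightarrow> 'v \<Rightarrow> 'v) set \<Rightarrow> ('w \<Rightarrow> 'w \<Rightarrow> 'w \<Rightarrow> 'w) set" where
  "hoch_push H \<phi> C =
     {g. \<exists>f\<in>C. \<forall>i j k. \<forall>x\<in>gpart H i. \<forall>y\<in>gpart H j. \<forall>z\<in>gpart H k.
           g (\<phi> x) (\<phi> y) (\<phi> z) = \<phi> (f x y z)}"


section \<open>A-infinity morphisms\<close>

text \<open>A family of maps with one map in each arity is a function on lists; the value at the empty
  list plays no role.\<close>

fun ainf_mult :: "('f, 'a::ring_1) dg_alg \<Rightarrow> 'a list \<Rightarrow> 'a" where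
  "ainf_mult A [x] = diff A x"
| "ainf_mult A [x, y] = x * y"
| "ainf_mult A _ = 0"

fun blocks :: "nat list \<Rightarrow> 'a list \<Rightarrow> 'a list list" where
  "blocks [] xs = []"
| "blocks (j # js) xs = take j xs # blocks js (drop j xs)"

text \<open>The sign exponent of the term indexed by \<open>js = [j\<^sub>1, \<dots>, j\<^sub>l]\<close> on the right-hand side of
  \<open>\<Sum>\<^bsub>r+s+t=k\<^esub> (-1)\<^bsup>r+st\<^esup> f(id\<^bsup>\<otimes>r\<^esup> \<otimes> m\<^sub>s \<otimes> id\<^bsup>\<otimes>t\<^esup>) =
  \<Sum>\<^bsub>j\<^sub>1+\<dots>+j\<^sub>l=k\<^esub> (-1)\<^bsup>(l-1)(j\<^sub>1-1) + (l-2)(j\<^sub>2-1) + \<dots>\<^esup> m'(f\<^bsub>j\<^sub>1\<^esub> \<otimes> \<dots> \<otimes> f\<^bsub>j\<^sub>l\<^esub>)\<close>,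
  evaluated on elements of degrees \<open>ks\<close>. The second summand is the Koszul sign from moving each
  \<open>f\<^sub>j\<close>, of degree \<open>1 - j\<close>, past the arguments of the blocks before it.\<close>

definition tensor_sign :: "nat list \<Rightarrow> int list \<Rightarrow> int" where
  "tensor_sign js ks =
     (\<Sum>q<length js.
        (int (length js) - 1 - int q) * (int (js ! q) - 1) +
        (1 - int (js ! q)) * sum_list (take (sum_list (take q js)) ks))"

definition ainf_morphism ::
  "('f::field, 'a::ab_group_add, 'y) gspace_scheme \<Rightarrow> ('a list \<Rightarrow> 'a) \<Rightarrow>
   ('f, 'b::ab_group_add, 'z) gspace_scheme \<Rightarrow> ('b list \<Rightarrow> 'b) \<Rightarrow> ('a list \<Rightarrow> 'b) \<Rightarrow> bool" where
  "ainf_morphism V m W m' f \<longleftrightarrow>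
     (\<forall>xs ys. Vector_Spaces.linear (scal V) (scal W) (\<lambda>x. f (xs @ x # ys))) \<and>
     (\<forall>ks xs. xs \<noteq> [] \<longrightarrow> list_all2 (\<lambda>k x. x \<in> gr V k) ks xs \<longrightarrow>
        f xs \<in> gr W (sum_list ks + 1 - int (length xs))) \<and>
     (\<forall>ks xs. xs \<noteq> [] \<longrightarrow> list_all2 (\<lambda>k x. x \<in> gr V k) ks xs \<longrightarrow>
        (\<Sum>(r, s) | 1 \<le> s \<and> r + s \<le> length xs.
           scal W (ksgn (int r + int s * int (length xs - r - s)
                         + (2 - int s) * sum_list (take r ks)))
             (f (take r xs @ m (take s (drop r xs)) # drop (r + s) xs)))
        = (\<Sum>js | sum_list js = length xs \<and> 0 \<notin> set js.
             scal W (ksgn (tensor_sign js ks)) (m' (map f (blocks js xs)))))"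

definition ainf_quasi_iso ::
  "('f::field, 'a::ring_1) dg_alg \<Rightarrow> ('f, 'b::ring_1) dg_alg \<Rightarrow> ('a list \<Rightarrow> 'b) \<Rightarrow> bool" where
  "ainf_quasi_iso A B f \<longleftrightarrow>
     ainf_morphism A (ainf_mult A) B (ainf_mult B) f \<and>
     (\<forall>k. bij_betw (\<lambda>X. \<Union>x\<in>X. cls B (f [x])) (gpart (cohomology A) k) (gpart (cohomology B) k))"

text \<open>Over a field every A-infinity quasi-isomorphism has a quasi-inverse, so the existence of a
  single one is already an equivalence relation.\<close>

definition ainf_quasi_isomorphic ::
  "('f::field, 'a::ring_1) dg_alg \<Rightarrow> ('f, 'b::ring_1) dg_alg \<Rightarrow> bool" where
  "ainf_quasi_isomorphic A B \<longleftrightarrow> (\<exists>f. ainf_quasi_iso A B f)"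

end

theory Submission
  imports Defs
begin

text \<open>
  The idea is obstruction theory with an explicit contraction. Over a field, Hodge decompositions contract source
  and target onto their harmonic subspaces, so an \<open>A\<^sub>\<infinity>\<close>-morphism \<open>f\<close> can be built one arity at a
  time, the obstruction in arity \<open>k\<close> being a \<open>k\<close>-linear map \<open>H\<^bsup>\<otimes>k\<^esup> \<rightarrow> H'\<close> of degree \<open>2 - k\<close>, and in
  each arity the harmonic part of \<open>f\<^sub>k\<close> may be chosen freely.
  In arity 2 the obstruction vanishes because the given map of cohomologies is multiplicative, and in arity 3 it
  is the difference of the ternary products plus the coboundary of the harmonic part of \<open>f\<^sub>2\<close>. In arity at
  least 4, connectedness, \<open>n \<le> 5r - 3\<close> and Poincare duality leave only obstructions in arity 4 and 5 with
  values in the top degree, where the orthogonality relations of the Hodge decomposition reduce them to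
  \<open>\<Sum> \<omega>(c\<^sub>j, c\<^sub>k\<^sub>-\<^sub>j)\<close>, with \<open>c\<^sub>j\<close> the harmonic parts and \<open>\<omega>\<close> the shifted pairing. Since \<open>\<omega>\<close>
  is antisymmetric, these cyclic sums can be made zero by choosing \<open>c\<^sub>3\<close> and \<open>c\<^sub>4\<close>, provided that \<open>c\<^sub>2\<close> has no
  component in top degree. For this, \<open>c\<^sub>2\<close> is first made graded symmetric, which is
  possible because the ternary products are antisymmetric under reversal of their arguments, and then changed by
  the coboundary of a linear map of degree -1.
  Conversely, the first three components of an \<open>A\<^sub>\<infinity>\<close>-morphism provide a cochain bounding the difference of
  the ternary products.
\<close>

section \<open>Linear maps and graded algebras\<close>

text \<open>The constant comes from a degree count. In arity k, arguments of degree at least r put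
  the obstruction in degree at least k (r - 1) + 2, which is 4 r - 2 or more for k >= 4. By duality
  the harmonic space is zero strictly between degrees n - r and n, and 4 r - 2 > n - r is exactly n
  <= 5 r - 3; so only degree n can survive, and six arguments already reach 6 r - 4 > 5 r - 3.
  Arguments of degree 0 escape this count; they are multiples of the unit, and for them the morphism
  is kept strictly unital. In degree n the integral sees everything, but it must be decoupled from
  the homotopies. Values in \<open>Bs'\<close> integrate to zero against harmonic ones and each
  other; what could remain are integrals of free parts on a product, such as
  \<open>c [x * y, z]\<close>. These are not of cyclic shape, hence the normalization: free parts of
  arity at least 2 have integral zero. For the solutions in arity three and four this is automatic,
  being the pairing with 1, since T vanishes on units. Division by 2 occurs in the symmetrization,
  in the normalization and in the arity four equation.\<close>

lemma lin_add: "Vector_Spaces.linear s t f \<Longrightarrow> f (x + y) = f x + f y"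
  and lin_scale: "Vector_Spaces.linear s t f \<Longrightarrow> f (s c x) = t c (f x)"
  by (auto simp: Vector_Spaces.linear_iff)

lemma lin_0: "Vector_Spaces.linear s t f \<Longrightarrow> f 0 = 0"
  using lin_add[of s t f 0 0] by simp

lemma lin_neg: "Vector_Spaces.linear s t f \<Longrightarrow> f (- x) = - f x"
  using lin_add[of s t f x "- x"] lin_0[of s t f] by (simp add: eq_neg_iff_add_eq_0 add.commute)

lemma lin_diff: "Vector_Spaces.linear s t f \<Longrightarrow> f (x - y) = f x - f y"
  using lin_add[of s t f x "- y"] lin_neg[of s t f y] by simp

lemma lin_sum: "Vector_Spaces.linear s t f \<Longrightarrow> f (sum g I) = (\<Sum>i\<in>I. f (g i))"
  by (induction I rule: infinite_finite_induct) (simp_all add: lin_0 lin_add)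

lemmas lin_rules = lin_add lin_diff lin_neg lin_0 lin_scale lin_sum

lemma lin_vs: "Vector_Spaces.linear s t f \<Longrightarrow> vector_space s" "Vector_Spaces.linear s t f \<Longrightarrow> vector_space t"
  by (auto simp: Vector_Spaces.linear_iff)

lemma lin_comp:
  "Vector_Spaces.linear s t f \<Longrightarrow> Vector_Spaces.linear t u g \<Longrightarrow> Vector_Spaces.linear s u (\<lambda>x. g (f x))"
  by (simp add: Vector_Spaces.linear_iff)

lemma lin_add_fun:
  "Vector_Spaces.linear s t f \<Longrightarrow> Vector_Spaces.linear s t g \<Longrightarrow> Vector_Spaces.linear s t (\<lambda>x. f x + g x)"
  by (auto simp: Vector_Spaces.linear_iff vector_space.vector_space_assms)

lemma lin_diff_fun:
  "Vector_Spaces.linear s t f \<Longrightarrow> Vector_Spaces.linear s t g \<Longrightarrow> Vector_Spaces.linear s t (\<lambda>x. f x - g x)"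
  by (auto simp: Vector_Spaces.linear_iff module.scale_right_diff_distrib module_iff_vector_space)

lemma lin_neg_fun:
  "Vector_Spaces.linear s t f \<Longrightarrow> Vector_Spaces.linear s t (\<lambda>x. - f x)"
  by (auto simp: Vector_Spaces.linear_iff module.scale_minus_right module_iff_vector_space)

lemma lin_zero_fun:
  "vector_space s \<Longrightarrow> vector_space t \<Longrightarrow> Vector_Spaces.linear s t (\<lambda>x. 0)"
  by (auto simp: Vector_Spaces.linear_iff module.scale_zero_right module_iff_vector_space)

lemma lin_id: "vector_space s \<Longrightarrow> Vector_Spaces.linear s s (\<lambda>x. x)"
  by (auto simp: Vector_Spaces.linear_iff)

lemma lin_scale_fun:
  "Vector_Spaces.linear s t f \<Longrightarrow> Vector_Spaces.linear s t (\<lambda>x. t c (f x))"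
  by (auto simp: Vector_Spaces.linear_iff vector_space.vector_space_assms mult.commute)

lemma lin_sum_fun:
  "vector_space s \<Longrightarrow> vector_space t \<Longrightarrow> (\<And>i. i \<in> I \<Longrightarrow> Vector_Spaces.linear s t (f i)) \<Longrightarrow>
   Vector_Spaces.linear s t (\<lambda>x. \<Sum>i\<in>I. f i x)"
  by (induction I rule: infinite_finite_induct) (simp_all add: lin_zero_fun lin_add_fun)

lemma vs_field: "vector_space ((*) :: 'f::field \<Rightarrow> 'f \<Rightarrow> 'f)"
  by unfold_locales (simp_all add: algebra_simps)

lemma ksgn_simps [simp]:
  "ksgn 0 = 1" "ksgn 1 = - 1" "ksgn (- k) = ksgn k" "ksgn k * ksgn k = 1" "ksgn (2 * k) = 1"
  by (auto simp: ksgn_def)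

lemma ksgn_add: "ksgn (k + l) = ksgn k * ksgn l"
  by (auto simp: ksgn_def)

lemma ksgn_diff: "ksgn (k - l) = ksgn k * ksgn l"
  by (auto simp: ksgn_def)

section \<open>Homogeneous components and intrinsic signs\<close>

locale cdga =
  fixes A :: "('f::field_char_0, 'a::ring_1) dg_alg"
  assumes dgca: "dgca A"
begin

lemma gs: "graded_space A" using dgca unfolding dgca_def by blast

lemma vs: "vector_space (scal A)" using gs by (simp add: graded_space_def)

sublocale V: vector_space "scal A" by (rule vs)

lemma sub_gr: "V.subspace (gr A k)" using gs by (simp add: graded_space_def)

lemmas gr_add = V.subspace_add[OF sub_gr] and gr_scale = V.subspace_scale[OF sub_gr]
  and gr_0 = V.subspace_0[OF sub_gr] and gr_neg = V.subspace_neg[OF sub_gr]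
  and gr_diff = V.subspace_diff[OF sub_gr] and gr_sum = V.subspace_sum[OF sub_gr]

lemma scal_mult_left: "scal A c x * y = scal A c (x * y)"
  and scal_mult_right: "x * scal A c y = scal A c (x * y)"
  using dgca by (metis dgca_def)+

lemma one_gr: "1 \<in> gr A 0" using dgca unfolding dgca_def by blast

lemma mult_gr: "x \<in> gr A i \<Longrightarrow> y \<in> gr A j \<Longrightarrow> x * y \<in> gr A (i + j)"
  using dgca unfolding dgca_def by blast

lemma gcomm: "x \<in> gr A i \<Longrightarrow> y \<in> gr A j \<Longrightarrow> x * y = scal A (ksgn (i * j)) (y * x)"
  using dgca unfolding dgca_def by blast

lemma lin_d: "Vector_Spaces.linear (scal A) (scal A) (diff A)"
  using dgca unfolding dgca_def by blast

lemmas d_simps [simp] = lin_rules[OF lin_d]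

lemma d_gr: "x \<in> gr A k \<Longrightarrow> diff A x \<in> gr A (k + 1)"
  using dgca unfolding dgca_def by blast

lemma dd [simp]: "diff A (diff A x) = 0" using dgca unfolding dgca_def by blast

lemma d_mult_hom: "x \<in> gr A i \<Longrightarrow> diff A (x * y) = diff A x * y + scal A (ksgn i) (x * diff A y)"
  using dgca unfolding dgca_def by blast

definition is_decomp :: "'a \<Rightarrow> (int \<Rightarrow> 'a) \<Rightarrow> bool" where
  "is_decomp x c \<longleftrightarrow> (\<forall>k. c k \<in> gr A k) \<and> finite {k. c k \<noteq> 0} \<and> x = (\<Sum>k | c k \<noteq> 0. c k)"

definition hc :: "int \<Rightarrow> 'a \<Rightarrow> 'a" where
  "hc k x = (THE c. is_decomp x c) k"

lemma ex1_decomp: "\<exists>!c. is_decomp x c"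
  using gs unfolding graded_space_def is_decomp_def by blast

lemma hc_decomp: "is_decomp x (\<lambda>k. hc k x)"
  unfolding hc_def using theI'[OF ex1_decomp, of x] by simp

lemma hc_unique: "is_decomp x c \<Longrightarrow> hc k x = c k"
  unfolding hc_def using the1_equality[OF ex1_decomp, of x c] by simp

lemma hc_gr [simp]: "hc k x \<in> gr A k" and hc_finite [simp]: "finite {k. hc k x \<noteq> 0}"
  using hc_decomp[of x] by (auto simp: is_decomp_def)

lemma hc_sum: "finite S \<Longrightarrow> {k. hc k x \<noteq> 0} \<subseteq> S \<Longrightarrow> (\<Sum>k\<in>S. hc k x) = x"
proof -
  assume "finite S" "{k. hc k x \<noteq> 0} \<subseteq> S"
  then have "(\<Sum>k\<in>S. hc k x) = (\<Sum>k | hc k x \<noteq> 0. hc k x)"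
    by (intro sum.mono_neutral_right) auto
  then show ?thesis using hc_decomp[of x] by (simp add: is_decomp_def)
qed

lemma hc_uniqueI:
  assumes "finite S" "\<And>k. c k \<in> gr A k" "\<And>k. k \<notin> S \<Longrightarrow> c k = 0" "x = (\<Sum>k\<in>S. c k)"
  shows "hc k x = c k"
proof (rule hc_unique)
  have "{k. c k \<noteq> 0} \<subseteq> S" using assms(3) by auto
  moreover from this have "(\<Sum>k\<in>S. c k) = (\<Sum>k | c k \<noteq> 0. c k)"
    using assms(1) by (intro sum.mono_neutral_right) auto
  ultimately show "is_decomp x c"
    using assms finite_subset by (auto simp: is_decomp_def)
qed

lemma hc_hom: "x \<in> gr A j \<Longrightarrow> hc k x = (if k = j then x else 0)"
  by (rule hc_uniqueI[of "{j}"]) (auto simp: gr_0)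

lemma lin_hc: "Vector_Spaces.linear (scal A) (scal A) (hc k)"
  unfolding Vector_Spaces.linear_iff
proof (intro conjI vs allI)
  fix x y
  let ?S = "{k. hc k x \<noteq> 0} \<union> {k. hc k y \<noteq> 0}"
  have "x + y = (\<Sum>k\<in>?S. hc k x + hc k y)"
    using hc_sum[of ?S x] hc_sum[of ?S y] by (simp add: sum.distrib)
  then show "hc k (x + y) = hc k x + hc k y"
    by (intro hc_uniqueI[of ?S]) (auto intro: gr_add)
next
  fix c x
  let ?S = "{k. hc k x \<noteq> 0}"
  have "scal A c x = (\<Sum>k\<in>?S. scal A c (hc k x))"
    using hc_sum[of ?S x] by (simp flip: V.scale_sum_right)
  then show "hc k (scal A c x) = scal A c (hc k x)"
    by (intro hc_uniqueI[of ?S]) (auto intro: gr_scale)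
qed

lemmas hc_simps [simp] = lin_rules[OF lin_hc]

lemma hc_eqI: "(\<And>k. hc k x = hc k y) \<Longrightarrow> x = y"
  using hc_sum[of "{k. hc k x \<noteq> 0}" x] hc_sum[of "{k. hc k x \<noteq> 0}" y] by simp

lemma gr_unique: "x \<in> gr A i \<Longrightarrow> x \<in> gr A j \<Longrightarrow> x \<noteq> 0 \<Longrightarrow> i = j"
  using hc_hom[of x i i] hc_hom[of x j i] by (auto split: if_splits)

text \<open>Every element is the finite sum of its components, so it suffices to compare linear maps
  in each degree. Most sign identities below are reduced in this way to explicit powers of
  -1.\<close>

lemma lin_ext_hom:
  assumes "Vector_Spaces.linear (scal A) t f" "Vector_Spaces.linear (scal A) t g"
    and "\<And>k x. x \<in> gr A k \<Longrightarrow> f x = g x"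
  shows "f x = g x"
proof -
  let ?S = "{k. hc k x \<noteq> 0}"
  have "f x = f (\<Sum>k\<in>?S. hc k x)" by (simp add: hc_sum)
  also have "\<dots> = (\<Sum>k\<in>?S. f (hc k x))" by (rule lin_sum[OF assms(1)])
  also have "\<dots> = (\<Sum>k\<in>?S. g (hc k x))" by (intro sum.cong refl assms(3)[OF hc_gr])
  also have "\<dots> = g (\<Sum>k\<in>?S. hc k x)" by (rule lin_sum[OF assms(2), symmetric])
  also have "\<dots> = g x" by (simp add: hc_sum)
  finally show ?thesis .
qed

lemma lin_mult_left: "Vector_Spaces.linear (scal A) (scal A) (\<lambda>x. x * y)"
  and lin_mult_right: "Vector_Spaces.linear (scal A) (scal A) (\<lambda>x. y * x)"
  using vs by (auto simp: Vector_Spaces.linear_iff scal_mult_left scal_mult_right algebra_simps)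

text \<open>The linear map \<open>x \<mapsto> (-1)\<^bsup>deg x - 1\<^esup> x\<close>. In the shifted complex all structure maps have degree 0 or 1,
  so every Koszul sign below is an application of this map.\<close>

definition sg :: "'a \<Rightarrow> 'a" where
  "sg x = (\<Sum>k | hc k x \<noteq> 0. scal A (ksgn (k - 1)) (hc k x))"

lemma hc_sg: "hc k (sg x) = scal A (ksgn (k - 1)) (hc k x)"
  by (rule hc_uniqueI[of "{k. hc k x \<noteq> 0}"]) (auto simp: sg_def gr_scale)

lemma lin_sg: "Vector_Spaces.linear (scal A) (scal A) sg"
  unfolding Vector_Spaces.linear_iff
  by (intro conjI vs allI; rule hc_eqI)
     (simp_all add: hc_sg V.scale_right_distrib V.scale_left_commute)

lemmas sg_simps [simp] = lin_rules[OF lin_sg]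

lemma sg_hom: "x \<in> gr A k \<Longrightarrow> sg x = scal A (ksgn (k - 1)) x"
  by (rule hc_eqI) (auto simp: hc_sg hc_hom)

lemma sg_gr: "x \<in> gr A k \<Longrightarrow> sg x \<in> gr A k"
  by (simp add: sg_hom gr_scale)

lemma sg_sg [simp]: "sg (sg x) = x"
  by (rule hc_eqI) (simp add: hc_sg)

lemma sg_one [simp]: "sg 1 = - 1"
  using sg_hom[OF one_gr] by (simp add: ksgn_def)

text \<open>The shifted degree of a product exceeds the sum of the shifted degrees of the factors by
  one: i + j - 1 = (i - 1) + (j - 1) + 1.\<close>

lemma sg_mult [simp]: "sg (x * y) = - (sg x * sg y)"
proof -
  have "sg (x * y) = - (sg x * sg y)" if x: "x \<in> gr A i" for x i
    by (rule lin_ext_hom[of "scal A" "\<lambda>y. sg (x * y)" "\<lambda>y. - (sg x * sg y)" y,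
          OF lin_comp[OF lin_mult_right lin_sg] lin_neg_fun[OF lin_comp[OF lin_sg lin_mult_right]]])
       (use x in \<open>simp add: sg_hom[OF mult_gr] sg_hom scal_mult_left scal_mult_right ksgn_def\<close>)
  then show ?thesis
    by (rule lin_ext_hom[of "scal A" "\<lambda>x. sg (x * y)" "\<lambda>x. - (sg x * sg y)" x,
          OF lin_comp[OF lin_mult_left lin_sg] lin_neg_fun[OF lin_comp[OF lin_sg lin_mult_left]]])
qed

lemma d_sg: "diff A (sg x) = - sg (diff A x)"
  by (rule lin_ext_hom[of "scal A" "\<lambda>x. diff A (sg x)" "\<lambda>x. - sg (diff A x)" x,
        OF lin_comp[OF lin_sg lin_d] lin_neg_fun[OF lin_comp[OF lin_d lin_sg]]])
     (auto simp: sg_hom sg_hom[OF d_gr] ksgn_def)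

lemma sg_d [simp]: "sg (diff A x) = - diff A (sg x)"
  by (simp add: d_sg)

text \<open>The Koszul sign (-1)^i is minus the shifted sign built into \<open>sg\<close>; in this
  form the Leibniz rule needs no homogeneous argument.\<close>

lemma d_mult: "diff A (x * y) = diff A x * y - sg x * diff A y"
  by (rule lin_ext_hom[of "scal A" "\<lambda>x. diff A (x * y)" "\<lambda>x. diff A x * y - sg x * diff A y" x,
        OF lin_comp[OF lin_mult_left lin_d] lin_diff_fun[OF lin_comp[OF lin_d lin_mult_left] lin_comp[OF lin_sg lin_mult_left]]])
     (auto simp: d_mult_hom sg_hom ksgn_def)

lemma d_one [simp]: "diff A 1 = 0"
  using d_mult[of 1 1] by simp

end

section \<open>Cochains on the tensor coalgebra\<close>

definition mlin ::
  "('f::field \<Rightarrow> 'a::ab_group_add \<Rightarrow> 'a) \<Rightarrow> ('f \<Rightarrow> 'c::ab_group_add \<Rightarrow> 'c) \<Rightarrow> ('a list \<Rightarrow> 'c) \<Rightarrow> bool" where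
  "mlin s t g \<longleftrightarrow> (\<forall>xs ys. Vector_Spaces.linear s t (\<lambda>x. g (xs @ x # ys)))"

lemma mlin_at: "mlin s t g \<Longrightarrow> Vector_Spaces.linear s t (\<lambda>x. g (xs @ x # ys))"
  by (simp add: mlin_def)

lemma mlin_hd: "mlin s t g \<Longrightarrow> Vector_Spaces.linear s t (\<lambda>x. g (x # ys))"
  using mlin_at[of s t g "[]"] by simp

lemma mlin_Cons: "mlin s t g \<Longrightarrow> mlin s t (\<lambda>l. g (x # l))"
  unfolding mlin_def
proof (intro allI)
  fix xs ys
  assume "\<forall>xs ys. Vector_Spaces.linear s t (\<lambda>x. g (xs @ x # ys))"
  from this[rule_format, of "x # xs" ys]
  show "Vector_Spaces.linear s t (\<lambda>y. g (x # xs @ y # ys))" by simp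
qed

lemma mlin_vs: "mlin s t g \<Longrightarrow> vector_space s" "mlin s t g \<Longrightarrow> vector_space t"
  using lin_vs[OF mlin_hd[of s t g undefined]] by auto

lemma mlinI:
  assumes "\<And>ys. Vector_Spaces.linear s t (\<lambda>x. g (x # ys))" "\<And>x. mlin s t (\<lambda>l. g (x # l))"
  shows "mlin s t g"
  unfolding mlin_def
proof (intro allI)
  fix xs ys
  show "Vector_Spaces.linear s t (\<lambda>x. g (xs @ x # ys))"
    by (cases xs) (use assms in \<open>auto simp: mlin_def\<close>)
qed

lemma mlin_add: "mlin s t g \<Longrightarrow> mlin s t k \<Longrightarrow> mlin s t (\<lambda>l. g l + k l)"
  and mlin_diff: "mlin s t g \<Longrightarrow> mlin s t k \<Longrightarrow> mlin s t (\<lambda>l. g l - k l)"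
  by (simp_all add: mlin_def lin_add_fun lin_diff_fun)

lemma mlin_zero: "vector_space s \<Longrightarrow> vector_space t \<Longrightarrow> mlin s t (\<lambda>l. 0)"
  by (simp add: mlin_def lin_zero_fun)

lemma mlin_comp: "mlin s t g \<Longrightarrow> Vector_Spaces.linear t u L \<Longrightarrow> mlin s u (\<lambda>l. L (g l))"
  unfolding mlin_def using lin_comp[of s t _ u L] by blast

lemma mlin_map: "mlin t u g \<Longrightarrow> Vector_Spaces.linear s t p \<Longrightarrow> mlin s u (\<lambda>l. g (map p l))"
  unfolding mlin_def using lin_comp[of s t p] by auto

text \<open>A function on lists stands for a family of multilinear maps, one in each arity. The operators
  \<open>opD1\<close> and \<open>opD2\<close> are precomposition with the two parts of the bar differential, \<open>opK\<close> is
  precomposition with the homotopy of the tensor trick, and \<open>conv\<close> is the convolution product.\<close>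

fun opK :: "('a \<Rightarrow> 'a) \<Rightarrow> ('a \<Rightarrow> 'a) \<Rightarrow> ('a \<Rightarrow> 'a) \<Rightarrow> ('a list \<Rightarrow> 'c::ab_group_add) \<Rightarrow> 'a list \<Rightarrow> 'c" where
  "opK s h p g [] = 0"
| "opK s h p g (x # xs) = g (h x # map p xs) + opK s h p (\<lambda>l. g (s x # l)) xs"

fun opD1 :: "('a \<Rightarrow> 'a) \<Rightarrow> ('a \<Rightarrow> 'a) \<Rightarrow> ('a list \<Rightarrow> 'c::ab_group_add) \<Rightarrow> 'a list \<Rightarrow> 'c" where
  "opD1 s d g [] = 0"
| "opD1 s d g (x # xs) = g (d x # xs) + opD1 s d (\<lambda>l. g (s x # l)) xs"

fun opD2 :: "('a \<Rightarrow> 'a::times) \<Rightarrow> ('a list \<Rightarrow> 'c::ab_group_add) \<Rightarrow> 'a list \<Rightarrow> 'c" where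
  "opD2 s g [] = 0"
| "opD2 s g [x] = 0"
| "opD2 s g (x # y # zs) = g (s x * y # zs) + opD2 s (\<lambda>l. g (s x # l)) (y # zs)"

fun conv :: "('a list \<Rightarrow> 'c::ring_1) \<Rightarrow> ('a list \<Rightarrow> 'c) \<Rightarrow> 'a list \<Rightarrow> 'c" where
  "conv f g [] = f [] * g []"
| "conv f g (x # xs) = f [] * g (x # xs) + conv (\<lambda>l. f (x # l)) g xs"

text \<open>The recursive definitions suit inductions in which g absorbs the arguments already
  passed; the closed forms suit congruence, additivity and the vanishing of single summands.\<close>

lemma opK_alt:
  "opK s h p g xs = (\<Sum>i<length xs. g (map s (take i xs) @ h (xs ! i) # map p (drop (Suc i) xs)))"
  by (induction xs arbitrary: g) (simp_all add: sum.lessThan_Suc_shift del: sum.lessThan_Suc)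

lemma opD1_alt:
  "opD1 s d g xs = (\<Sum>i<length xs. g (map s (take i xs) @ d (xs ! i) # drop (Suc i) xs))"
  by (induction xs arbitrary: g) (simp_all add: sum.lessThan_Suc_shift del: sum.lessThan_Suc)

lemma opD2_alt:
  "opD2 s g xs =
    (\<Sum>i<length xs - 1. g (map s (take i xs) @ s (xs ! i) * xs ! Suc i # drop (Suc (Suc i)) xs))"
  by (induction s g xs rule: opD2.induct)
     (simp_all add: sum.lessThan_Suc_shift del: sum.lessThan_Suc)

lemma conv_alt: "conv f g xs = (\<Sum>i\<le>length xs. f (take i xs) * g (drop i xs))"
  by (induction xs arbitrary: f) (simp_all add: sum.atMost_Suc_shift del: sum.atMost_Suc)

lemma conv_alt0:
  assumes "f [] = 0" "g [] = 0"
  shows "conv f g xs = (\<Sum>i\<in>{0<..<length xs}. f (take i xs) * g (drop i xs))"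
  unfolding conv_alt
  by (rule sum.mono_neutral_right) (use assms in \<open>auto simp: not_less le_less\<close>)

lemma opK_cong: "(\<And>l. length l = length xs \<Longrightarrow> f l = g l) \<Longrightarrow> opK s h p f xs = opK s h p g xs"
  unfolding opK_alt by (intro sum.cong) auto

lemma opD2_cong: "(\<And>l. Suc (length l) = length xs \<Longrightarrow> f l = g l) \<Longrightarrow> opD2 s f xs = opD2 s g xs"
  unfolding opD2_alt by (intro sum.cong) auto

text \<open>If both factors vanish on the empty list, a convolution only reads strictly shorter
  lists. This makes the recursion on the arity well founded.\<close>

lemma conv_cong0:
  assumes "f [] = 0" "g [] = 0" "f' [] = 0" "g' [] = 0"
    and "\<And>l. length l < length xs \<Longrightarrow> f l = f' l" "\<And>l. length l < length xs \<Longrightarrow> g l = g' l"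
  shows "conv f g xs = conv f' g' xs"
  unfolding conv_alt0[of f g, OF assms(1,2)] conv_alt0[of f' g', OF assms(3,4)]
  by (intro sum.cong) (auto simp: assms)

lemma op_add:
  "opK s h p (\<lambda>l. f l + g l) xs = opK s h p f xs + opK s h p g xs"
  "opD1 s d (\<lambda>l. f l + g l) xs = opD1 s d f xs + opD1 s d g xs"
  "opD2 s (\<lambda>l. f l + g l) ys = opD2 s f ys + opD2 s g ys"
  by (simp_all add: opK_alt opD1_alt opD2_alt sum.distrib)

lemma op_neg:
  "opK s h p (\<lambda>l. - f l) xs = - opK s h p f xs"
  "opD1 s d (\<lambda>l. - f l) xs = - opD1 s d f xs"
  "opD2 s (\<lambda>l. - f l) ys = - opD2 s f ys"
  by (simp_all add: opK_alt opD1_alt opD2_alt sum_negf)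

lemma op_diff:
  "opK s h p (\<lambda>l. f l - g l) xs = opK s h p f xs - opK s h p g xs"
  "opD1 s d (\<lambda>l. f l - g l) xs = opD1 s d f xs - opD1 s d g xs"
  "opD2 s (\<lambda>l. f l - g l) ys = opD2 s f ys - opD2 s g ys"
  by (simp_all add: opK_alt opD1_alt opD2_alt sum_subtractf)

lemma op_comp:
  assumes "Vector_Spaces.linear t u L"
  shows "opK s h p (\<lambda>l. L (f l)) xs = L (opK s h p f xs)"
  "opD1 s d (\<lambda>l. L (f l)) xs = L (opD1 s d f xs)"
  "opD2 s' (\<lambda>l. L (f l)) ys = L (opD2 s' f ys)"
  by (simp_all add: opK_alt opD1_alt opD2_alt lin_sum[OF assms])

lemma op_mult_left:
  fixes c :: "'c::ring_1"
  shows "opK s h p (\<lambda>l. c * f l) xs = c * opK s h p f xs"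
  "opD1 s d (\<lambda>l. c * f l) xs = c * opD1 s d f xs"
  "opD2 s' (\<lambda>l. c * f l) ys = c * opD2 s' f ys"
  by (simp_all add: opK_alt opD1_alt opD2_alt sum_distrib_left)

lemma conv_linear:
  "conv (\<lambda>l. f l + f' l) g xs = conv f g xs + conv f' g xs"
  "conv f (\<lambda>l. g l + g' l) xs = conv f g xs + conv f g' xs"
  "conv (\<lambda>l. f l - f' l) g xs = conv f g xs - conv f' g xs"
  "conv f (\<lambda>l. g l - g' l) xs = conv f g xs - conv f g' xs"
  "conv (\<lambda>l. - f l) g xs = - conv f g xs"
  "conv f (\<lambda>l. - g l) xs = - conv f g xs"
  "conv (\<lambda>l. c * f l) g xs = c * conv f g xs"
  "conv (\<lambda>l. 0) g xs = 0"
  "conv f (\<lambda>l. 0) xs = 0"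
  by (simp_all add: conv_alt sum.distrib sum_subtractf sum_negf sum_distrib_left algebra_simps)

lemma conv_assoc: "conv (conv f g) k xs = conv f (conv g k) xs"
  by (induction xs arbitrary: f) (simp_all add: conv_linear algebra_simps)

lemma op_lin_param:
  assumes "\<And>l. Vector_Spaces.linear u t (\<lambda>x. G x l)"
  shows "Vector_Spaces.linear u t (\<lambda>x. opK s h p (G x) xs)"
    "Vector_Spaces.linear u t (\<lambda>x. opD1 s d (G x) xs)"
  unfolding opK_alt opD1_alt by (intro lin_sum_fun lin_vs[OF assms] assms)+

lemma opD2_lin_param:
  assumes "\<And>l. Vector_Spaces.linear u t (\<lambda>x. G x l)"
  shows "Vector_Spaces.linear u t (\<lambda>x. opD2 s (G x) ys)"
  unfolding opD2_alt by (intro lin_sum_fun lin_vs[OF assms] assms)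

lemma mlin_hd_comp: "mlin t u g \<Longrightarrow> Vector_Spaces.linear s t k \<Longrightarrow> Vector_Spaces.linear s u (\<lambda>x. g (k x # l))"
  using lin_comp[OF _ mlin_hd] .

lemma mlin_opK:
  assumes "Vector_Spaces.linear u u s" "Vector_Spaces.linear u u h" "Vector_Spaces.linear u u p"
    and "mlin u t g"
  shows "mlin u t (opK s h p g)"
  unfolding mlin_def
proof (intro allI)
  fix xs ys
  show "Vector_Spaces.linear u t (\<lambda>x. opK s h p g (xs @ x # ys))"
    using assms(4)
  proof (induction xs arbitrary: g)
    case Nil
    show ?case
      by (simp, intro lin_add_fun op_lin_param mlin_hd_comp[OF Nil] assms)
  next
    case (Cons a xs)
    have "Vector_Spaces.linear u t (\<lambda>x. g (h a # map p xs @ p x # map p ys))"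
      using lin_comp[OF assms(3) mlin_at[OF Cons.prems, of "h a # map p xs" "map p ys"]] by simp
    then show ?case using Cons.IH[OF mlin_Cons[OF Cons.prems]] by (auto intro: lin_add_fun)
  qed
qed

lemma mlin_opD1:
  assumes "Vector_Spaces.linear u u s" "Vector_Spaces.linear u u d" and "mlin u t g"
  shows "mlin u t (opD1 s d g)"
  unfolding mlin_def
proof (intro allI)
  fix xs ys
  show "Vector_Spaces.linear u t (\<lambda>x. opD1 s d g (xs @ x # ys))"
    using assms(3)
  proof (induction xs arbitrary: g)
    case Nil
    show ?case
      by (simp, intro lin_add_fun op_lin_param mlin_hd_comp[OF Nil] assms)
  next
    case (Cons a xs)
    have "Vector_Spaces.linear u t (\<lambda>x. g (d a # xs @ x # ys))"
      using mlin_at[OF Cons.prems, of "d a # xs" "ys"] by simp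
    then show ?case using Cons.IH[OF mlin_Cons[OF Cons.prems]] by (auto intro: lin_add_fun)
  qed
qed

lemma mlin_conv:
  fixes f :: "'a::ab_group_add list \<Rightarrow> 'c::ring_1"
  assumes f: "mlin u t f" and g: "mlin u t g"
    and l: "\<And>y. Vector_Spaces.linear t t (\<lambda>x. x * y)" and r: "\<And>y. Vector_Spaces.linear t t (\<lambda>x. y * x)"
  shows "mlin u t (conv f g)"
  unfolding mlin_def
proof (intro allI)
  fix xs ys
  show "Vector_Spaces.linear u t (\<lambda>x. conv f g (xs @ x # ys))"
    using f
  proof (induction xs arbitrary: f)
    case Nil
    have "Vector_Spaces.linear u t (\<lambda>x. conv (\<lambda>l. f (x # l)) g ys)"
      unfolding conv_alt by (intro lin_sum_fun mlin_vs[OF Nil] lin_comp[OF mlin_hd l] Nil)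
    then show ?case by (simp add: lin_add_fun lin_comp[OF mlin_hd[OF g] r])
  next
    case (Cons a xs)
    have "Vector_Spaces.linear u t (\<lambda>x. g (a # xs @ x # ys))"
      using mlin_at[OF g, of "a # xs" "ys"] by simp
    from lin_comp[OF this r] show ?case using Cons.IH[OF mlin_Cons[OF Cons.prems]]
      by (simp add: lin_add_fun)
  qed
qed

section \<open>The bar differential and the tensor trick\<close>

context cdga
begin

abbreviation "DD1 \<equiv> opD1 sg (diff A)"
abbreviation "DD2 \<equiv> opD2 sg"

lemma mlin_DD1: "mlin (scal A) t g \<Longrightarrow> mlin (scal A) t (DD1 g)"
  by (rule mlin_opD1[OF lin_sg lin_d])

lemma mlin_DD2:
  assumes "mlin (scal A) t g"
  shows "mlin (scal A) t (DD2 g)"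
  unfolding mlin_def
proof (intro allI)
  fix xs ys
  show "Vector_Spaces.linear (scal A) t (\<lambda>x. DD2 g (xs @ x # ys))"
    using assms
  proof (induction xs arbitrary: g)
    case Nil
    show ?case
    proof (cases ys)
      case Nil
      then show ?thesis using lin_zero_fun mlin_vs[OF assms] by auto
    next
      case (Cons y zs)
      then show ?thesis
        by (simp, intro lin_add_fun opD2_lin_param mlin_hd_comp[OF Nil(1)] lin_sg
            lin_comp[OF lin_sg lin_mult_left])
    qed
  next
    case (Cons a xs)
    have IH: "Vector_Spaces.linear (scal A) t (\<lambda>x. DD2 (\<lambda>l. g (sg a # l)) (xs @ x # ys))"
      by (rule Cons.IH[OF mlin_Cons[OF Cons.prems]])
    show ?case
    proof (cases xs)
      case Nil
      then show ?thesis using IH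
        by (simp add: lin_add_fun mlin_hd_comp[OF Cons.prems lin_mult_right])
    next
      case (Cons b bs)
      have "Vector_Spaces.linear (scal A) t (\<lambda>x. g (sg a * b # bs @ x # ys))"
        using mlin_at[OF \<open>mlin (scal A) t g\<close>, of "sg a * b # bs" "ys"] by simp
      then show ?thesis using IH Cons by (auto intro!: lin_add_fun)
    qed
  qed
qed

text \<open>Together with the next two lemmas this says that the bar differential squares to zero,
  split by the number of products: d d = 0, the Leibniz rule, and associativity. The mixed terms
  cancel because \<open>diff A\<close> anticommutes with \<open>sg\<close>.\<close>

lemma DD1_DD1: "mlin (scal A) t g \<Longrightarrow> DD1 (DD1 g) xs = 0"
proof (induction xs arbitrary: g)
  case (Cons x xs)
  note L = lin_rules[OF mlin_hd[OF Cons.prems]]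
  show ?case
    using Cons.IH[OF mlin_Cons[OF Cons.prems]] by (simp add: op_add op_neg L)
qed simp

lemma DD1_DD2: "mlin (scal A) t g \<Longrightarrow> DD1 (DD2 g) xs + DD2 (DD1 g) xs = 0"
proof (induction xs arbitrary: g)
  case (Cons x xs)
  note L = lin_rules[OF mlin_hd[OF Cons.prems]]
  have IH: "DD1 (DD2 (\<lambda>l. g (x # l))) xs + DD2 (DD1 (\<lambda>l. g (x # l))) xs = 0"
    by (rule Cons.IH[OF mlin_Cons[OF Cons.prems]])
  show ?case
  proof (cases xs)
    case Nil
    then show ?thesis by simp
  next
    case (Cons y zs)
    show ?thesis using IH
      by (simp add: Cons op_add op_neg L d_mult algebra_simps)
  qed
qed simp

lemma DD2_DD2: "mlin (scal A) t g \<Longrightarrow> DD2 (DD2 g) xs = 0"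
proof (induction xs arbitrary: g)
  case (Cons x xs)
  note L = lin_rules[OF mlin_hd[OF Cons.prems]]
  have IH: "DD2 (DD2 (\<lambda>l. g (x # l))) xs = 0"
    by (rule Cons.IH[OF mlin_Cons[OF Cons.prems]])
  show ?case
  proof (cases xs)
    case Nil
    then show ?thesis by simp
  next
    case (Cons y ys)
    show ?thesis
    proof (cases ys)
      case Nil
      then show ?thesis using \<open>xs = y # ys\<close> by simp
    next
      case (Cons z zs)
      show ?thesis using IH
        by (simp add: Cons \<open>xs = y # ys\<close> op_add op_neg L algebra_simps flip: mult.assoc)
    qed
  qed
qed simp

text \<open>The bar differential is a coderivation, so precomposition with it is a derivation of the
  convolution product; passing the first block costs the Koszul sign \<open>map sg\<close>.\<close>

lemma DD1_conv:
  fixes f :: "'a list \<Rightarrow> 'c::ring_1"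
  shows "DD1 (conv f g) xs = conv (DD1 f) g xs + conv (\<lambda>l. f (map sg l)) (DD1 g) xs"
  by (induction xs arbitrary: f) (simp_all add: op_add op_mult_left conv_linear algebra_simps)

lemma DD2_conv:
  fixes f :: "'a list \<Rightarrow> 'c::ring_1"
  shows "DD2 (conv f g) xs = conv (DD2 f) g xs + conv (\<lambda>l. f (map sg l)) (DD2 g) xs"
proof (induction xs arbitrary: f)
  case (Cons x xs)
  show ?case
  proof (cases xs)
    case (Cons y ys)
    then show ?thesis using Cons.IH[of "\<lambda>l. f (sg x # l)"]
      by (simp add: op_add op_mult_left conv_linear algebra_simps)
  qed simp
qed simp

text \<open>The homotopies on the single factors telescope: the first slot contributes the
  difference between x and \<open>p x\<close>, the induction hypothesis the differences in the later
  slots. All other terms cancel in pairs or contain \<open>d\<close> next to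
  \<open>p\<close>.\<close>

lemma DD1_opK:
  assumes p: "Vector_Spaces.linear (scal A) (scal A) p" and dp: "\<And>x. diff A (p x) = 0" and pd: "\<And>x. p (diff A x) = 0"
    and sp: "\<And>x. sg (p x) = p (sg x)" and sh: "\<And>x. h (sg x) = - sg (h x)"
    and dh: "\<And>x. diff A (h x) + h (diff A x) = x - p x"
  shows "mlin (scal A) t g \<Longrightarrow> DD1 (opK sg h p g) xs + opK sg h p (DD1 g) xs = g xs - g (map p xs)"
proof (induction xs arbitrary: g)
  case (Cons x xs)
  note L = lin_rules[OF mlin_hd[OF Cons.prems]]
  have IH: "DD1 (opK sg h p (\<lambda>l. g (x # l))) xs + opK sg h p (DD1 (\<lambda>l. g (x # l))) xs
    = g (x # xs) - g (x # map p xs)"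
    by (rule Cons.IH[OF mlin_Cons[OF Cons.prems]])
  have z: "DD1 f (map p zs) = 0" if "mlin (scal A) t f" for f and zs :: "'a list"
    using that
  proof (induction zs arbitrary: f)
    case (Cons z zs)
    then show ?case using lin_0[OF mlin_hd[OF Cons.prems]] by (simp add: dp mlin_Cons)
  qed simp
  have z1: "DD1 (\<lambda>l. f (map p l)) zs = 0" if "mlin (scal A) t f" for f and zs :: "'a list"
    using that
  proof (induction zs arbitrary: f)
    case (Cons z zs)
    have "mlin (scal A) t (\<lambda>l. f (p (sg z) # l))" using Cons.prems by (rule mlin_Cons)
    then show ?case using lin_0[OF mlin_hd[OF Cons.prems]] Cons.IH[of "\<lambda>l. f (p (sg z) # l)"]
      by (simp add: pd)
  qed simp
  have "g (diff A (h x) # map p xs) + g (h (diff A x) # map p xs) = g (x # map p xs) - g (p x # map p xs)"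
    using dh[of x] by (simp flip: L)
  moreover have "DD1 (\<lambda>l. g (sg (h x) # map p l)) xs = 0"
    by (rule z1[OF mlin_Cons[OF Cons.prems]])
  ultimately show ?case using IH
    by (simp add: op_add op_neg op_diff L z mlin_Cons Cons.prems sh algebra_simps)
      (metis (no_types, lifting) add.assoc)
qed simp

end

section \<open>Hodge decompositions and Poincare duality\<close>

context cdga
begin

lemma cls_shift: "cls A (x + diff A y) = cls A x"
proof -
  have "\<exists>y'. x + diff A y + diff A z = x + diff A y'" for z
    by (rule exI[of _ "y + z"]) simp
  moreover have "\<exists>y'. x + diff A z = x + diff A y + diff A y'" for z
    by (rule exI[of _ "z - y"]) simp
  ultimately show ?thesis unfolding cls_def by auto
qed

lemma cls_self: "x \<in> cls A x"
  unfolding cls_def by (auto intro: exI[of _ 0])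

lemma cls_eq_iff: "cls A x = cls A y \<longleftrightarrow> x - y \<in> range (diff A)"
proof
  assume "cls A x = cls A y"
  then have "x \<in> cls A y" using cls_self[of x] by simp
  then obtain z where "x = y + diff A z" by (auto simp: cls_def)
  then show "x - y \<in> range (diff A)" by simp
next
  assume "x - y \<in> range (diff A)"
  then obtain z where "x - y = diff A z" by auto
  then have "x = y + diff A z" by (simp add: algebra_simps)
  then show "cls A x = cls A y" by (simp add: cls_shift)
qed

lemma UN_cls_const: "(\<And>y. f (x + diff A y) = C) \<Longrightarrow> (\<Union>x'\<in>cls A x. f x') = C"
  unfolding cls_def by auto

lemma coh_add: "gadd (cohomology A) (cls A x) (cls A y) = cls A (x + y)"
proof -
  have "cls A (x + diff A u + (y + diff A v)) = cls A (x + y)" for u v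
    using cls_shift[of "x + y" "u + v"] by (simp add: algebra_simps)
  then show ?thesis by (simp add: cohomology_def UN_cls_const)
qed

lemma coh_scale: "gscale (cohomology A) c (cls A x) = cls A (scal A c x)"
proof -
  have "cls A (scal A c (x + diff A u)) = cls A (scal A c x)" for u
    using cls_shift[of "scal A c x" "scal A c u"] by (simp add: V.scale_right_distrib)
  then show ?thesis by (simp add: cohomology_def UN_cls_const)
qed

lemma coh_mult:
  assumes "diff A x = 0" "diff A y = 0"
  shows "gmult (cohomology A) (cls A x) (cls A y) = cls A (x * y)"
proof -
  have "cls A ((x + diff A u) * (y + diff A v)) = cls A (x * y)" for u v
  proof -
    \<comment> \<open>The primitive of the difference uses that x and y are closed;
      \<open>sg x * v\<close> carries the sign of the Leibniz rule.\<close>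
    have "(x + diff A u) * (y + diff A v) = x * y + diff A (u * y - sg x * v + u * diff A v)"
      using assms by (simp add: d_mult d_sg algebra_simps)
    then show ?thesis by (simp only: cls_shift)
  qed
  then show ?thesis by (simp add: cohomology_def UN_cls_const)
qed

lemma coh_zero: "gzero (cohomology A) = cls A 0" and coh_one: "gone (cohomology A) = cls A 1"
  by (simp_all add: cohomology_def)

lemma coh_part: "gpart (cohomology A) k = cls A ` (cocycles A \<inter> gr A k)"
  by (simp add: cohomology_def)

lemma coh_partE:
  assumes "X \<in> gpart (cohomology A) k"
  obtains x where "X = cls A x" "diff A x = 0" "x \<in> gr A k"
  using assms by (auto simp: coh_part cocycles_def)

lemma coh_partI: "diff A x = 0 \<Longrightarrow> x \<in> gr A k \<Longrightarrow> cls A x \<in> gpart (cohomology A) k"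
  by (auto simp: coh_part cocycles_def)

lemma d_hc: "diff A (hc k x) = hc (k + 1) (diff A x)"
  by (rule lin_ext_hom[of "scal A" "\<lambda>x. diff A (hc k x)" "\<lambda>x. hc (k + 1) (diff A x)" x,
        OF lin_comp[OF lin_hc lin_d] lin_comp[OF lin_d lin_hc]])
     (auto simp: hc_hom hc_hom[OF d_gr])

lemma graded_hc:
  assumes "graded_subspace A S" "x \<in> S"
  shows "hc k x \<in> S"
proof -
  have S: "V.subspace S" and e: "S = V.span (\<Union>j. S \<inter> gr A j)"
    using assms by (auto simp: graded_subspace_def)
  have "x \<in> V.span (\<Union>j. S \<inter> gr A j)" using assms e by simp
  then show ?thesis
  proof (induction rule: V.span_induct_alt)
    case base
    then show ?case using V.subspace_0[OF S] by simp
  next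
    case (step c y z)
    then have "hc k y \<in> S" using V.subspace_0[OF S] by (auto simp: hc_hom)
    with step show ?case by (auto intro!: V.subspace_add[OF S] V.subspace_scale[OF S])
  qed
qed

lemma graded_sg:
  assumes "graded_subspace A S" "x \<in> S"
  shows "sg x \<in> S"
proof -
  have S: "V.subspace S" using assms by (auto simp: graded_subspace_def)
  show ?thesis unfolding sg_def
    by (intro V.subspace_sum[OF S] V.subspace_scale[OF S] graded_hc[OF assms])
qed

lemma sg_deg:
  assumes "Vector_Spaces.linear (scal A) (scal A) f" "\<And>k x. x \<in> gr A k \<Longrightarrow> f x \<in> gr A (k + q)"
  shows "f (sg x) = scal A (ksgn q) (sg (f x))"
  by (rule lin_ext_hom[of "scal A" "\<lambda>x. f (sg x)" "\<lambda>x. scal A (ksgn q) (sg (f x))" x,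
        OF lin_comp[OF lin_sg assms(1)] lin_scale_fun[OF lin_comp[OF assms(1) lin_sg]]])
     (auto simp: sg_hom sg_hom[OF assms(2)] lin_rules[OF assms(1)] ksgn_def)

end

section \<open>Contraction onto the harmonic subspace and Poincare duality\<close>

locale hodge = cdga A for A :: "('f::field_char_0, 'a::ring_1) dg_alg" +
  fixes n :: nat and I :: "'a set \<Rightarrow> 'f" and Hs Bs :: "'a set" and i :: "'a set \<Rightarrow> 'a" and r :: nat
  assumes r1: "r > 1" and n5: "n \<le> 5 * r - 3"
    and poin: "poincare_dgca A n I" and conn: "s_connected A (r - 1)"
    and adap: "adapted_hodge_decomposition A n I Hs Bs i"
begin

abbreviation "HA \<equiv> cohomology A"
abbreviation "pr \<equiv> harm_proj A Hs Bs"
abbreviation "hm \<equiv> dminus A Hs Bs"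

lemma hd: "hodge_decomposition A n I Hs Bs"
  using adap unfolding adapted_hodge_decomposition_def by blast

lemma gH: "graded_subspace A Hs" and gB: "graded_subspace A Bs"
  and cocyc: "cocycles A = {e + h | e h. e \<in> range (diff A) \<and> h \<in> Hs}"
  using hd by (auto simp: hodge_decomposition_def harmonic_subspace_def)

lemma sH: "V.subspace Hs" and sB: "V.subspace Bs"
  using gH gB by (auto simp: graded_subspace_def)

lemmas H_rules [simp] = V.subspace_0[OF sH] V.subspace_add[OF sH] V.subspace_diff[OF sH]
  V.subspace_neg[OF sH] V.subspace_scale[OF sH] V.subspace_sum[OF sH] graded_hc[OF gH] graded_sg[OF gH]
lemmas B_rules [simp] = V.subspace_0[OF sB] V.subspace_add[OF sB] V.subspace_diff[OF sB]
  V.subspace_neg[OF sB] V.subspace_scale[OF sB] V.subspace_sum[OF sB] graded_hc[OF gB] graded_sg[OF gB]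

lemma gr_out: "k < 0 \<or> int n < k \<Longrightarrow> gr A k = {0}"
  using poin unfolding poincare_dgca_def by blast

lemma d_H: "x \<in> Hs \<Longrightarrow> diff A x = 0"
proof -
  assume "x \<in> Hs"
  then have "0 + x \<in> cocycles A" unfolding cocyc using rangeI[of "diff A" 0] by (metis (mono_tags, lifting) d_simps(4) mem_Collect_eq)
  then show ?thesis by (simp add: cocycles_def)
qed

lemma ex1_dec: "\<exists>!p. p \<in> range (diff A) \<times> Hs \<times> Bs \<and> x = fst p + fst (snd p) + snd (snd p)"
  using hd unfolding hodge_decomposition_def by (elim conjE) (erule spec)

lemma HB_pairing:
  "\<forall>k l. \<forall>x\<in>gr A k. \<forall>y\<in>gr A l.
     x \<in> {h + b | h b. h \<in> Hs \<and> b \<in> Bs} \<longrightarrow> y \<in> Bs \<longrightarrow> dg_pairing A n I k l x y = 0"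
  using hd unfolding hodge_decomposition_def by (elim conjE)

lemma dec_unique:
  assumes "diff A u + h + b = diff A u' + h' + b'" "h \<in> Hs" "b \<in> Bs" "h' \<in> Hs" "b' \<in> Bs"
  shows "diff A u = diff A u'" "h = h'" "b = b'"
proof -
  let ?P = "\<lambda>p. p \<in> range (diff A) \<times> Hs \<times> Bs \<and> diff A u + h + b = fst p + fst (snd p) + snd (snd p)"
  have "?P (diff A u, h, b)" "?P (diff A u', h', b')" using assms by simp_all
  with ex1_dec[of "diff A u + h + b"] have "(diff A u, h, b) = (diff A u', h', b')" by blast
  then show "diff A u = diff A u'" "h = h'" "b = b'" by auto
qed

text \<open>A closed element of \<open>Bs\<close> is also a sum of an exact and a harmonic element,
  so directness of the decomposition forces it to vanish.\<close>

lemma d_inj_B: assumes "b \<in> Bs" "diff A b = 0" shows "b = 0"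
proof -
  have "b \<in> cocycles A" using assms by (simp add: cocycles_def)
  then obtain u h where "b = diff A u + h" "h \<in> Hs" unfolding cocyc by auto
  then show ?thesis using dec_unique(3)[of u h 0 0 0 b] assms by simp
qed

lemma ex_dec0: "\<exists>e h b. x = diff A e + h + b \<and> h \<in> Hs \<and> b \<in> Bs"
proof -
  obtain p where "p \<in> range (diff A) \<times> Hs \<times> Bs" "x = fst p + fst (snd p) + snd (snd p)"
    using ex1_implies_ex[OF ex1_dec[of x]] by blast
  then show ?thesis by (cases p) auto
qed

lemma ex_dec: "\<exists>u h b. x = diff A u + h + b \<and> u \<in> Bs \<and> h \<in> Hs \<and> b \<in> Bs"
proof -
  obtain e h b where x: "x = diff A e + h + b" "h \<in> Hs" "b \<in> Bs"
    using ex_dec0 by blast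
  \<comment> \<open>Decompose the primitive as well: only its \<open>Bs\<close> part contributes to
    \<open>diff A e\<close>, so the primitive can be taken in \<open>Bs\<close>.\<close>
  obtain e' h' u where e: "e = diff A e' + h' + u" "h' \<in> Hs" "u \<in> Bs"
    using ex_dec0 by blast
  have "diff A e = diff A u" by (subst e(1)) (simp add: d_H e(2))
  with x e(3) show ?thesis by auto
qed

lemma pr_hm_eq:
  assumes "x = diff A u + h + b" "u \<in> Bs" "h \<in> Hs" "b \<in> Bs"
  shows "pr x = h" "hm x = u"
proof -
  show "pr x = h" unfolding harm_proj_def
  proof (rule the_equality)
    show "h \<in> Hs \<and> (\<exists>e\<in>range (diff A). \<exists>b\<in>Bs. x = e + h + b)" using assms by auto
    fix h' assume "h' \<in> Hs \<and> (\<exists>e\<in>range (diff A). \<exists>b\<in>Bs. x = e + h' + b)"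
    then obtain e b' where "h' \<in> Hs" "b' \<in> Bs" "x = diff A e + h' + b'" by blast
    then show "h' = h" using assms dec_unique(2)[of e h' b' u h b] by simp
  qed
  show "hm x = u" unfolding dminus_def
  proof (rule the_equality)
    show "u \<in> Bs \<and> (\<exists>h\<in>Hs. \<exists>b'\<in>Bs. x = diff A u + h + b')" using assms by auto
    fix v assume v: "v \<in> Bs \<and> (\<exists>h\<in>Hs. \<exists>b'\<in>Bs. x = diff A v + h + b')"
    then obtain h' b' where "h' \<in> Hs" "b' \<in> Bs" "x = diff A v + h' + b'" by blast
    then have "diff A v = diff A u" using assms dec_unique(1)[of v h' b' u h b] by simp
    then show "v = u" using d_inj_B[of "v - u"] v assms by simp
  qed
qed

lemma dec: "\<exists>b\<in>Bs. x = diff A (hm x) + pr x + b" and hm_B [simp]: "hm x \<in> Bs" and pr_H [simp]: "pr x \<in> Hs"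
proof -
  obtain u h b where x: "x = diff A u + h + b" "u \<in> Bs" "h \<in> Hs" "b \<in> Bs"
    using ex_dec by blast
  from pr_hm_eq[OF this] this show "\<exists>b\<in>Bs. x = diff A (hm x) + pr x + b" "hm x \<in> Bs" "pr x \<in> Hs" by auto
qed

lemma lin_pr: "Vector_Spaces.linear (scal A) (scal A) pr" and lin_hm: "Vector_Spaces.linear (scal A) (scal A) hm"
proof -
  have "pr (x + y) = pr x + pr y \<and> hm (x + y) = hm x + hm y" for x y
  proof -
    obtain b c where b: "b \<in> Bs" "x = diff A (hm x) + pr x + b" "c \<in> Bs" "y = diff A (hm y) + pr y + c"
      using dec by meson
    then have "x + y = diff A (hm x + hm y) + (pr x + pr y) + (b + c)"
      by (metis (no_types, lifting) add.assoc add.left_commute d_simps(1))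
    from pr_hm_eq[OF this] show ?thesis using b by simp
  qed
  moreover have "pr (scal A a x) = scal A a (pr x) \<and> hm (scal A a x) = scal A a (hm x)" for x a
  proof -
    obtain b where b: "b \<in> Bs" "x = diff A (hm x) + pr x + b"
      using dec by meson
    then have "scal A a x = diff A (scal A a (hm x)) + scal A a (pr x) + scal A a b"
      by (metis V.scale_right_distrib d_simps(5))
    from pr_hm_eq[OF this] show ?thesis using b by simp
  qed
  ultimately show "Vector_Spaces.linear (scal A) (scal A) pr" "Vector_Spaces.linear (scal A) (scal A) hm"
    by (auto simp: Vector_Spaces.linear_iff vs)
qed

lemmas pr_simps [simp] = lin_rules[OF lin_pr]
lemmas hm_simps [simp] = lin_rules[OF lin_hm]

lemma pr_id [simp]: "x \<in> Hs \<Longrightarrow> pr x = x" and hm_H [simp]: "x \<in> Hs \<Longrightarrow> hm x = 0"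
  using pr_hm_eq[of x 0 x 0] by auto

lemma pr_B [simp]: "x \<in> Bs \<Longrightarrow> pr x = 0" and hm_on_B [simp]: "x \<in> Bs \<Longrightarrow> hm x = 0"
  using pr_hm_eq[of x 0 0 x] by auto

lemma pr_d [simp]: "pr (diff A x) = 0"
proof -
  obtain b where b: "b \<in> Bs" "x = diff A (hm x) + pr x + b" using dec by meson
  from b(2) have "diff A x = diff A (diff A (hm x) + pr x + b)" by simp
  then have "diff A x = diff A b + 0 + 0" by (simp add: d_H)
  from pr_hm_eq[OF this] b show ?thesis by auto
qed

lemma d_pr [simp]: "diff A (pr x) = 0" by (simp add: d_H)

text \<open>For x = d u + h + b with u and b in \<open>Bs\<close>, the first summand on the left is
  d u and the second is b, because x and b have the same differential.\<close>

lemma dh: "diff A (hm x) + hm (diff A x) = x - pr x"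
proof -
  obtain b where b: "b \<in> Bs" "x = diff A (hm x) + pr x + b" using dec by meson
  from b(2) have "hm (diff A x) = hm (diff A (diff A (hm x) + pr x + b))" by simp
  also have "\<dots> = hm (diff A b)" by (simp add: d_H)
  also have "\<dots> = b" using pr_hm_eq(2)[of "diff A b" b 0 0] b by simp
  finally show ?thesis using b(2) by (metis add_diff_cancel_left' add_diff_eq diff_add_eq add.commute)
qed

lemma d_hm: "diff A (hm x) = x - pr x - hm (diff A x)"
  using dh[of x] by (simp add: algebra_simps)

lemma d_hm_closed: "diff A x = 0 \<Longrightarrow> diff A (hm x) = x - pr x"
  by (simp add: d_hm)

lemma cls_pr: "diff A x = 0 \<Longrightarrow> cls A (pr x) = cls A x"
  using cls_shift[of "pr x" "hm x"] by (simp add: d_hm_closed)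

lemma cls_eq_pr: "diff A x = 0 \<Longrightarrow> diff A y = 0 \<Longrightarrow> cls A x = cls A y \<longleftrightarrow> pr x = pr y"
proof
  assume "diff A x = 0" "diff A y = 0" "cls A x = cls A y"
  then obtain z where "x - y = diff A z" by (auto simp: cls_eq_iff)
  then have "pr (x - y) = 0" by simp
  then show "pr x = pr y" by simp
next
  assume "diff A x = 0" "diff A y = 0" "pr x = pr y"
  then show "cls A x = cls A y" by (metis cls_pr)
qed

lemma
  assumes "x \<in> gr A k"
  shows pr_gr: "pr x \<in> gr A k" and hm_gr: "hm x \<in> gr A (k - 1)"
proof -
  obtain b where b: "b \<in> Bs" "x = diff A (hm x) + pr x + b" using dec by meson
  \<comment> \<open>Taking degree k components in the decomposition of a homogeneous x gives another
    decomposition of x, and decompositions are unique.\<close>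
  have "x = hc k (diff A (hm x) + pr x + b)" using b(2) hc_hom[OF assms, of k] by simp
  also have "\<dots> = diff A (hc (k - 1) (hm x)) + hc k (pr x) + hc k b" by (simp add: d_hc)
  finally have "x = diff A (hc (k - 1) (hm x)) + hc k (pr x) + hc k b" .
  from pr_hm_eq[OF this] have "pr x = hc k (pr x)" "hm x = hc (k - 1) (hm x)" using b by auto
  then show "pr x \<in> gr A k" "hm x \<in> gr A (k - 1)" by (metis hc_gr)+
qed

lemma sg_pr: "sg (pr x) = pr (sg x)"
  using sg_deg[OF lin_pr, of 0] by (simp add: pr_gr)

lemma hm_sg: "hm (sg x) = - sg (hm x)"
  using sg_deg[OF lin_hm, of "- 1"] by (simp add: hm_gr)

lemma hc_out: "k < 0 \<or> int n < k \<Longrightarrow> hc k x = 0"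
  using gr_out[of k] hc_gr[of k x] by auto

lemma hc_sum_n: "(\<Sum>k\<in>{0..int n}. hc k x) = x"
  by (rule hc_sum) (use hc_out in \<open>auto simp: not_less[symmetric]\<close>)

lemma d_top: "x \<in> gr A (int n) \<Longrightarrow> diff A x = 0"
  using d_gr[of x "int n"] gr_out[of "int n + 1"] by auto

lemma split: "splitting_on A (gpart HA) i" and H_span: "Hs = V.span (\<Union>k. i ` gpart HA k)"
  using adap by (auto simp: adapted_hodge_decomposition_def adapted_section_def)

lemma i_gr: "X \<in> gpart HA k \<Longrightarrow> i X \<in> gr A k" and cls_i: "X \<in> gpart HA k \<Longrightarrow> cls A (i X) = X"
  using split by (auto simp: splitting_on_def)

lemma i_H: "X \<in> gpart HA k \<Longrightarrow> i X \<in> Hs"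
  unfolding H_span by (auto intro: V.span_base)

lemma i_cls: assumes "x \<in> Hs" "x \<in> gr A k" shows "i (cls A x) = x"
proof -
  have p: "cls A x \<in> gpart HA k" using assms by (intro coh_partI) (auto simp: d_H)
  have "pr (i (cls A x)) = pr x"
    using cls_i[OF p] i_H[OF p] assms by (subst cls_eq_pr[symmetric]) (auto simp: d_H)
  then show ?thesis using i_H[OF p] assms by simp
qed

lemma i_cls_closed: assumes "diff A x = 0" "x \<in> gr A k" shows "i (cls A x) = pr x"
  using i_cls[of "pr x" k] pr_gr[OF assms(2)] cls_pr[OF assms(1)] by simp

lemma coh_partE':
  assumes "X \<in> gpart HA k"
  obtains x where "X = cls A x" "x \<in> Hs" "x \<in> gr A k" "i X = x"
  using assms cls_i i_H i_gr by metis

lemma coh_partI': "x \<in> Hs \<Longrightarrow> x \<in> gr A k \<Longrightarrow> cls A x \<in> gpart HA k"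
  by (simp add: coh_partI d_H)

text \<open>The homotopy sends 1 to degree -1, where the algebra vanishes; a closed element killed
  by the homotopy equals its harmonic part.\<close>

lemma one_H [simp]: "1 \<in> Hs"
proof -
  have "hm 1 = 0" using hm_gr[OF one_gr] gr_out[of "-1"] by auto
  then have "1 = pr 1" using dh[of 1] by simp
  then show ?thesis using pr_H[of 1] by metis
qed

text \<open>The integral is read off from the degree n component, which is closed because degree n +
  1 is zero. This gives a linear functional on the whole algebra, so that pairings need no degree
  condition.\<close>

definition J :: "'a \<Rightarrow> 'f" where "J x = I (cls A (hc (int n) x))"

lemma poa: "poincare_algebra HA n I" using poin by (simp add: poincare_dgca_def)

lemma I_add: "\<forall>x\<in>gpart HA (int n). \<forall>y\<in>gpart HA (int n). I (gadd HA x y) = I x + I y"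
  using poa unfolding poincare_algebra_def by (elim conjE)

lemma I_scale: "\<forall>c. \<forall>x\<in>gpart HA (int n). I (gscale HA c x) = c * I x"
  using poa unfolding poincare_algebra_def by (elim conjE)

lemma finite_gspan: "\<forall>k. \<exists>S. finite S \<and> gpart HA k = gspan HA S"
  using poa unfolding poincare_algebra_def by (elim conjE)

lemma nondeg_coh:
  "\<forall>k. \<forall>x\<in>gpart HA k. (\<forall>l. \<forall>y\<in>gpart HA l. gpairing HA n I k l x y = 0) \<longrightarrow> x = gzero HA"
  using poa unfolding poincare_algebra_def by (elim conjE)

lemma hcn_part: "cls A (hc (int n) x) \<in> gpart HA (int n)"
  by (intro coh_partI d_top) simp_all

lemma lin_J: "Vector_Spaces.linear (scal A) (*) J"
  unfolding Vector_Spaces.linear_iff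
proof (intro conjI allI vs vs_field)
  fix x y c
  show "J (x + y) = J x + J y"
    using bspec[OF bspec[OF I_add hcn_part] hcn_part, of x y] by (simp add: J_def coh_add)
  show "J (scal A c x) = c * J x"
    using I_scale[rule_format, OF hcn_part, of c x] by (simp add: J_def coh_scale)
qed

lemmas J_simps [simp] = lin_rules[OF lin_J]

lemma J_hom: "x \<in> gr A k \<Longrightarrow> k \<noteq> int n \<Longrightarrow> J x = 0"
  using J_simps(4) by (simp add: J_def hc_hom)

lemma J_top: "x \<in> gr A (int n) \<Longrightarrow> J x = I (cls A x)"
  by (simp add: J_def hc_hom)

lemma J_d [simp]: "J (diff A x) = 0"
proof -
  have "J (diff A x) = I (cls A (0 + diff A (hc (int n - 1) x)))"
    by (simp add: J_def d_hc)
  also have "\<dots> = I (cls A 0)" by (simp only: cls_shift)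
  also have "\<dots> = 0" using J_simps(4) by (simp add: J_def)
  finally show ?thesis .
qed

lemma J_HB: assumes "x \<in> Hs" "x' \<in> Bs" "y \<in> Bs" shows "J ((x + x') * y) = 0"
proof -
  have "J (hc k (x + x') * hc l y) = 0" for k l
  proof (cases "k + l = int n")
    case True
    have "hc k (x + x') \<in> {h + b | h b. h \<in> Hs \<and> b \<in> Bs}" using assms by fastforce
    moreover have "hc l y \<in> Bs" using assms by simp
    ultimately have "dg_pairing A n I k l (hc k (x + x')) (hc l y) = 0"
      using HB_pairing hc_gr by blast
    then show ?thesis using True J_top[of "hc k (x + x') * hc l y"] mult_gr[OF hc_gr hc_gr, of k "x + x'" l y]
      by (simp add: dg_pairing_def del: hc_simps)
  next
    case False
    then show ?thesis using J_hom[OF mult_gr[OF hc_gr hc_gr]] by blast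
  qed
  moreover have "(x + x') * y = (\<Sum>k\<in>{0..int n}. \<Sum>l\<in>{0..int n}. hc k (x + x') * hc l y)"
    by (simp only: sum_product[symmetric] hc_sum_n)
  ultimately show ?thesis by (simp del: hc_simps)
qed

text \<open>In each pair of degrees graded commutativity changes a product only by a sign, so
  vanishing of the pairing passes to the opposite order.\<close>

lemma J_comm: assumes "\<And>k l. J (hc k x * hc l y) = 0" shows "J (y * x) = 0"
proof -
  have "J (hc l y * hc k x) = 0" for k l
    using assms[of k l] gcomm[OF hc_gr[of l y] hc_gr[of k x]] by simp
  moreover have "y * x = (\<Sum>k\<in>{0..int n}. \<Sum>l\<in>{0..int n}. hc k y * hc l x)"
    by (simp only: sum_product[symmetric] hc_sum_n)
  ultimately show ?thesis by simp
qed

lemma J_HB_zero [simp]: "x \<in> Hs \<Longrightarrow> y \<in> Bs \<Longrightarrow> J (x * y) = 0" "x \<in> Bs \<Longrightarrow> y \<in> Bs \<Longrightarrow> J (x * y) = 0"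
  "x \<in> Hs \<Longrightarrow> y \<in> Bs \<Longrightarrow> J (y * x) = 0"
  using J_HB[of x 0 y] J_HB[of 0 x y] J_comm[of x y] J_HB[of "hc k x" 0 "hc l y" for k l] by auto

lemma J_B [simp]: "b \<in> Bs \<Longrightarrow> J b = 0"
  using J_HB_zero(1)[of 1 b] by simp

text \<open>Exact elements integrate to zero, and \<open>Bs\<close> is orthogonal to the harmonic
  element 1; only the harmonic part is left.\<close>

lemma J_pr: "J (pr x) = J x"
proof -
  obtain b where b: "b \<in> Bs" "x = diff A (hm x) + pr x + b" using dec by meson
  from arg_cong[OF b(2), of J] show ?thesis using b(1) by simp
qed

lemma lin_expand: "Vector_Spaces.linear (scal A) t L \<Longrightarrow> L y = (\<Sum>l\<in>{0..int n}. L (hc l y))"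
  using lin_sum[of "scal A" t L "\<lambda>l. hc l y" "{0..int n}"] by (simp add: hc_sum_n)

lemma J_right: "x \<in> gr A k \<Longrightarrow> J (x * y) = J (x * hc (int n - k) y)"
proof -
  assume x: "x \<in> gr A k"
  have "J (x * y) = (\<Sum>l\<in>{0..int n}. J (x * hc l y))"
    by (rule lin_expand[OF lin_comp[OF lin_mult_right lin_J]])
  also have "\<dots> = (\<Sum>l\<in>{0..int n}. if l = int n - k then J (x * hc (int n - k) y) else 0)"
    by (intro sum.cong) (auto intro!: J_hom[OF mult_gr[OF x hc_gr]])
  also have "\<dots> = J (x * hc (int n - k) y)" using hc_out[of "int n - k" y] by auto
  finally show ?thesis .
qed

lemma J_left: "y \<in> gr A k \<Longrightarrow> J (x * y) = J (hc (int n - k) x * y)"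
proof -
  assume y: "y \<in> gr A k"
  have "J (x * y) = (\<Sum>l\<in>{0..int n}. J (hc l x * y))"
    by (rule lin_expand[OF lin_comp[OF lin_mult_left lin_J]])
  also have "\<dots> = (\<Sum>l\<in>{0..int n}. if l = int n - k then J (hc (int n - k) x * y) else 0)"
    by (intro sum.cong) (auto intro!: J_hom[OF mult_gr[OF hc_gr y]])
  also have "\<dots> = J (hc (int n - k) x * y)" using hc_out[of "int n - k" x] by auto
  finally show ?thesis .
qed

lemma nondeg_hom:
  assumes "x \<in> Hs" "x \<in> gr A k" "\<And>y. y \<in> Hs \<Longrightarrow> y \<in> gr A (int n - k) \<Longrightarrow> J (x * y) = 0"
  shows "x = 0"
proof -
  have "gpairing HA n I k l (cls A x) Y = 0" if Y: "Y \<in> gpart HA l" for l Y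
  proof (cases "k + l = int n")
    case True
    then have l: "l = int n - k" by simp
    obtain y where y: "Y = cls A y" "y \<in> Hs" "y \<in> gr A l" using Y coh_partE' by metis
    show ?thesis using assms(3)[OF y(2)] y assms J_top[of "x * y"] mult_gr[of x k y l]
      by (simp add: gpairing_def coh_mult d_H l)
  qed (simp add: gpairing_def)
  then have "cls A x = gzero HA"
    using nondeg_coh[rule_format, OF coh_partI'[OF assms(1,2)]] by blast
  then have "pr x = pr 0" using cls_eq_pr[of x 0] assms by (simp add: coh_zero d_H)
  then show ?thesis using assms by simp
qed

lemma nondeg:
  assumes "x \<in> Hs" "\<And>y. y \<in> Hs \<Longrightarrow> J (x * y) = 0"
  shows "x = 0"
proof -
  have "hc k x = 0" for k
  proof (rule nondeg_hom)
    fix y assume y: "y \<in> Hs" "y \<in> gr A (int n - k)"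
    show "J (hc k x * y) = 0" using J_left[OF y(2), of x] assms y by simp
  qed (use assms in auto)
  then show ?thesis using hc_sum_n[of x] by simp
qed

lemma nondeg_right:
  assumes "x \<in> Hs" "\<And>y. y \<in> Hs \<Longrightarrow> J (y * x) = 0"
  shows "x = 0"
proof (rule nondeg[OF assms(1)])
  fix y assume "y \<in> Hs"
  have "J (hc k y * hc l x) = 0" for k l
  proof (cases "k = int n - l")
    case True
    then show ?thesis using J_right[of "hc k y" k x] assms(2)[of "hc k y"] \<open>y \<in> Hs\<close> by simp
  next
    case False
    then show ?thesis by (intro J_hom[OF mult_gr[OF hc_gr hc_gr]]) auto
  qed
  then show "J (x * y) = 0" by (rule J_comm)
qed

lemma H_0: assumes "x \<in> Hs" "x \<in> gr A 0" obtains c where "x = scal A c 1"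
proof -
  have "bij_betw (\<lambda>c. gscale HA c (gone HA)) UNIV (gpart HA 0)"
    using conn unfolding s_connected_def by (rule conjunct1)
  then have "cls A x \<in> range (\<lambda>c. gscale HA c (gone HA))"
    using coh_partI'[OF assms] by (simp add: bij_betw_imp_surj_on)
  then obtain c where "cls A x = gscale HA c (gone HA)" by (rule rangeE)
  then have "cls A x = cls A (scal A c 1)" by (simp add: coh_one coh_scale)
  moreover have "i (cls A (scal A c 1)) = scal A c 1"
    by (rule i_cls[of _ 0]) (simp_all add: gr_scale[OF one_gr])
  ultimately have "x = scal A c 1" using i_cls[OF assms] by metis
  then show thesis by (rule that)
qed

lemma H_low: assumes "x \<in> Hs" "x \<in> gr A k" "1 \<le> k" "k < int r" shows "x = 0"
proof -
  have "k \<le> int (r - 1)" using assms(4) r1 by (simp add: of_nat_diff)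
  moreover have "\<forall>k. 1 \<le> k \<and> k \<le> int (r - 1) \<longrightarrow> gpart HA k = {gzero HA}"
    using conn unfolding s_connected_def by (rule conjunct2)
  ultimately have "gpart HA k = {gzero HA}" using assms(3) by blast
  then have "cls A x = cls A 0" using coh_partI'[OF assms(1,2)] by (simp add: coh_zero)
  then show ?thesis using i_cls[OF assms(1,2)] i_cls[of 0 0] by (simp add: gr_0)
qed

text \<open>In degree n the dual partners are the multiples of 1, so the integral alone detects a
  harmonic element.\<close>

lemma H_top: assumes "x \<in> Hs" "x \<in> gr A (int n)" "J x = 0" shows "x = 0"
proof (rule nondeg_hom[OF assms(1,2)])
  fix y assume "y \<in> Hs" "y \<in> gr A (int n - int n)"
  then obtain c where "y = scal A c 1" using H_0[of y] by auto
  then show "J (x * y) = 0" using assms by (simp add: scal_mult_right)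
qed

text \<open>The dual partners live in degree n - k, between 1 and r - 1, where connectedness leaves
  nothing.\<close>

lemma H_high: assumes "x \<in> Hs" "x \<in> gr A k" "int n - int r < k" "k < int n" shows "x = 0"
proof (rule nondeg_hom[OF assms(1,2)])
  fix y assume "y \<in> Hs" "y \<in> gr A (int n - k)"
  then have "y = 0" using assms by (intro H_low) auto
  then show "J (x * y) = 0" by simp
qed

lemma i_add: "X \<in> gpart HA k \<Longrightarrow> Y \<in> gpart HA k \<Longrightarrow> i (gadd HA X Y) = i X + i Y"
  and i_scale: "X \<in> gpart HA k \<Longrightarrow> i (gscale HA c X) = scal A c (i X)"
  using split by (auto simp: splitting_on_def)

text \<open>Each cohomology group is finitely spanned and only degrees 0 to n occur. The finite
  basis serves to represent functionals by vectors.\<close>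

lemma finite_basis_H: "\<exists>T. finite T \<and> V.independent T \<and> V.span T = Hs"
proof -
  have "\<exists>T. finite T \<and> T \<subseteq> Hs \<and> i ` gpart HA k \<subseteq> V.span T" for k
  proof -
    obtain S where S: "finite S" "gpart HA k = gspan HA S" using finite_gspan by blast
    have "i X \<in> V.span (i ` S)" if "X \<in> gspan HA S" for X
      using that
    proof (induction rule: gspan.induct)
      case zero
      show ?case using i_cls[of 0 0] by (simp add: coh_zero gr_0 V.span_zero)
    next
      case (base x)
      then show ?case by (auto intro: V.span_base)
    next
      case (add x y)
      then show ?case using i_add[of x k y] S by (auto intro: V.span_add)
    next
      case (scale x c)
      then show ?case using i_scale[of x k c] S by (auto intro: V.span_scale)
    qed
    moreover have "i ` S \<subseteq> Hs"
    proof (rule image_subsetI)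
      fix X assume "X \<in> S"
      then have "X \<in> gpart HA k" unfolding S(2) by (rule gspan.base)
      then show "i X \<in> Hs" by (rule i_H)
    qed
    moreover have "finite (i ` S)" using S(1) by simp
    ultimately show ?thesis unfolding S(2) by blast
  qed
  then obtain T where T: "\<And>k. finite (T k)" "\<And>k. T k \<subseteq> Hs" "\<And>k. i ` gpart HA k \<subseteq> V.span (T k)"
    by metis
  let ?U = "\<Union>k\<in>{0..int n}. T k"
  have "Hs \<subseteq> V.span ?U"
  proof
    fix x assume x: "x \<in> Hs"
    have "hc k x \<in> V.span ?U" if "k \<in> {0..int n}" for k
    proof -
      have "hc k x = i (cls A (hc k x))" using i_cls[of "hc k x" k] x by simp
      also have "\<dots> \<in> V.span (T k)" using T(3)[of k] coh_partI'[of "hc k x" k] x by auto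
      also have "\<dots> \<subseteq> V.span ?U" by (intro V.span_mono) (use that in auto)
      finally show ?thesis .
    qed
    then have "(\<Sum>k\<in>{0..int n}. hc k x) \<in> V.span ?U" by (rule V.span_sum)
    then show "x \<in> V.span ?U" by (simp add: hc_sum_n)
  qed
  moreover have "V.span ?U \<subseteq> Hs" using T(2) by (intro V.span_minimal sH) auto
  ultimately have U: "V.span ?U = Hs" by auto
  obtain B where "B \<subseteq> ?U" "V.independent B" "V.span B = V.span ?U"
    using V.maximal_independent_subset[of ?U] V.span_mono[of _ ?U] V.span_span[of _] V.span_mono[of ?U]
    by (metis subset_antisym)
  moreover have "finite ?U" using T(1) by auto
  ultimately show ?thesis using U finite_subset by metis
qed

text \<open>Nondegeneracy makes evaluation against finitely many independent vectors surjective.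
  Adding one vector s in the induction requires an element that is orthogonal to T and still detects
  s.\<close>

lemma riesz_indep:
  assumes "finite T" "V.independent T" "T \<subseteq> Hs"
  shows "\<exists>v\<in>Hs. \<forall>y\<in>T. J (v * y) = c y"
  using assms
proof (induction T arbitrary: c rule: finite_induct)
  case empty
  then show ?case by (intro bexI[of _ 0]) auto
next
  case (insert s T)
  have ind: "V.independent T" using insert.prems(1) V.independent_mono by blast
  have T: "T \<subseteq> Hs" "s \<in> Hs" using insert.prems by auto
  have IH: "\<exists>v\<in>Hs. \<forall>y\<in>T. J (v * y) = c y" for c by (rule insert.IH[OF ind T(1)])
  \<comment> \<open>A dual family for T: the induction hypothesis with delta functions as prescribed
    values.\<close>
  have "\<forall>z. \<exists>v. v \<in> Hs \<and> (\<forall>y\<in>T. J (v * y) = (if y = z then 1 else 0))"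
    using IH unfolding Bex_def by (rule allI)
  from choice[OF this] obtain e
    where e: "\<And>z. e z \<in> Hs" "\<And>z y. y \<in> T \<Longrightarrow> J (e z * y) = (if y = z then 1 else 0)"
    by blast
  let ?s = "s - (\<Sum>z\<in>T. scal A (J (e z * s)) z)"
  \<comment> \<open>Otherwise s minus its expansion along the dual family pairs to zero with
    everything, so s would lie in the span of T.\<close>
  have "\<exists>w\<in>Hs. (\<forall>y\<in>T. J (w * y) = 0) \<and> J (w * s) \<noteq> 0"
  proof (rule ccontr)
    assume "\<not> (\<exists>w\<in>Hs. (\<forall>y\<in>T. J (w * y) = 0) \<and> J (w * s) \<noteq> 0)"
    then have no: "\<And>w. w \<in> Hs \<Longrightarrow> (\<And>y. y \<in> T \<Longrightarrow> J (w * y) = 0) \<Longrightarrow> J (w * s) = 0" by blast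
    have "J (v * ?s) = 0" if v: "v \<in> Hs" for v
    proof -
      let ?w = "v - (\<Sum>z\<in>T. scal A (J (v * z)) (e z))"
      have "J (?w * y) = 0" if "y \<in> T" for y
      proof -
        have "J (?w * y) = J (v * y) - (\<Sum>z\<in>T. J (v * z) * J (e z * y))"
          by (simp add: left_diff_distrib sum_distrib_right scal_mult_left)
        also have "\<dots> = J (v * y) - (\<Sum>z\<in>T. if z = y then J (v * z) else 0)"
          using e(2)[OF that] by (intro arg_cong2[of _ _ _ _ minus] sum.cong) auto
        finally show ?thesis using that insert.hyps by simp
      qed
      then have "J (?w * s) = 0" using v e(1) by (intro no) auto
      then show ?thesis
        by (simp add: left_diff_distrib right_diff_distrib sum_distrib_right sum_distrib_left
            scal_mult_left scal_mult_right mult.commute)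
    qed
    then have "?s = 0" using T
      by (intro nondeg_right V.subspace_diff[OF sH] V.subspace_sum[OF sH] V.subspace_scale[OF sH]) auto
    then have "s = (\<Sum>z\<in>T. scal A (J (e z * s)) z)" by simp
    also have "\<dots> \<in> V.span T" by (intro V.span_sum V.span_scale V.span_base)
    finally have "s \<in> V.span (insert s T - {s})" using insert.hyps(2) by simp
    then show False using insert.prems(1) unfolding V.dependent_def by blast
  qed
  then obtain w where w: "w \<in> Hs" "\<And>y. y \<in> T \<Longrightarrow> J (w * y) = 0" "J (w * s) \<noteq> 0" by blast
  obtain v where v: "v \<in> Hs" "\<And>y. y \<in> T \<Longrightarrow> J (v * y) = c y" using IH[of c] by blast
  \<comment> \<open>Adding a multiple of w corrects the value at s and leaves the values on T
    untouched.\<close>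
  let ?v = "v + scal A ((c s - J (v * s)) / J (w * s)) w"
  have "J (?v * y) = c y" if "y \<in> insert s T" for y
    using that v w by (auto simp: distrib_right scal_mult_left)
  then show ?case using v(1) w(1) by (intro bexI[of _ ?v]) auto
qed

text \<open>The factor \<open>sg v\<close> builds in the shifted pairing
  \<open>J (sg v * y)\<close>, the form in which the obstructions arise.\<close>

lemma riesz_ex:
  assumes "Vector_Spaces.linear (scal A) (*) L"
  shows "\<exists>!v. v \<in> Hs \<and> (\<forall>y\<in>Hs. J (sg v * y) = L y)"
proof -
  obtain T where T: "finite T" "V.independent T" "V.span T = Hs" using finite_basis_H by blast
  have "T \<subseteq> Hs" using T(3) V.span_superset by blast
  from riesz_indep[OF T(1,2) this, of L] obtain v where v: "v \<in> Hs" "\<And>y. y \<in> T \<Longrightarrow> J (v * y) = L y" by blast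
  have "J (v * y) = L y" if "y \<in> V.span T" for y
    using that
  proof (induction rule: V.span_induct_alt)
    case base
    then show ?case by (simp add: lin_rules[OF assms])
  next
    case (step c x y)
    then show ?case using v(2) by (simp add: lin_rules[OF assms] distrib_left scal_mult_right)
  qed
  then have ex: "sg v \<in> Hs \<and> (\<forall>y\<in>Hs. J (sg (sg v) * y) = L y)" using T(3) v(1) by simp
  have un: "v = w" if "v \<in> Hs \<and> (\<forall>y\<in>Hs. J (sg v * y) = L y)" "w \<in> Hs \<and> (\<forall>y\<in>Hs. J (sg w * y) = L y)" for v w
  proof -
    have "sg (v - w) = 0" using that by (intro nondeg) (auto simp: left_diff_distrib)
    then have "sg (sg (v - w)) = 0" by simp
    then show ?thesis by (simp only: sg_sg) simp
  qed
  show ?thesis by (rule ex1I[of _ "sg v"]) (use ex un in blast)+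
qed

end

section \<open>Extension to an A-infinity morphism, arity by arity\<close>

text \<open>Varying one entry keeps the length of the list, so a case distinction on the length
  preserves linearity in each slot.\<close>

lemma mlin_if: "mlin s t f \<Longrightarrow> mlin s t g \<Longrightarrow> mlin s t (\<lambda>l. if length l \<le> k then f l else g l)"
  unfolding mlin_def
proof (intro allI)
  fix xs ys
  assume "\<forall>xs ys. Vector_Spaces.linear s t (\<lambda>x. f (xs @ x # ys))" "\<forall>xs ys. Vector_Spaces.linear s t (\<lambda>x. g (xs @ x # ys))"
  then show "Vector_Spaces.linear s t (\<lambda>x. if length (xs @ x # ys) \<le> k then f (xs @ x # ys) else g (xs @ x # ys))"
    by (cases "Suc (length xs + length ys) \<le> k") simp_all
qed

lemma mlin_zero_entry: "mlin s t g \<Longrightarrow> 0 \<in> set xs \<Longrightarrow> g xs = 0"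
  using lin_0[OF mlin_at] by (metis split_list)

context cdga
begin

lemma mlin_ext_hom:
  assumes "mlin (scal A) t f" "mlin (scal A) t g"
    and "\<And>ks ys. list_all2 (\<lambda>k x. x \<in> gr A k) ks ys \<Longrightarrow> length ys = length xs \<Longrightarrow> f ys = g ys"
  shows "f xs = g xs"
  using assms
proof (induction xs arbitrary: f g)
  case Nil
  then show ?case using Nil(3)[of "[]" "[]"] by simp
next
  case (Cons x xs)
  have "f (y # xs) = g (y # xs)" if "y \<in> gr A k" for y k
  proof (rule Cons.IH[OF mlin_Cons[OF Cons.prems(1)] mlin_Cons[OF Cons.prems(2)]])
    fix ks ys assume "list_all2 (\<lambda>k x. x \<in> gr A k) ks ys" "length ys = length xs"
    then show "f (y # ys) = g (y # ys)" using Cons.prems(3)[of "k # ks" "y # ys"] that by simp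
  qed
  then show ?case
    by (rule lin_ext_hom[OF mlin_hd[OF Cons.prems(1)] mlin_hd[OF Cons.prems(2)]])
qed

lemma mlin_map_sg:
  assumes "mlin (scal A) t g" "list_all2 (\<lambda>k x. x \<in> gr A k) ks xs"
  shows "g (map sg xs) = t (ksgn (sum_list ks - int (length xs))) (g xs)"
  using assms(2,1)
proof (induction ks xs arbitrary: g rule: list_all2_induct)
  case Nil
  interpret T: vector_space t by (rule mlin_vs(2)[OF Nil])
  show ?case by simp
next
  case (Cons k ks x xs)
  interpret T: vector_space t by (rule mlin_vs(2)[OF Cons.prems])
  have "g (map sg (x # xs)) = t (ksgn (k - 1)) (g (x # map sg xs))"
    using lin_scale[OF mlin_hd[OF Cons.prems]] by (simp add: sg_hom[OF Cons.hyps(1)])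
  also have "\<dots> = t (ksgn (k - 1)) (t (ksgn (sum_list ks - int (length xs))) (g (x # xs)))"
    using Cons.IH[OF mlin_Cons[OF Cons.prems]] by simp
  finally show ?case by (simp add: ksgn_def)
qed

text \<open>The family G is arbitrary up to closure under sums, since the values of g lie in another
  algebra than its arguments.\<close>

lemma DD2_gr:
  assumes "\<And>ks ys. list_all2 (\<lambda>k x. x \<in> gr A k) ks ys \<Longrightarrow> Suc (length ys) = length xs \<Longrightarrow> g ys \<in> G (sum_list ks + q)"
    and "list_all2 (\<lambda>k x. x \<in> gr A k) ks xs" and "\<And>k. 0 \<in> G k" "\<And>k x y. x \<in> G k \<Longrightarrow> y \<in> G k \<Longrightarrow> x + y \<in> G k"
  shows "DD2 g xs \<in> G (sum_list ks + q)"
  using assms(1,2)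
proof (induction xs arbitrary: g ks q)
  case Nil
  then show ?case using assms(3) by simp
next
  case (Cons x xs)
  show ?case
  proof (cases xs)
    case Nil
    then show ?thesis using assms(3) by simp
  next
    case (Cons y zs)
    obtain k l js where ks: "ks = k # l # js" "x \<in> gr A k" "y \<in> gr A l" "list_all2 (\<lambda>k x. x \<in> gr A k) js zs"
      using Cons.prems(2) Cons by (auto simp: list_all2_Cons2)
    have "g (sg x * y # zs) \<in> G (sum_list ((k + l) # js) + q)"
      by (rule Cons.prems(1)) (use ks Cons in \<open>auto intro: mult_gr sg_gr\<close>)
    moreover have "DD2 (\<lambda>l. g (sg x # l)) xs \<in> G (sum_list (l # js) + (k + q))"
    proof (rule Cons.IH)
      fix ks' ys assume "list_all2 (\<lambda>k x. x \<in> gr A k) ks' ys" "Suc (length ys) = length xs"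
      then have "g (sg x # ys) \<in> G (sum_list (k # ks') + q)"
        by (intro Cons.prems(1)) (use ks in \<open>auto intro: sg_gr\<close>)
      then show "g (sg x # ys) \<in> G (sum_list ks' + (k + q))" by (simp add: algebra_simps)
    qed (use ks Cons in auto)
    ultimately show ?thesis using ks Cons by (auto intro: assms(4) simp: algebra_simps)
  qed
qed

lemma opK_gr:
  assumes "\<And>ks ys. list_all2 (\<lambda>k x. x \<in> gr A k) ks ys \<Longrightarrow> length ys = length xs \<Longrightarrow> g ys \<in> G (sum_list ks + q)"
    and "list_all2 (\<lambda>k x. x \<in> gr A k) ks xs" and "\<And>k. 0 \<in> G k" "\<And>k x y. x \<in> G k \<Longrightarrow> y \<in> G k \<Longrightarrow> x + y \<in> G k"
    and h: "\<And>k x. x \<in> gr A k \<Longrightarrow> h x \<in> gr A (k - 1)" and p: "\<And>k x. x \<in> gr A k \<Longrightarrow> p x \<in> gr A k"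
  shows "opK sg h p g xs \<in> G (sum_list ks + q - 1)"
  using assms(1,2)
proof (induction xs arbitrary: g ks q)
  case Nil
  then show ?case using assms(3) by simp
next
  case (Cons x xs)
  obtain k js where ks: "ks = k # js" "x \<in> gr A k" "list_all2 (\<lambda>k x. x \<in> gr A k) js xs"
    using Cons.prems(2) by (auto simp: list_all2_Cons2)
  have "list_all2 (\<lambda>k x. x \<in> gr A k) js (map p xs)"
    using ks(3) by (auto simp: list_all2_conv_all_nth p)
  then have "g (h x # map p xs) \<in> G (sum_list ((k - 1) # js) + q)"
    by (intro Cons.prems(1)) (use ks h in auto)
  moreover have "opK sg h p (\<lambda>l. g (sg x # l)) xs \<in> G (sum_list js + (k + q) - 1)"
  proof (rule Cons.IH)
    fix ks' ys assume "list_all2 (\<lambda>k x. x \<in> gr A k) ks' ys" "length ys = length xs"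
    then have "g (sg x # ys) \<in> G (sum_list (k # ks') + q)"
      by (intro Cons.prems(1)) (use ks in \<open>auto intro: sg_gr\<close>)
    then show "g (sg x # ys) \<in> G (sum_list ks' + (k + q))" by (simp add: algebra_simps)
  qed (use ks in auto)
  ultimately show ?case using ks by (auto intro: assms(4) simp: algebra_simps)
qed

end

section \<open>Defect of the A-infinity equations and its Bianchi identity\<close>

locale cdga_pair = A: cdga A + B: cdga B
  for A :: "('f::field_char_0, 'a::ring_1) dg_alg" and B :: "('f, 'b::ring_1) dg_alg"
begin

lemma conv_gr:
  assumes "f [] = 0" "g [] = (0::'b)"
    and f: "\<And>ks ys. list_all2 (\<lambda>k x. x \<in> gr A k) ks ys \<Longrightarrow> ys \<noteq> [] \<Longrightarrow> length ys < length xs \<Longrightarrow>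
      f ys \<in> gr B (sum_list ks + p - int (length ys))"
    and g: "\<And>ks ys. list_all2 (\<lambda>k x. x \<in> gr A k) ks ys \<Longrightarrow> ys \<noteq> [] \<Longrightarrow> length ys < length xs \<Longrightarrow>
      g ys \<in> gr B (sum_list ks + q - int (length ys))"
    and xs: "list_all2 (\<lambda>k x. x \<in> gr A k) ks xs"
  shows "conv f g xs \<in> gr B (sum_list ks + (p + q) - int (length xs))"
  unfolding conv_alt0[of f g, OF assms(1,2)]
proof (rule B.gr_sum)
  fix j assume j: "j \<in> {0<..<length xs}"
  have "f (take j xs) \<in> gr B (sum_list (take j ks) + p - int (length (take j xs)))"
    by (rule f) (use xs j in auto)
  moreover have "g (drop j xs) \<in> gr B (sum_list (drop j ks) + q - int (length (drop j xs)))"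
    by (rule g) (use xs j in auto)
  moreover have "sum_list (take j ks) + sum_list (drop j ks) = sum_list ks"
    by (metis append_take_drop_id sum_list_append)
  then have "(sum_list (take j ks) + p - int (length (take j xs))) + (sum_list (drop j ks) + q - int (length (drop j xs)))
    = sum_list ks + (p + q) - int (length xs)"
    using j by (simp add: of_nat_diff)
  ultimately show "f (take j xs) * g (drop j xs) \<in> gr B (sum_list ks + (p + q) - int (length xs))"
    using B.mult_gr by metis
qed

text \<open>The quadratic part of the equations. When f vanishes on the empty list, its arity k part
  only involves components of arity below k, so it is the known right-hand side when component k is
  chosen.\<close>

definition Qop :: "('a list \<Rightarrow> 'b) \<Rightarrow> 'a list \<Rightarrow> 'b" where
  "Qop f xs = conv (\<lambda>l. B.sg (f l)) f xs - A.DD2 f xs"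

text \<open>The defect of the \<open>A\<^sub>\<infinity>\<close>-equations for the shifted maps \<open>sA\<^bsup>\<otimes>k\<^esup> \<rightarrow> sB\<close> of degree 0.\<close>

definition Eop :: "('a list \<Rightarrow> 'b) \<Rightarrow> 'a list \<Rightarrow> 'b" where
  "Eop f xs = diff B (f xs) - A.DD1 f xs + Qop f xs"

lemma Qop_cong:
  assumes "f [] = 0" "g [] = 0" "\<And>l. length l < length xs \<Longrightarrow> f l = g l"
  shows "Qop f xs = Qop g xs"
  unfolding Qop_def
  by (intro arg_cong2[of _ _ _ _ minus] conv_cong0 opD2_cong) (use assms in auto)

lemma mlin_Qop: "mlin (scal A) (scal B) f \<Longrightarrow> mlin (scal A) (scal B) (Qop f)"
  unfolding Qop_def[abs_def]
  by (intro mlin_diff mlin_conv A.mlin_DD2 mlin_comp[OF _ B.lin_sg] B.lin_mult_left B.lin_mult_right)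

lemma d_conv: "diff B (conv f g xs) = conv (\<lambda>l. diff B (f l)) g xs - conv (\<lambda>l. B.sg (f l)) (\<lambda>l. diff B (g l)) xs"
  by (simp add: conv_alt B.d_mult sum_subtractf)

lemma sg_conv: "B.sg (conv f g xs) = - conv (\<lambda>l. B.sg (f l)) (\<lambda>l. B.sg (g l)) xs"
  by (simp add: conv_alt sum_negf)

text \<open>The defect is the bar differential after f minus the bar differential before f. Both
  differentials square to zero, so the defect satisfies this linear identity, as a curvature does.
  The hypothesis \<open>fsg\<close> expresses that f has shifted degree 0.\<close>

lemma bianchi:
  assumes f: "mlin (scal A) (scal B) f" and fsg: "\<And>xs. f (map A.sg xs) = B.sg (f xs)"
  shows "diff B (Eop f xs) + A.DD1 (Eop f) xs + A.DD2 (Eop f) xs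
    = - conv (\<lambda>l. B.sg (Eop f l)) f xs - conv f (Eop f) xs"
proof -
  let ?F = "conv (\<lambda>l. B.sg (f l)) f"
  have E: "Eop f = (\<lambda>l. diff B (f l) - A.DD1 f l + (?F l - A.DD2 f l))"
    by (simp add: fun_eq_iff Eop_def Qop_def)
  note opd = op_comp(2)[OF B.lin_d, of A.sg "diff A" f] op_comp(3)[OF B.lin_d, of A.sg f]
  have ops: "A.DD1 (\<lambda>l. B.sg (f l)) = (\<lambda>l. B.sg (A.DD1 f l))" "A.DD2 (\<lambda>l. B.sg (f l)) = (\<lambda>l. B.sg (A.DD2 f l))"
    by (simp_all add: fun_eq_iff op_comp[OF B.lin_sg])
  have dE: "diff B (Eop f xs) = - A.DD1 (\<lambda>l. diff B (f l)) xs - A.DD2 (\<lambda>l. diff B (f l)) xs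
      - conv (\<lambda>l. B.sg (diff B (f l))) f xs - conv f (\<lambda>l. diff B (f l)) xs"
    by (simp add: E opd d_conv B.d_sg conv_linear algebra_simps del: B.sg_d)
  have D1: "A.DD1 (Eop f) xs = A.DD1 (\<lambda>l. diff B (f l)) xs + conv (\<lambda>l. B.sg (A.DD1 f l)) f xs
      + conv f (A.DD1 f) xs - A.DD1 (A.DD2 f) xs"
    unfolding E by (simp add: op_add op_diff A.DD1_conv A.DD1_DD1[OF f] fsg ops)
  have D2: "A.DD2 (Eop f) xs = A.DD2 (\<lambda>l. diff B (f l)) xs + conv (\<lambda>l. B.sg (A.DD2 f l)) f xs
      + conv f (A.DD2 f) xs - A.DD2 (A.DD1 f) xs"
    unfolding E by (simp add: op_add op_diff A.DD2_conv A.DD2_DD2[OF f] fsg ops)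
  have c1: "conv (\<lambda>l. B.sg (Eop f l)) f xs = conv (\<lambda>l. B.sg (diff B (f l))) f xs - conv (\<lambda>l. B.sg (A.DD1 f l)) f xs
     - conv (\<lambda>l. B.sg (A.DD2 f l)) f xs - conv f ?F xs"
    unfolding E by (simp add: conv_linear sg_conv conv_assoc del: B.sg_d)
  have c2: "conv f (Eop f) xs = conv f (\<lambda>l. diff B (f l)) xs - conv f (A.DD1 f) xs
     - conv f (A.DD2 f) xs + conv f ?F xs"
    unfolding E by (simp add: conv_linear)
  show ?thesis unfolding dE D1 D2 c1 c2 using A.DD1_DD2[OF f, of xs]
    by (simp add: algebra_simps)
qed

end

locale hodge_pair = A: hodge A n I Hs Bs i r + B: hodge B n I' Hs' Bs' i' r
  for A :: "('f::field_char_0, 'a::ring_1) dg_alg" and n I Hs Bs i r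
    and B :: "('f, 'b::ring_1) dg_alg" and I' Hs' Bs' i'
begin

sublocale cdga_pair A B ..

abbreviation "KK \<equiv> opK A.sg A.hm A.pr"

lemma DD1_KK:
  "mlin (scal A) t g \<Longrightarrow> A.DD1 (KK g) xs + KK (A.DD1 g) xs = g xs - g (map A.pr xs)"
  by (rule A.DD1_opK) (simp_all add: A.lin_pr A.lin_hm A.sg_pr A.hm_sg A.dh)

lemma mlin_KK: "mlin (scal A) t g \<Longrightarrow> mlin (scal A) t (KK g)"
  by (rule mlin_opK[OF A.lin_sg A.lin_hm A.lin_pr])

end

text \<open>\<open>c\<close> collects the freely chosen harmonic parts of the components of the morphism.\<close>

locale ainf_extension = hodge_pair A n I Hs Bs i r B I' Hs' Bs' i'
  for A :: "('f::field_char_0, 'a::ring_1) dg_alg" and n I Hs Bs i r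
    and B :: "('f, 'b::ring_1) dg_alg" and I' Hs' Bs' i' +
  fixes c :: "'a list \<Rightarrow> 'b"
  assumes mlin_c: "mlin (scal A) (scal B) c" and c_Nil [simp]: "c [] = 0"
    and c_pr: "c (map A.pr xs) = c xs" and c_H [simp]: "c xs \<in> Hs'"
    and c_one: "c [1] = 1" and c_unit: "length xs \<ge> 2 \<Longrightarrow> 1 \<in> set xs \<Longrightarrow> c xs = 0"
    and c_gr: "list_all2 (\<lambda>k x. x \<in> gr A k) ks xs \<Longrightarrow> xs \<noteq> [] \<Longrightarrow> c xs \<in> gr B (sum_list ks + 1 - int (length xs))"
    and c_mult: "x \<in> Hs \<Longrightarrow> y \<in> Hs \<Longrightarrow> B.pr (B.sg (c [x]) * c [y]) = c [A.sg x * y]"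
    and c_3: "x \<in> Hs \<Longrightarrow> y \<in> Hs \<Longrightarrow> z \<in> Hs \<Longrightarrow>
      B.pr (B.sg (c [x]) * c [y, z] + B.sg (c [x, y]) * c [z]) - c [A.sg x * y, z] - c [A.sg x, A.sg y * z]
      - B.pr (B.sg (c [x]) * B.hm (B.sg (c [y]) * c [z]) + B.sg (B.hm (B.sg (c [x]) * c [y])) * c [z])
      + c [A.sg (A.hm (A.sg x * y)) * z + A.sg x * A.hm (A.sg y * z)] = 0"
    and c_J: "length xs \<ge> 2 \<Longrightarrow> B.J (c xs) = 0"
    and c_cyc: "set xs \<subseteq> Hs \<Longrightarrow> length xs = 4 \<or> length xs = 5 \<Longrightarrow>
      B.J (conv (\<lambda>l. B.sg (c l)) c xs) = 0"
begin

text \<open>\<open>F k\<close> is final on lists of length at most k; its values on longer lists are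
  provisional. In the new component, \<open>B.hm\<close> solves the equation up to the harmonic part
  of the right-hand side, and \<open>KK\<close> treats that part with the homotopy of A.\<close>

primrec F :: "nat \<Rightarrow> 'a list \<Rightarrow> 'b" where
  "F 0 = (\<lambda>xs. 0)"
| "F (Suc k) = (\<lambda>xs. if length xs \<le> k then F k xs
     else c xs + KK (\<lambda>l. B.pr (Qop (F k) l)) xs - B.hm (Qop (F k) xs))"

definition f :: "'a list \<Rightarrow> 'b" where "f xs = F (length xs) xs"

lemma F_f: "length xs \<le> k \<Longrightarrow> F k xs = f xs"
  by (induction k) (auto simp: f_def le_Suc_eq)

lemma f_Nil [simp]: "f [] = 0" by (simp add: f_def)

lemma Qop_Nil [simp]: "Qop f [] = 0" by (simp add: Qop_def)

text \<open>\<open>KK\<close> preserves the length and \<open>Qop\<close> only reads shorter lists,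
  so the stages of the recursion can be replaced by their limit f.\<close>

lemma f_eq: "f xs = c xs + KK (\<lambda>l. B.pr (Qop f l)) xs - B.hm (Qop f xs)"
proof (cases "length xs")
  case 0
  then show ?thesis by simp
next
  case (Suc k)
  have Q: "Qop (F k) l = Qop f l" if "length l = length xs" for l
    by (rule Qop_cong) (use that Suc F_f[of "[]" k] in \<open>auto simp: F_f\<close>)
  have "KK (\<lambda>l. B.pr (Qop (F k) l)) xs = KK (\<lambda>l. B.pr (Qop f l)) xs"
    by (rule opK_cong) (simp add: Q)
  then show ?thesis by (simp add: f_def Suc Q)
qed

lemma mlin_F: "mlin (scal A) (scal B) (F k)"
proof (induction k)
  case 0
  then show ?case by (simp add: mlin_zero A.vs B.vs)
next
  case (Suc k)
  then show ?case
    by (auto intro!: mlin_if mlin_add mlin_diff mlin_c mlin_KK mlin_comp[OF _ B.lin_pr]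
        mlin_comp[OF _ B.lin_hm] mlin_Qop)
qed

lemma mlin_f: "mlin (scal A) (scal B) f"
  unfolding mlin_def
proof (intro allI)
  fix xs ys
  show "Vector_Spaces.linear (scal A) (scal B) (\<lambda>x. f (xs @ x # ys))"
    using mlin_at[OF mlin_F, of "Suc (length xs + length ys)" xs ys] by (simp add: f_def)
qed

lemma mlin_Q: "mlin (scal A) (scal B) (Qop f)"
  by (rule mlin_Qop[OF mlin_f])

lemmas Q_zero = mlin_zero_entry[OF mlin_Q] and f_zero = mlin_zero_entry[OF mlin_f]

text \<open>The two degree statements go together: \<open>Qop f\<close> in arity k needs f in lower
  arities, and f in arity k needs \<open>Qop f\<close> in the same arity.\<close>

lemma f_gr: "list_all2 (\<lambda>k x. x \<in> gr A k) ks xs \<Longrightarrow> xs \<noteq> [] \<Longrightarrow> f xs \<in> gr B (sum_list ks + 1 - int (length xs))"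
  and Q_gr: "list_all2 (\<lambda>k x. x \<in> gr A k) ks xs \<Longrightarrow> xs \<noteq> [] \<Longrightarrow> Qop f xs \<in> gr B (sum_list ks + 2 - int (length xs))"
proof -
  have Q: "Qop f xs \<in> gr B (sum_list ks + 2 - int (length xs))"
    if f: "\<And>ks ys. list_all2 (\<lambda>k x. x \<in> gr A k) ks ys \<Longrightarrow> ys \<noteq> [] \<Longrightarrow> length ys < length xs \<Longrightarrow>
        f ys \<in> gr B (sum_list ks + 1 - int (length ys))"
      and xs: "list_all2 (\<lambda>k x. x \<in> gr A k) ks xs" for ks xs
  proof -
    have "conv (\<lambda>l. B.sg (f l)) f xs \<in> gr B (sum_list ks + (1 + 1) - int (length xs))"
      by (rule conv_gr) (use f xs in \<open>auto intro: B.sg_gr\<close>)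
    moreover have "A.DD2 f xs \<in> gr B (sum_list ks + (2 - int (length xs)))"
    proof (rule A.DD2_gr[OF _ xs])
      fix ks ys assume *: "list_all2 (\<lambda>k x. x \<in> gr A k) ks ys" "Suc (length ys) = length xs"
      show "f ys \<in> gr B (sum_list ks + (2 - int (length xs)))"
      proof (cases "ys = []")
        case True
        then show ?thesis by (simp add: B.gr_0)
      next
        case False
        have "sum_list ks + 1 - int (length ys) = sum_list ks + (2 - int (length xs))"
          using *(2) by linarith
        with f[OF *(1) False] *(2) show ?thesis by simp
      qed
    qed (auto intro: B.gr_0 B.gr_add)
    ultimately show ?thesis unfolding Qop_def by (intro B.gr_diff) (simp_all add: algebra_simps)
  qed
  have "f xs \<in> gr B (sum_list ks + 1 - int (length xs))"
    if "list_all2 (\<lambda>k x. x \<in> gr A k) ks xs" "xs \<noteq> []" for ks xs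
    using that
  proof (induction "length xs" arbitrary: xs ks rule: less_induct)
    case less
    have Q': "Qop f ys \<in> gr B (sum_list js + (2 - int (length xs)))"
      if "list_all2 (\<lambda>k x. x \<in> gr A k) js ys" "length ys = length xs" for js ys
      using Q[OF _ that(1)] less.hyps that(2) by (simp add: algebra_simps)
    have "KK (\<lambda>l. B.pr (Qop f l)) xs \<in> gr B (sum_list ks + (2 - int (length xs)) - 1)"
      by (rule A.opK_gr) (use Q' less.prems in \<open>auto intro: B.pr_gr B.gr_0 B.gr_add A.hm_gr A.pr_gr\<close>)
    moreover have "B.hm (Qop f xs) \<in> gr B (sum_list ks + (2 - int (length xs)) - 1)"
      by (rule B.hm_gr[OF Q']) (use less.prems in auto)
    moreover have "sum_list ks + (2 - int (length xs)) - 1 = sum_list ks + 1 - int (length xs)" by simp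
    ultimately show ?case using c_gr[OF less.prems] f_eq[of xs] by (simp add: B.gr_add B.gr_diff)
  qed
  then show "list_all2 (\<lambda>k x. x \<in> gr A k) ks xs \<Longrightarrow> xs \<noteq> [] \<Longrightarrow> f xs \<in> gr B (sum_list ks + 1 - int (length xs))"
   "list_all2 (\<lambda>k x. x \<in> gr A k) ks xs \<Longrightarrow> xs \<noteq> [] \<Longrightarrow> Qop f xs \<in> gr B (sum_list ks + 2 - int (length xs))"
    using Q by blast+
qed

lemma f_sg: "f (map A.sg xs) = B.sg (f xs)"
proof (cases "xs = []")
  case False
  show ?thesis
  proof (rule A.mlin_ext_hom[of "scal B" "\<lambda>l. f (map A.sg l)" "\<lambda>l. B.sg (f l)"])
    show "mlin (scal A) (scal B) (\<lambda>l. f (map A.sg l))" "mlin (scal A) (scal B) (\<lambda>l. B.sg (f l))"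
      by (rule mlin_map[OF mlin_f A.lin_sg] mlin_comp[OF mlin_f B.lin_sg])+
    fix ks ys assume *: "list_all2 (\<lambda>k x. x \<in> gr A k) ks ys" "length ys = length xs"
    then have "ys \<noteq> []" using False by auto
    from B.sg_hom[OF f_gr[OF *(1) this]] A.mlin_map_sg[OF mlin_f *(1)]
    show "f (map A.sg ys) = B.sg (f ys)" by (simp add: algebra_simps)
  qed
qed simp

text \<open>The free parts factor through the harmonic projection, which kills exact
  elements.\<close>

lemma DD1_c: "A.DD1 c xs = 0"
proof -
  have "c (map A.sg (take j xs) @ diff A (xs ! j) # drop (Suc j) xs) = 0" for j
  proof -
    have "c (map A.pr (map A.sg (take j xs) @ diff A (xs ! j) # drop (Suc j) xs)) = 0"
      by (rule mlin_zero_entry[OF mlin_c]) simp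
    then show ?thesis by (simp only: c_pr)
  qed
  then show ?thesis by (simp add: opD1_alt)
qed

text \<open>The homotopy built into the recursion solves the equation in the next arity up to its obstruction,
  which only sees harmonic arguments and harmonic values.\<close>

lemma Eop_step:
  assumes "\<And>l. length l < length xs \<Longrightarrow> Eop f l = 0"
  shows "Eop f xs = B.pr (Qop f (map A.pr xs))"
proof -
  \<comment> \<open>This is the Bianchi identity with vanishing defect in lower arity: the
    convolutions and \<open>DD2\<close> only see the defect on shorter lists, so the quadratic part
    is itself closed.\<close>
  have dQ: "diff B (Qop f ys) + A.DD1 (Qop f) ys = 0" if ys: "length ys = length xs" for ys
  proof -
    have E0: "Eop f [] = 0" by (simp add: Eop_def)
    have "conv (\<lambda>l. B.sg (Eop f l)) f ys = conv (\<lambda>l. 0) f ys"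
      unfolding conv_alt by (intro sum.cong refl) (use ys assms E0 in \<open>auto simp: le_less\<close>)
    moreover have "conv f (Eop f) ys = conv f (\<lambda>l. 0) ys"
      unfolding conv_alt
    proof (intro sum.cong refl)
      fix j assume "j \<in> {..length ys}"
      then show "f (take j ys) * Eop f (drop j ys) = f (take j ys) * 0"
        using assms[of "drop j ys"] ys by (cases "j = 0") auto
    qed
    moreover have "A.DD2 (Eop f) ys = A.DD2 (\<lambda>l. 0) ys"
      by (rule opD2_cong) (use assms ys in auto)
    ultimately have b: "diff B (Eop f ys) + A.DD1 (Eop f) ys = 0"
      using bianchi[OF mlin_f f_sg, of ys] by (simp add: conv_linear opD2_alt)
    have "Qop f = (\<lambda>l. Eop f l - diff B (f l) + A.DD1 f l)" by (simp add: Eop_def fun_eq_iff)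
    then show ?thesis using b
      by (simp add: op_add op_diff op_comp[OF B.lin_d] A.DD1_DD1[OF mlin_f])
  qed
  have D1f: "A.DD1 f xs = A.DD1 (KK (\<lambda>l. B.pr (Qop f l))) xs - B.hm (A.DD1 (Qop f) xs)"
  proof -
    have "f = (\<lambda>l. c l + KK (\<lambda>l. B.pr (Qop f l)) l - B.hm (Qop f l))"
      by (rule ext) (rule f_eq)
    then have "A.DD1 f xs = A.DD1 (\<lambda>l. c l + KK (\<lambda>l. B.pr (Qop f l)) l - B.hm (Qop f l)) xs" by simp
    then show ?thesis by (simp add: op_add op_diff DD1_c op_comp[OF B.lin_hm])
  qed
  \<comment> \<open>By \<open>dQ\<close>, precomposition with \<open>DD1\<close> gives an exact
    value, which \<open>pr\<close> kills. The homotopy identity then leaves the harmonic values at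
    \<open>xs\<close> and at the projected list.\<close>
  have "KK (A.DD1 (\<lambda>l. B.pr (Qop f l))) xs = KK (\<lambda>l. 0) xs"
  proof (rule opK_cong)
    fix l :: "'a list" assume "length l = length xs"
    then have "A.DD1 (Qop f) l = - diff B (Qop f l)"
      using dQ by (metis add.commute eq_neg_iff_add_eq_0)
    then show "A.DD1 (\<lambda>l. B.pr (Qop f l)) l = 0" by (simp add: op_comp[OF B.lin_pr])
  qed
  then have K0: "A.DD1 (KK (\<lambda>l. B.pr (Qop f l))) xs = B.pr (Qop f xs) - B.pr (Qop f (map A.pr xs))"
    using DD1_KK[OF mlin_comp[OF mlin_Q B.lin_pr], of xs] by (simp add: opK_alt)
  have dK: "diff B (KK (\<lambda>l. B.pr (Qop f l)) xs) = 0"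
    by (simp add: opK_alt)
  have dQ1: "A.DD1 (Qop f) xs = - diff B (Qop f xs)"
    using dQ[of xs] by (metis add.commute eq_neg_iff_add_eq_0)
  have "diff B (f xs) = - diff B (B.hm (Qop f xs))"
    by (subst f_eq) (simp add: dK B.d_H)
  then show ?thesis
    unfolding Eop_def D1f K0 dQ1 using B.dh[of "Qop f xs"] by (simp add: algebra_simps)
qed

end

section \<open>Vanishing of the obstructions\<close>

context ainf_extension
begin

section \<open>Strict unitality of the extension\<close>

lemma f_one: "f [1] = 1"
  using f_eq[of "[1]"] by (simp add: c_one Qop_def)

lemma f_single: "f [x] = c [x]"
  using f_eq[of "[x]"] by (simp add: Qop_def)

lemma unit_neg: "mlin (scal A) t g \<Longrightarrow> g (ys @ (- 1) # zs) = - g (ys @ 1 # zs)"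
  using lin_neg[OF mlin_at] by fastforce

text \<open>Multiplying 1 with its left and with its right neighbour gives the same list with
  opposite signs, so an interior unit contributes nothing; a unit at an end has only one
  neighbour.\<close>

lemma DD2_unit:
  fixes g :: "'a list \<Rightarrow> 'b"
  assumes "mlin (scal A) (scal B) g"
    and "\<And>l. 1 \<in> set l \<Longrightarrow> Suc (length l) = length (ys @ 1 # zs) \<Longrightarrow> g l = 0"
  shows "A.DD2 g (ys @ 1 # zs) =
    (if ys = [] then if zs = [] then 0 else - g zs else if zs = [] then g (map A.sg ys) else 0)"
  using assms
proof (induction ys arbitrary: g)
  case Nil
  note L = lin_rules[OF mlin_hd[OF Nil(1)]]
  show ?case
  proof (cases zs)
    case (Cons z ws)
    have "A.DD2 (\<lambda>l. g (- 1 # l)) (z # ws) = A.DD2 (\<lambda>l. 0) (z # ws)"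
    proof (rule opD2_cong)
      fix l :: "'a list" assume "Suc (length l) = length (z # ws)"
      then have "g (1 # l) = 0" using Cons by (intro Nil(2)) auto
      then show "g (- 1 # l) = 0" by (simp add: L)
    qed
    then show ?thesis using Cons by (simp add: L opD2_alt[of _ "\<lambda>l. 0"])
  qed simp
next
  case (Cons y ys)
  have IH: "A.DD2 (\<lambda>l. g (A.sg y # l)) (ys @ 1 # zs) =
    (if ys = [] then if zs = [] then 0 else - g (A.sg y # zs) else if zs = [] then g (A.sg y # map A.sg ys) else 0)"
    by (rule Cons.IH[OF mlin_Cons[OF Cons.prems(1)]]) (use Cons.prems(2) in auto)
  show ?case
  proof (cases ys)
    case Nil
    then show ?thesis using IH by simp
  next
    case (Cons b bs)
    have "g ((A.sg y * b) # bs @ 1 # zs) = 0"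
      using Cons.prems(2) Cons by auto
    then show ?thesis using IH Cons by simp
  qed
qed

text \<open>Only a split that cuts off a unit at one end of the list contributes to the convolution,
  and it cancels the end term of \<open>DD2_unit\<close>.\<close>

lemma Q_unit:
  assumes f: "\<And>l. 1 \<in> set l \<Longrightarrow> 2 \<le> length l \<Longrightarrow> length l < length xs \<Longrightarrow> f l = 0"
    and xs: "1 \<in> set xs"
  shows "Qop f xs = 0"
proof (cases "length xs \<le> 2")
  case True
  consider "xs = [1]" | x where "xs = [1, x]" | x where "xs = [x, 1]"
    using True xs by (cases xs; cases "tl xs") auto
  then show ?thesis
    by cases (simp_all add: Qop_def f_one lin_rules[OF mlin_hd[OF mlin_f]] f_sg[of "[x]" for x, simplified])
next
  case False
  obtain ys zs where e: "xs = ys @ 1 # zs" using xs by (meson split_list)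
  have D2: "A.DD2 f xs = (if ys = [] then - f zs else if zs = [] then f (map A.sg ys) else 0)"
    using DD2_unit[OF mlin_f, of ys zs] f False e by (auto split: if_splits)
  have C: "conv (\<lambda>l. B.sg (f l)) f xs = (\<Sum>j\<in>{0<..<length xs}. B.sg (f (take j xs)) * f (drop j xs))"
    by (rule conv_alt0) auto
  have t: "B.sg (f (take j xs)) * f (drop j xs) =
    (if ys = [] \<and> j = 1 then - f zs else if zs = [] \<and> j = length ys then B.sg (f ys) else 0)"
    if j: "j \<in> {0<..<length xs}" for j
  proof (cases "j \<le> length ys")
    case True
    then have d: "drop j xs = drop j ys @ 1 # zs" using e by simp
    show ?thesis
    proof (cases "2 \<le> length (drop j xs)")
      case True
      have "f (drop j xs) = 0" by (rule f) (simp add: d, rule True, use j in auto)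
      moreover have "\<not> (zs = [] \<and> j = length ys)" using True d by auto
      moreover have "\<not> (ys = [] \<and> j = 1)" using \<open>j \<le> length ys\<close> by auto
      ultimately show ?thesis by auto
    next
      case False
      moreover have "length (drop j xs) = length ys - j + Suc (length zs)" by (simp add: d)
      ultimately have "length zs = 0 \<and> j = length ys" using \<open>j \<le> length ys\<close> by linarith
      then have "zs = []" "j = length ys" by auto
      then show ?thesis using e j f_one by auto
    qed
  next
    case False
    then have d: "take j xs = ys @ 1 # take (j - Suc (length ys)) zs" using e by (simp add: take_Cons')
    show ?thesis
    proof (cases "2 \<le> length (take j xs)")
      case True
      have "f (take j xs) = 0" by (rule f) (simp add: d, rule True, use j in auto)
      then show ?thesis using True False by auto
    next
      case f2: False
      have "length (take j xs) = j" using j by simp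
      then have "length ys = 0 \<and> j = 1" using f2 False by linarith
      then have "ys = []" "j = 1" by auto
      then show ?thesis using e f_one by simp
    qed
  qed
  have "conv (\<lambda>l. B.sg (f l)) f xs = (\<Sum>j\<in>{0<..<length xs}.
    (if ys = [] \<and> j = 1 then - f zs else if zs = [] \<and> j = length ys then B.sg (f ys) else 0))"
    unfolding C by (intro sum.cong refl t)
  also have "\<dots> = (\<Sum>j\<in>{0<..<length xs}. if j = (if ys = [] then 1 else length ys)
      then (if ys = [] then - f zs else if zs = [] then B.sg (f ys) else 0) else 0)"
    by (intro sum.cong refl) auto
  also have "\<dots> = (if ys = [] then - f zs else if zs = [] then B.sg (f ys) else 0)"
    using False by (subst sum.delta) (auto simp: e)
  finally show ?thesis unfolding Qop_def D2 using f_sg[of ys] by simp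
qed

lemma f_unit: "1 \<in> set xs \<Longrightarrow> 2 \<le> length xs \<Longrightarrow> f xs = 0"
proof (induction "length xs" arbitrary: xs rule: less_induct)
  case less
  have Q: "Qop f l = 0" if "1 \<in> set l" "length l = length xs" for l
    by (rule Q_unit) (use less.hyps that in auto)
  \<comment> \<open>In a summand of \<open>KK\<close>, a unit before the distinguished position
    becomes -1, at that position it is killed by \<open>hm\<close>, and after it \<open>pr\<close>
    fixes it.\<close>
  have "B.pr (Qop f (map A.sg (take j xs) @ A.hm (xs ! j) # map A.pr (drop (Suc j) xs))) = 0" if j: "j < length xs" for j
  proof -
    let ?l = "map A.sg (take j xs) @ A.hm (xs ! j) # map A.pr (drop (Suc j) xs)"
    have "xs = take j xs @ xs ! j # drop (Suc j) xs" using j by (simp add: id_take_nth_drop)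
    then have "1 \<in> set (take j xs) \<or> xs ! j = 1 \<or> 1 \<in> set (drop (Suc j) xs)"
      using less.prems(1) by (metis Un_iff set_ConsD set_append)
    then consider "1 \<in> set (take j xs)" | "xs ! j = 1" | "1 \<in> set (drop (Suc j) xs)" by blast
    then have "Qop f ?l = 0"
    proof cases
      case 1
      then obtain ps qs where t: "take j xs = ps @ 1 # qs" by (meson split_list)
      have "Qop f (map A.sg ps @ 1 # map A.sg qs @ A.hm (xs ! j) # map A.pr (drop (Suc j) xs)) = 0"
        by (rule Q) (use arg_cong[OF t, of length] j in auto)
      then show ?thesis
        using unit_neg[OF mlin_Q, of "map A.sg ps" "map A.sg qs @ A.hm (xs ! j) # map A.pr (drop (Suc j) xs)"]
        by (simp add: t)
    next
      case 2
      then show ?thesis by (intro Q_zero) simp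
    next
      case 3
      then have "1 \<in> A.pr ` set (drop (Suc j) xs)" by (metis A.one_H A.pr_id imageI)
      then show ?thesis using j by (intro Q) auto
    qed
    then show ?thesis by simp
  qed
  then have "KK (\<lambda>l. B.pr (Qop f l)) xs = 0" by (simp add: opK_alt)
  then show ?case using f_eq[of xs] c_unit[OF less.prems(2,1)] Q[OF less.prems(1)] by simp
qed

lemma Q_unit': "1 \<in> set xs \<Longrightarrow> Qop f xs = 0"
  by (rule Q_unit) (auto intro: f_unit)

section \<open>The integral of the obstruction\<close>

lemma KK_zero:
  assumes "mlin (scal A) t g" "set xs \<subseteq> Hs \<union> Bs"
  shows "KK g xs = 0"
  unfolding opK_alt
proof (rule sum.neutral, rule ballI)
  fix j assume "j \<in> {..<length xs}"
  then have "xs ! j \<in> Hs \<union> Bs" using assms(2) nth_mem by blast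
  then have "A.hm (xs ! j) = 0" by auto
  then show "g (map A.sg (take j xs) @ A.hm (xs ! j) # map A.pr (drop (Suc j) xs)) = 0"
    by (intro mlin_zero_entry[OF assms(1)]) simp
qed

lemma f_HB: "set xs \<subseteq> Hs \<union> Bs \<Longrightarrow> f xs = c xs - B.hm (Qop f xs)"
  using f_eq[of xs] KK_zero[OF mlin_comp[OF mlin_Q B.lin_pr], of xs] by simp

lemma c_B: assumes "b \<in> set xs" "b \<in> Bs" shows "c xs = 0"
proof -
  have "0 \<in> set (map A.pr xs)" using assms by force
  then show ?thesis using mlin_zero_entry[OF mlin_c] c_pr by metis
qed

text \<open>Only the degree n component of u matters, and its harmonic part is determined by its
  integral.\<close>

lemma J_c_single: assumes "A.J u = 0" shows "B.J (c [u]) = 0"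
proof -
  have lin: "Vector_Spaces.linear (scal A) (*) (\<lambda>x. B.J (c [x]))"
    by (rule lin_comp[OF mlin_hd[OF mlin_c] B.lin_J])
  have "B.J (c [u]) = (\<Sum>l\<in>{0..int n}. B.J (c [A.hc l u]))" by (rule A.lin_expand[OF lin])
  also have "\<dots> = 0"
  proof (rule sum.neutral, rule ballI)
    fix l assume "l \<in> {0..int n}"
    have "A.hc l u \<in> gr A l" by simp
    then have g: "c [A.hc l u] \<in> gr B l" using c_gr[of "[l]" "[A.hc l u]"] by simp
    show "B.J (c [A.hc l u]) = 0"
    proof (cases "l = int n")
      case True
      have "A.pr (A.hc l u) = 0"
      proof (rule A.H_top)
        show "A.pr (A.hc l u) \<in> gr A (int n)" unfolding True by (rule A.pr_gr) simp
        have "A.J (A.hc l u) = A.J u" using True by (simp add: A.J_def A.hc_hom[OF A.hc_gr])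
        then show "A.J (A.pr (A.hc l u)) = 0" using assms by (simp add: A.J_pr)
      qed simp
      then have "c (map A.pr [A.hc l u]) = 0" using mlin_zero_entry[OF mlin_c] by simp
      then show ?thesis by (simp only: c_pr B.J_simps)
    qed (use B.J_hom[OF g] in simp)
  qed
  finally show ?thesis .
qed

text \<open>With a single entry u outside \<open>Hs \<union> Bs\<close>, only the summand that
  applies the homotopy to u survives, and there \<open>hm u\<close> is an entry in
  \<open>Bs\<close>.\<close>

lemma J_KK:
  assumes IH: "\<And>l. length l = length (ps @ u # qs) \<Longrightarrow> set l \<subseteq> Hs \<union> Bs \<Longrightarrow> set l \<inter> Bs \<noteq> {} \<Longrightarrow> B.J (Qop f l) = 0"
    and ps: "set ps \<subseteq> Hs \<union> Bs" "set qs \<subseteq> Hs \<union> Bs"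
  shows "B.J (KK (\<lambda>l. B.pr (Qop f l)) (ps @ u # qs)) = 0"
proof -
  let ?xs = "ps @ u # qs"
  have "B.J (Qop f (map A.sg (take j ?xs) @ A.hm (?xs ! j) # map A.pr (drop (Suc j) ?xs))) = 0"
    if j: "j < length ?xs" for j
  proof (cases "j = length ps")
    case True
    have "set (map A.sg ps) \<subseteq> Hs \<union> Bs" "set (map A.pr qs) \<subseteq> Hs" using ps by auto
    then show ?thesis using True by (intro IH) auto
  next
    case False
    have "?xs ! j \<in> set ps \<union> set qs"
    proof (cases "j < length ps")
      case True
      then show ?thesis by (simp add: nth_append)
    next
      case nl: False
      with False obtain m where "j = Suc (length ps + m)" using less_imp_Suc_add[of "length ps" j] by auto
      then show ?thesis using j by (simp add: nth_append)
    qed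
    then have "?xs ! j \<in> Hs \<union> Bs" using ps by blast
    then have "A.hm (?xs ! j) = 0" by auto
    then have "Qop f (map A.sg (take j ?xs) @ A.hm (?xs ! j) # map A.pr (drop (Suc j) ?xs)) = 0"
      by (intro Q_zero) (simp del: take_append drop_append)
    then show ?thesis by simp
  qed
  then have "(\<Sum>j<length ?xs. B.J (Qop f (map A.sg (take j ?xs) @ A.hm (?xs ! j) # map A.pr (drop (Suc j) ?xs)))) = 0"
    by (intro sum.neutral) blast
  then show ?thesis by (simp only: opK_alt B.J_pr B.J_simps)
qed

text \<open>Each summand merges two neighbours into one arbitrary entry, so \<open>J_KK\<close>
  applies. The \<open>hm\<close> part of f integrates to zero, and so does its free part: by
  \<open>c_J\<close> in arity at least two, by \<open>J_c_single\<close> in arity one.\<close>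

lemma J_DD2:
  assumes IH: "\<And>l. Suc (length l) = length xs \<Longrightarrow> set l \<subseteq> Hs \<union> Bs \<Longrightarrow> set l \<inter> Bs \<noteq> {} \<Longrightarrow> B.J (Qop f l) = 0"
    and xs: "set xs \<subseteq> Hs \<union> Bs" and len: "length xs \<ge> 3 \<or> (\<exists>x y. xs = [x, y] \<and> A.J (A.sg x * y) = 0)"
  shows "B.J (A.DD2 f xs) = 0"
proof -
  have "B.J (f (map A.sg (take j xs) @ A.sg (xs ! j) * xs ! Suc j # drop (Suc (Suc j)) xs)) = 0"
    if j: "j < length xs - 1" for j
  proof -
    let ?l = "map A.sg (take j xs) @ A.sg (xs ! j) * xs ! Suc j # drop (Suc (Suc j)) xs"
    have s: "set (map A.sg (take j xs)) \<subseteq> Hs \<union> Bs" "set (drop (Suc (Suc j)) xs) \<subseteq> Hs \<union> Bs"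
      using xs set_take_subset[of j xs] set_drop_subset[of "Suc (Suc j)" xs] by auto
    have "B.J (KK (\<lambda>l. B.pr (Qop f l)) ?l) = 0"
      by (rule J_KK[OF _ s]) (use IH j in auto)
    moreover have "B.J (c ?l) = 0"
    proof (cases "length xs \<ge> 3")
      case True
      then show ?thesis using j by (intro c_J) auto
    next
      case False
      then show ?thesis using len j by (auto intro: J_c_single)
    qed
    ultimately show ?thesis by (subst f_eq) simp
  qed
  then show ?thesis by (simp add: opD2_alt)
qed

lemma J_conv:
  "B.J (conv (\<lambda>l. B.sg (f l)) f xs) = (\<Sum>j\<in>{0<..<length xs}. B.J (B.sg (f (take j xs)) * f (drop j xs)))"
  by (subst conv_alt0) auto

text \<open>On such arguments f is its free harmonic part plus an element of \<open>Bs'\<close>; the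
  orthogonality relations kill every product that contains the latter.\<close>

lemma J_split:
  assumes "set ys \<subseteq> Hs \<union> Bs" "set zs \<subseteq> Hs \<union> Bs"
  shows "B.J (B.sg (f ys) * f zs) = B.J (B.sg (c ys) * c zs)"
  by (simp add: f_HB[OF assms(1)] f_HB[OF assms(2)] left_diff_distrib right_diff_distrib)

text \<open>In each split one block contains the entry from \<open>Bs\<close>, so its free part
  vanishes by \<open>c_B\<close>. The \<open>DD2\<close> term reduces to shorter lists in which the
  homotopy has created such an entry.\<close>

lemma J_Q_B: "set xs \<subseteq> Hs \<union> Bs \<Longrightarrow> set xs \<inter> Bs \<noteq> {} \<Longrightarrow> B.J (Qop f xs) = 0"
proof (induction "length xs" arbitrary: xs rule: less_induct)
  case less
  have "B.J (B.sg (f (take j xs)) * f (drop j xs)) = 0" for j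
  proof -
    have s: "set (take j xs) \<subseteq> Hs \<union> Bs" "set (drop j xs) \<subseteq> Hs \<union> Bs"
      using less.prems(1) set_take_subset[of j xs] set_drop_subset[of j xs] by auto
    have "set (take j xs) \<union> set (drop j xs) = set xs" by (metis append_take_drop_id set_append)
    then have "set (take j xs) \<inter> Bs \<noteq> {} \<or> set (drop j xs) \<inter> Bs \<noteq> {}" using less.prems(2) by auto
    then have "c (take j xs) = 0 \<or> c (drop j xs) = 0" using c_B by blast
    then show ?thesis by (auto simp: J_split[OF s])
  qed
  then have C: "B.J (conv (\<lambda>l. B.sg (f l)) f xs) = 0" by (simp add: J_conv)
  show ?case
  proof (cases "length xs \<ge> 2")
    case True
    have "B.J (A.DD2 f xs) = 0"
    proof (rule J_DD2[OF _ less.prems(1)])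
      show "length xs \<ge> 3 \<or> (\<exists>x y. xs = [x, y] \<and> A.J (A.sg x * y) = 0)"
      proof (cases "length xs \<ge> 3")
        case False
        then obtain x y where xs: "xs = [x, y]" using True by (cases xs; cases "tl xs"; cases "tl (tl xs)") auto
        then have "A.J (A.sg x * y) = 0" using less.prems by auto
        then show ?thesis using xs by blast
      qed simp
    qed (use less.hyps in auto)
    then show ?thesis using C by (simp add: Qop_def)
  next
    case False
    then have "A.DD2 f xs = 0" by (cases xs; cases "tl xs") auto
    then show ?thesis using C by (simp add: Qop_def)
  qed
qed

text \<open>Here the top-degree obstruction loses all its homotopy terms and becomes an expression
  in the free parts alone.\<close>

lemma J_Q_H:
  assumes "set xs \<subseteq> Hs" "length xs \<ge> 3"
  shows "B.J (Qop f xs) = B.J (conv (\<lambda>l. B.sg (c l)) c xs)"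
proof -
  have s: "set (take j xs) \<subseteq> Hs \<union> Bs" "set (drop j xs) \<subseteq> Hs \<union> Bs" for j
    using assms(1) set_take_subset[of j xs] set_drop_subset[of j xs] by auto
  have "B.J (conv (\<lambda>l. B.sg (f l)) f xs) = (\<Sum>j\<in>{0<..<length xs}. B.J (B.sg (c (take j xs)) * c (drop j xs)))"
    unfolding J_conv by (simp add: J_split[OF s])
  also have "\<dots> = B.J (conv (\<lambda>l. B.sg (c l)) c xs)"
    by (subst conv_alt0) auto
  finally have "B.J (conv (\<lambda>l. B.sg (f l)) f xs) = B.J (conv (\<lambda>l. B.sg (c l)) c xs)" .
  moreover have "B.J (A.DD2 f xs) = 0"
    by (rule J_DD2) (use assms J_Q_B in auto)
  ultimately show ?thesis by (simp add: Qop_def)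
qed

lemma prQ_2: assumes "x \<in> Hs" "y \<in> Hs" shows "B.pr (Qop f [x, y]) = 0"
  using c_mult[OF assms] by (simp add: Qop_def f_single)

lemma Q_2: "Qop f [x, y] = B.sg (c [x]) * c [y] - c [A.sg x * y]"
  by (simp add: Qop_def f_single)

lemma c_zero_single [simp]: "c [0] = 0"
  by (rule mlin_zero_entry[OF mlin_c]) simp

lemma c_hm [simp]: "c [A.hm u] = 0"
  by (rule c_B[of "A.hm u"]) auto

lemma c_sg: "c [A.sg x] = B.sg (c [x])"
  using f_sg[of "[x]"] by (simp add: f_single)

lemma prQ_3:
  assumes "x \<in> Hs" "y \<in> Hs" "z \<in> Hs" shows "B.pr (Qop f [x, y, z]) = 0"
proof -
  have f2: "f [y, z] = c [y, z] - B.hm (B.sg (c [y]) * c [z])" if "y \<in> Hs" "z \<in> Hs" for y z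
    using f_HB[of "[y, z]"] that by (simp add: Q_2)
  \<comment> \<open>For a non-harmonic entry the source homotopy contributes \<open>Q_2\<close> at
    the \<open>hm\<close> of that entry; this produces the terms with \<open>A.hm\<close> in the
    ternary product of A.\<close>
  have a: "B.pr (f [u, z]) = c [u, z] - c [A.sg (A.hm u) * z]" if "z \<in> Hs" for u z
    using that Q_zero[of "[A.sg u, 0]"] by (subst f_eq) (simp add: Q_2 c_sg)
  have b: "B.pr (f [x, v]) = c [x, v] - c [A.sg (A.sg x) * A.hm v]" if "x \<in> Hs" for x v
    using that Q_zero[of "[0, A.pr v]"] by (subst f_eq) (simp add: Q_2)
  have "B.pr (Qop f [x, y, z]) = B.pr (B.sg (c [x]) * (c [y, z] - B.hm (B.sg (c [y]) * c [z]))
     + B.sg (c [x, y] - B.hm (B.sg (c [x]) * c [y])) * c [z])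
     - (c [A.sg x * y, z] - c [A.sg (A.hm (A.sg x * y)) * z])
     - (c [A.sg x, A.sg y * z] - c [A.sg x * A.hm (A.sg y * z)])"
    using assms by (simp add: Qop_def f_single f2 a b)
  also have "\<dots> = B.pr (B.sg (c [x]) * c [y, z] + B.sg (c [x, y]) * c [z]) - c [A.sg x * y, z] - c [A.sg x, A.sg y * z]
      - B.pr (B.sg (c [x]) * B.hm (B.sg (c [y]) * c [z]) + B.sg (B.hm (B.sg (c [x]) * c [y])) * c [z])
      + c [A.sg (A.hm (A.sg x * y)) * z + A.sg x * A.hm (A.sg y * z)]"
    using lin_add[OF mlin_hd[OF mlin_c, of "[]"]]
    by (simp add: left_diff_distrib right_diff_distrib algebra_simps)
  finally show ?thesis using c_3[OF assms] by simp
qed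

lemma prQ_high:
  assumes len: "length xs \<ge> 4" and hom: "list_all2 (\<lambda>k x. x \<in> gr A k) ks xs" and H: "set xs \<subseteq> Hs"
  shows "B.pr (Qop f xs) = 0"
proof (cases "\<exists>j<length xs. ks ! j < int r")
  case True
  then obtain j where j: "j < length xs" "ks ! j < int r" by blast
  have x: "xs ! j \<in> gr A (ks ! j)" "xs ! j \<in> Hs" using hom H j by (auto simp: list_all2_conv_all_nth)
  have xs: "xs = take j xs @ xs ! j # drop (Suc j) xs" using j by (simp add: id_take_nth_drop)
  \<comment> \<open>A harmonic entry of degree below r is a multiple of the unit or zero, and the
    quadratic part vanishes in both cases.\<close>
  consider "ks ! j = 0" | "ks ! j < 0" | "1 \<le> ks ! j" by linarith
  then have "Qop f xs = 0"
  proof cases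
    case 1
    then obtain a where a: "xs ! j = scal A a 1" using A.H_0[of "xs ! j"] x by metis
    have "Qop f (take j xs @ 1 # drop (Suc j) xs) = 0" by (rule Q_unit') simp
    then have "Qop f (take j xs @ scal A a 1 # drop (Suc j) xs) = 0"
      using lin_scale[OF mlin_at[OF mlin_Q], of "take j xs" a 1 "drop (Suc j) xs"] by simp
    then show ?thesis using xs a by metis
  next
    case 2
    then have "xs ! j = 0" using x A.gr_out[of "ks ! j"] by auto
    then show ?thesis using j by (intro Q_zero) (metis nth_mem)
  next
    case 3
    then have "xs ! j = 0" using A.H_low[OF x(2,1)] j by auto
    then show ?thesis using j by (intro Q_zero) (metis nth_mem)
  qed
  then show ?thesis by simp
next
  case False
  let ?k = "int (length xs)" and ?D = "sum_list ks + 2 - int (length xs)"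
  have lk: "length ks = length xs" using hom by (simp add: list_all2_lengthD)
  have "sum_list ks \<ge> int (length ks) * int r"
    using False lk
  proof (induction ks arbitrary: xs)
    case (Cons k ks)
    then obtain x ys where xs: "xs = x # ys" by (cases xs) auto
    have "int r \<le> k" using Cons.prems(1) xs by force
    moreover have "int (length ks) * int r \<le> sum_list ks"
    proof (rule Cons.IH[of ys])
      show "\<not> (\<exists>j<length ys. ks ! j < int r)"
      proof
        assume "\<exists>j<length ys. ks ! j < int r"
        then obtain j where "j < length ys" "ks ! j < int r" by blast
        then have "Suc j < length xs \<and> (k # ks) ! Suc j < int r" using xs by simp
        then show False using Cons.prems(1) by blast
      qed
    qed (use Cons.prems xs in auto)
    ultimately show ?case by (simp add: algebra_simps)
  qed simp
  then have D: "?D \<ge> ?k * (int r - 1) + 2" using lk by (simp add: algebra_simps)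
  have r1: "int r \<ge> 2" and n5: "int n \<le> 5 * int r - 3" using A.r1 A.n5 by auto
  have "?k * (int r - 1) \<ge> 4 * (int r - 1)"
    by (rule mult_right_mono) (use len r1 in auto)
  then have D4: "?D \<ge> 4 * int r - 2" using D by (simp add: algebra_simps)
  have g: "B.pr (Qop f xs) \<in> gr B ?D" by (rule B.pr_gr[OF Q_gr[OF hom]]) (use len in auto)
  consider "?D > int n" | "?D < int n" | "?D = int n" by linarith
  then show ?thesis
  proof cases
    case 1
    then show ?thesis using g B.gr_out[of ?D] by auto
  next
    case 2
    then show ?thesis using D4 n5 by (intro B.H_high[OF B.pr_H g]) linarith+
  next
    case 3
    have "length xs \<le> 5"
    proof (rule ccontr)
      assume "\<not> length xs \<le> 5"
      then have "?k * (int r - 1) \<ge> 6 * (int r - 1)"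
        by (intro mult_right_mono) (use r1 in auto)
      then show False using D 3 n5 r1 by (simp add: algebra_simps)
    qed
    then have "length xs = 4 \<or> length xs = 5" using len by linarith
    then have "B.J (Qop f xs) = 0" using J_Q_H[OF H] c_cyc[OF H] len by simp
    then show ?thesis using g 3 by (intro B.H_top) (auto simp: B.J_pr)
  qed
qed

lemma prQ_zero: "B.pr (Qop f (map A.pr xs)) = 0"
proof (rule A.mlin_ext_hom[of "scal B" "\<lambda>l. B.pr (Qop f (map A.pr l))" "\<lambda>l. 0"])
  show "mlin (scal A) (scal B) (\<lambda>l. B.pr (Qop f (map A.pr l)))"
    by (rule mlin_map[OF mlin_comp[OF mlin_Q B.lin_pr] A.lin_pr])
  show "mlin (scal A) (scal B) (\<lambda>l. 0)" by (rule mlin_zero[OF A.vs B.vs])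
  fix ks ys assume ys: "list_all2 (\<lambda>k x. x \<in> gr A k) ks ys"
  show "B.pr (Qop f (map A.pr ys)) = 0"
  proof (cases "length ys \<ge> 4")
    case True
    show ?thesis
      by (rule prQ_high[of _ ks]) (use True ys A.pr_gr in \<open>auto simp: list_all2_conv_all_nth\<close>)
  next
    case False
    then consider "ys = []" | x where "ys = [x]" | x y where "ys = [x, y]" | x y z where "ys = [x, y, z]"
      by (cases ys; cases "tl ys"; cases "tl (tl ys)"; cases "tl (tl (tl ys))") auto
    then show ?thesis
      by cases (auto simp: prQ_2 prQ_3, simp add: Qop_def)
  qed
qed

theorem Eop_zero: "Eop f xs = 0"
  by (induction "length xs" arbitrary: xs rule: less_induct) (simp add: Eop_step prQ_zero)

end

section \<open>Shifted and unshifted signs\<close>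

text \<open>The exponent of the decalage sign: each degree counts once for every argument to its
  right.\<close>

fun esum :: "int list \<Rightarrow> int" where
  "esum [] = 0"
| "esum (k # ks) = k * int (length ks) + esum ks"

lemma esum_append: "esum (as @ bs) = esum as + int (length bs) * sum_list as + esum bs"
  by (induction as) (simp_all add: algebra_simps)

text \<open>Signs are compared by exhibiting half of the difference of their exponents; this is the
  meaning of the witnesses w supplied below.\<close>

lemma ksgn_cong: "a - b = 2 * w \<Longrightarrow> ksgn a = ksgn b"
proof -
  assume "a - b = 2 * w"
  then have "a = b + 2 * w" by simp
  then show ?thesis by (simp add: ksgn_def)
qed

context cdga
begin

text \<open>This is multiplication by (-1)^(k deg x), written as a linear map; \<open>- sg\<close>
  is the sign of the unshifted degree.\<close>

definition tau :: "nat \<Rightarrow> 'a \<Rightarrow> 'a" where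
  "tau k x = (if even k then x else - sg x)"

lemma lin_tau: "Vector_Spaces.linear (scal A) (scal A) (tau k)"
  unfolding tau_def[abs_def] using lin_id[OF vs] lin_neg_fun[OF lin_sg] by (cases "even k") simp_all

lemma tau_hom: "x \<in> gr A j \<Longrightarrow> tau k x = scal A (ksgn (j * int k)) x"
  by (auto simp: tau_def sg_hom ksgn_def)

lemma tau_tau [simp]: "tau k (tau k x) = x"
  by (simp add: tau_def)

lemma tau_0 [simp]: "tau 0 x = x"
  by (simp add: tau_def)

fun tw :: "'a list \<Rightarrow> 'a list" where
  "tw [] = []"
| "tw (x # xs) = tau (length xs) x # tw xs"

lemma length_tw [simp]: "length (tw xs) = length xs"
  by (induction xs) auto

lemma tw_tw [simp]: "tw (tw xs) = xs"
  by (induction xs) auto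

lemma mlin_tw:
  assumes "mlin (scal A) t g"
  shows "mlin (scal A) t (\<lambda>l. g (tw l))"
  unfolding mlin_def
proof (intro allI)
  fix xs ys
  show "Vector_Spaces.linear (scal A) t (\<lambda>x. g (tw (xs @ x # ys)))"
    using assms
  proof (induction xs arbitrary: g)
    case Nil
    then show ?case by (simp add: mlin_hd_comp[OF _ lin_tau])
  next
    case (Cons a xs)
    then show ?case using Cons.IH[OF mlin_Cons[OF Cons.prems]] by simp
  qed
qed

lemma tw_hom:
  "list_all2 (\<lambda>k x. x \<in> gr A k) ks xs \<Longrightarrow> mlin (scal A) t g \<Longrightarrow> g (tw xs) = t (ksgn (esum ks)) (g xs)"
proof (induction ks xs arbitrary: g rule: list_all2_induct)
  case Nil
  interpret T: vector_space t by (rule mlin_vs(2)[OF Nil])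
  show ?case by simp
next
  case (Cons k ks x xs)
  interpret T: vector_space t by (rule mlin_vs(2)[OF Cons.prems])
  have "length ks = length xs" using Cons.hyps(2) by (rule list_all2_lengthD)
  then have "g (tw (x # xs)) = t (ksgn (k * int (length ks))) (g (x # tw xs))"
    using lin_scale[OF mlin_hd[OF Cons.prems]] by (simp add: tau_hom[OF Cons.hyps(1)])
  also have "\<dots> = t (ksgn (k * int (length ks))) (t (ksgn (esum ks)) (g (x # xs)))"
    using Cons.IH[OF mlin_Cons[OF Cons.prems]] by simp
  finally show ?case by (simp add: ksgn_add)
qed

lemma map_sg_prefix:
  assumes "mlin (scal A) t g" "list_all2 (\<lambda>k x. x \<in> gr A k) ks xs"
  shows "g (map sg xs @ ys) = t (ksgn (sum_list ks - int (length xs))) (g (xs @ ys))"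
  using assms(2,1)
proof (induction ks xs arbitrary: g rule: list_all2_induct)
  case Nil
  interpret T: vector_space t by (rule mlin_vs(2)[OF Nil])
  show ?case by simp
next
  case (Cons k ks x xs)
  interpret T: vector_space t by (rule mlin_vs(2)[OF Cons.prems])
  have "g (map sg (x # xs) @ ys) = t (ksgn (k - 1)) (g (x # map sg xs @ ys))"
    using lin_scale[OF mlin_hd[OF Cons.prems]] by (simp add: sg_hom[OF Cons.hyps(1)])
  also have "\<dots> = t (ksgn (k - 1)) (t (ksgn (sum_list ks - int (length xs))) (g (x # xs @ ys)))"
    using Cons.IH[OF mlin_Cons[OF Cons.prems]] by simp
  finally show ?case by (simp add: ksgn_def)
qed

end

context cdga_pair
begin

text \<open>Passage between maps on \<open>A\<^bsup>\<otimes>k\<^esup>\<close> of degree \<open>1 - k\<close> and maps on \<open>(sA)\<^bsup>\<otimes>k\<^esup>\<close> of degree 0.\<close>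

definition shift :: "('a list \<Rightarrow> 'b) \<Rightarrow> 'a list \<Rightarrow> 'b" where
  "shift g xs = scal B (ksgn (int (length xs) - 1)) (g (A.tw xs))"

lemma shift_shift [simp]: "shift (shift g) = g"
  by (rule ext) (simp add: shift_def)

lemma mlin_shift: assumes "mlin (scal A) (scal B) g" shows "mlin (scal A) (scal B) (shift g)"
  unfolding mlin_def shift_def
proof (intro allI)
  fix xs ys
  show "Vector_Spaces.linear (scal A) (scal B)
    (\<lambda>x. scal B (ksgn (int (length (xs @ x # ys)) - 1)) (g (A.tw (xs @ x # ys))))"
    using lin_scale_fun[OF mlin_at[OF A.mlin_tw[OF assms]], of "ksgn (int (length xs + length ys))" xs ys] by simp
qed

lemma shift_hom:
  assumes "mlin (scal A) (scal B) g" "list_all2 (\<lambda>k x. x \<in> gr A k) ks xs"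
  shows "shift g xs = scal B (ksgn (int (length xs) - 1 + esum ks)) (g xs)"
  by (simp add: shift_def A.tw_hom[OF assms(2,1)] ksgn_add)

lemma shift_gr:
  assumes "mlin (scal A) (scal B) g" "list_all2 (\<lambda>k x. x \<in> gr A k) ks xs" "g xs \<in> gr B j"
  shows "shift g xs \<in> gr B j"
  using assms(3) by (simp add: shift_hom[OF assms(1,2)] B.gr_scale)

lemma ainf_mult_long: "length xs \<ge> 3 \<Longrightarrow> ainf_mult A xs = 0"
  by (cases "(A, xs)" rule: ainf_mult.cases) auto

lemma ainf_mult_long': "length xs \<ge> 3 \<Longrightarrow> ainf_mult B xs = 0"
  by (cases "(B, xs)" rule: ainf_mult.cases) auto

text \<open>The prescribed sign times the decalage sign of the differentiated list equals the
  decalage sign of \<open>xs\<close> times the Koszul sign of its first j entries, by a congruence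
  of exponents modulo 2.\<close>

lemma term1:
  assumes g: "mlin (scal A) (scal B) g" and xs: "list_all2 (\<lambda>k x. x \<in> gr A k) ks xs" and j: "j < length xs"
  shows "scal B (ksgn (int j + int 1 * int (length xs - j - 1) + (2 - int 1) * sum_list (take j ks)))
      (shift g (take j xs @ ainf_mult A (take 1 (drop j xs)) # drop (j + 1) xs))
    = scal B (ksgn (int (length xs) - 1 + esum ks)) (g (map A.sg (take j xs) @ diff A (xs ! j) # drop (Suc j) xs))"
proof -
  define ps k qs where k: "ps = take j ks" "k = ks ! j" "qs = drop (Suc j) ks"
  define us x vs where x: "us = take j xs" "x = xs ! j" "vs = drop (Suc j) xs"
  have lk: "length ks = length xs" using xs by (rule list_all2_lengthD)
  have ks: "ks = ps @ k # qs" and xs': "xs = us @ x # vs" using j lk by (simp_all add: k x id_take_nth_drop[symmetric])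
  have h: "list_all2 (\<lambda>k x. x \<in> gr A k) ps us" "x \<in> gr A k" "list_all2 (\<lambda>k x. x \<in> gr A k) qs vs"
    using xs j lk by (auto simp: k x list_all2_conv_all_nth)
  have l: "length us = j" "length ps = j" "length vs = length qs" using j lk by (auto simp: k x)
  have t1: "take (Suc 0) (drop j xs) = [x]" using l by (simp add: xs')
  have "shift g (us @ diff A x # vs) = scal B (ksgn (int (length xs) - 1 + esum (ps @ (k + 1) # qs))) (g (us @ diff A x # vs))"
    using shift_hom[OF g, of "ps @ (k + 1) # qs" "us @ diff A x # vs"] h A.d_gr[OF h(2)]
    by (simp add: list_all2_appendI xs')
  moreover have "g (map A.sg us @ diff A x # vs) = scal B (ksgn (sum_list ps - int j)) (g (us @ diff A x # vs))"
    using A.map_sg_prefix[OF g h(1)] l by simp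
  moreover have "ksgn (int j + int 1 * int (length xs - j - 1) + (2 - int 1) * sum_list ps) * ksgn (int (length xs) - 1 + esum (ps @ (k + 1) # qs))
    = ksgn (int (length xs) - 1 + esum ks) * (ksgn (sum_list ps - int j) :: 'f)"
    unfolding ksgn_add[symmetric]
    by (rule ksgn_cong[where w = "int j + int (length qs)"]) (use l in \<open>simp add: ks xs' esum_append algebra_simps\<close>)
  ultimately show ?thesis by (simp add: t1 x(1,3)[symmetric] k(1)[symmetric] x(2)[symmetric])
qed

lemma term2:
  assumes g: "mlin (scal A) (scal B) g" and xs: "list_all2 (\<lambda>k x. x \<in> gr A k) ks xs" and j: "j < length xs - 1"
  shows "scal B (ksgn (int j + int 2 * int (length xs - j - 2) + (2 - int 2) * sum_list (take j ks)))
      (shift g (take j xs @ ainf_mult A (take 2 (drop j xs)) # drop (j + 2) xs))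
    = scal B (ksgn (int (length xs) - 1 + esum ks))
        (g (map A.sg (take j xs) @ A.sg (xs ! j) * xs ! Suc j # drop (Suc (Suc j)) xs))"
proof -
  define ps k m qs where k: "ps = take j ks" "k = ks ! j" "m = ks ! Suc j" "qs = drop (Suc (Suc j)) ks"
  define us x y vs where x: "us = take j xs" "x = xs ! j" "y = xs ! Suc j" "vs = drop (Suc (Suc j)) xs"
  have lk: "length ks = length xs" using xs by (rule list_all2_lengthD)
  have ks: "ks = ps @ k # m # qs" and xs': "xs = us @ x # y # vs"
    using j lk by (simp_all add: k x id_take_nth_drop[of j] Cons_nth_drop_Suc)
  have h: "list_all2 (\<lambda>k x. x \<in> gr A k) ps us" "x \<in> gr A k" "y \<in> gr A m" "list_all2 (\<lambda>k x. x \<in> gr A k) qs vs"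
    using xs j lk by (auto simp: k x list_all2_conv_all_nth)
  have l: "length us = j" "length ps = j" "length vs = length qs" using j lk by (auto simp: k x)
  have t2: "take 2 (drop j xs) = [x, y]" using l by (simp add: xs')
  have "shift g (us @ x * y # vs) = scal B (ksgn (int (length xs) - 2 + esum (ps @ (k + m) # qs))) (g (us @ x * y # vs))"
    using shift_hom[OF g, of "ps @ (k + m) # qs" "us @ x * y # vs"] h A.mult_gr[OF h(2,3)]
    by (simp add: list_all2_appendI xs')
  moreover have "g (map A.sg us @ A.sg x * y # vs) = scal B (ksgn (sum_list ps - int j)) (scal B (ksgn (k - 1)) (g (us @ x * y # vs)))"
    using A.map_sg_prefix[OF g h(1)] l lin_scale[OF mlin_at[OF g]] by (simp add: A.sg_hom[OF h(2)] A.scal_mult_left)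
  moreover have "ksgn (int j + int 2 * int (length xs - j - 2) + (2 - int 2) * sum_list ps) * ksgn (int (length xs) - 2 + esum (ps @ (k + m) # qs))
    = ksgn (int (length xs) - 1 + esum ks) * (ksgn (sum_list ps - int j) * ksgn (k - 1) :: 'f)"
    unfolding ksgn_add[symmetric]
    by (rule ksgn_cong[where w = "int j + int (length qs) - sum_list ps - k"]) (use l in \<open>simp add: ks xs' esum_append algebra_simps\<close>)
  ultimately show ?thesis by (simp add: t2 x[symmetric] k(1)[symmetric])
qed

text \<open>Only blocks of size 1 and 2 contribute, as the higher multiplications of A vanish; all
  of them carry the same decalage sign.\<close>

lemma lhs_sum:
  assumes g: "mlin (scal A) (scal B) g" and xs: "list_all2 (\<lambda>k x. x \<in> gr A k) ks xs"
  shows "(\<Sum>(r, s) | 1 \<le> s \<and> r + s \<le> length xs.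
           scal B (ksgn (int r + int s * int (length xs - r - s) + (2 - int s) * sum_list (take r ks)))
             (shift g (take r xs @ ainf_mult A (take s (drop r xs)) # drop (r + s) xs)))
    = scal B (ksgn (int (length xs) - 1 + esum ks)) (A.DD1 g xs + A.DD2 g xs)"
    (is "sum ?t ?S = _")
proof -
  let ?S1 = "(\<lambda>j. (j, 1::nat)) ` {..<length xs}" and ?S2 = "(\<lambda>j. (j, 2::nat)) ` {..<length xs - 1}"
  have fin: "finite ?S"
    by (rule finite_subset[of _ "{..length xs} \<times> {..length xs}"]) auto
  have "?t p = 0" if "p \<in> ?S - (?S1 \<union> ?S2)" for p
  proof -
    obtain r s where p: "p = (r, s)" by (cases p)
    have s: "s \<ge> 3"
    proof (rule ccontr)
      assume "\<not> s \<ge> 3"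
      then have "s = 1 \<or> s = 2" using that p by auto
      then show False using that p by (auto simp: image_iff)
    qed
    have "ainf_mult A (take s (drop r xs)) = 0" by (rule ainf_mult_long) (use s that p in auto)
    then show ?thesis by (simp add: p mlin_zero_entry[OF mlin_shift[OF g]])
  qed
  then have "sum ?t ?S = sum ?t (?S1 \<union> ?S2)"
    by (intro sum.mono_neutral_right fin) auto
  also have "\<dots> = sum ?t ?S1 + sum ?t ?S2" by (rule sum.union_disjoint) auto
  also have "sum ?t ?S1 = (\<Sum>j<length xs. ?t (j, 1))" by (subst sum.reindex) (auto simp: inj_on_def)
  also have "\<dots> = scal B (ksgn (int (length xs) - 1 + esum ks)) (A.DD1 g xs)"
    unfolding opD1_alt B.V.scale_sum_right prod.case by (intro sum.cong refl term1[OF g xs]) simp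
  also have "sum ?t ?S2 = (\<Sum>j<length xs - 1. ?t (j, 2))" by (subst sum.reindex) (auto simp: inj_on_def)
  also have "\<dots> = scal B (ksgn (int (length xs) - 1 + esum ks)) (A.DD2 g xs)"
    unfolding opD2_alt B.V.scale_sum_right prod.case by (intro sum.cong refl term2[OF g xs]) simp
  finally show ?thesis by (simp add: B.V.scale_right_distrib)
qed

lemma finite_compositions: "finite {js. sum_list js = (m::nat) \<and> 0 \<notin> set js}"
proof (rule finite_subset)
  show "{js. sum_list js = m \<and> 0 \<notin> set js} \<subseteq> {js. set js \<subseteq> {..m} \<and> length js \<le> m}"
  proof safe
    fix js :: "nat list" and x
    assume "0 \<notin> set js"
    then show "length js \<le> sum_list js"
      by (induction js) auto
    assume "x \<in> set js"
    then show "x \<le> sum_list js" by (induction js) auto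
  qed
qed (rule finite_lists_length_le, simp)

definition sdeg :: "('a list \<Rightarrow> 'b) \<Rightarrow> bool" where
  "sdeg g \<longleftrightarrow> (\<forall>ks ys. list_all2 (\<lambda>k x. x \<in> gr A k) ks ys \<longrightarrow> ys \<noteq> [] \<longrightarrow>
     g ys \<in> gr B (sum_list ks + 1 - int (length ys)))"

lemma sdegD:
  "sdeg g \<Longrightarrow> list_all2 (\<lambda>k x. x \<in> gr A k) ks ys \<Longrightarrow> ys \<noteq> [] \<Longrightarrow> g ys \<in> gr B (sum_list ks + 1 - int (length ys))"
  by (simp add: sdeg_def)

text \<open>Only compositions with one or two blocks contribute. The tensor sign and the decalage
  signs of two blocks combine to the decalage sign of the whole list and \<open>sg\<close> on the
  first factor.\<close>

lemma rhs_sum: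
  assumes g: "mlin (scal A) (scal B) g" and g0: "g [] = 0" and xs: "list_all2 (\<lambda>k x. x \<in> gr A k) ks xs" and ne: "xs \<noteq> []"
    and gg: "sdeg g"
  shows "(\<Sum>js | sum_list js = length xs \<and> 0 \<notin> set js.
             scal B (ksgn (tensor_sign js ks)) (ainf_mult B (map (shift g) (blocks js xs))))
    = scal B (ksgn (int (length xs) - 1 + esum ks)) (diff B (g xs) + conv (\<lambda>l. B.sg (g l)) g xs)"
    (is "sum ?t ?S = _")
proof -
  let ?S1 = "{[length xs]}" and ?S2 = "(\<lambda>j. [j, length xs - j]) ` {0<..<length xs}"
  have "?t js = 0" if "js \<in> ?S - (?S1 \<union> ?S2)" for js
  proof -
    have len: "length js \<ge> 3"
    proof (rule ccontr)
      assume "\<not> length js \<ge> 3"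
      then consider "js = []" | a where "js = [a]" | a b where "js = [a, b]"
        by (cases js; cases "tl js"; cases "tl (tl js)") auto
      then show False
        by cases (use that ne in \<open>auto simp: image_iff\<close>)
    qed
    have "length (blocks js ys) = length js" for ys :: "'a list" by (induction js arbitrary: ys) auto
    then have "ainf_mult B (map (shift g) (blocks js xs)) = 0" by (intro ainf_mult_long') (use len in auto)
    then show ?thesis by simp
  qed
  then have "sum ?t ?S = sum ?t (?S1 \<union> ?S2)"
    by (intro sum.mono_neutral_right finite_compositions) (use ne in auto)
  also have "\<dots> = sum ?t ?S1 + sum ?t ?S2" by (rule sum.union_disjoint) auto
  also have "sum ?t ?S1 = scal B (ksgn (int (length xs) - 1 + esum ks)) (diff B (g xs))"
    by (simp add: tensor_sign_def shift_hom[OF g xs])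
  also have "sum ?t ?S2 = (\<Sum>j\<in>{0<..<length xs}. ?t [j, length xs - j])" by (subst sum.reindex) (auto simp: inj_on_def)
  also have "\<dots> = scal B (ksgn (int (length xs) - 1 + esum ks)) (conv (\<lambda>l. B.sg (g l)) g xs)"
  proof -
    have "?t [j, length xs - j] = scal B (ksgn (int (length xs) - 1 + esum ks)) (B.sg (g (take j xs)) * g (drop j xs))"
      if j: "j \<in> {0<..<length xs}" for j
    proof -
      define us vs ps qs where x: "us = take j xs" "vs = drop j xs" "ps = take j ks" "qs = drop j ks"
      have xs': "xs = us @ vs" and ks: "ks = ps @ qs" by (simp_all add: x)
      have lk: "length ks = length xs" using xs by (rule list_all2_lengthD)
      have h: "list_all2 (\<lambda>k x. x \<in> gr A k) ps us" "list_all2 (\<lambda>k x. x \<in> gr A k) qs vs"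
        using xs by (simp_all add: x)
      have ne: "us \<noteq> []" "vs \<noteq> []" using j by (auto simp: x)
      have l: "length us = j" "length ps = j" "length vs = length xs - j" "length qs = length vs" using j lk by (auto simp: x)
      have ts: "tensor_sign [j, length xs - j] ks = (int j - 1) + (1 - int (length vs)) * sum_list ps"
        using j by (simp add: tensor_sign_def numeral_2_eq_2 x)
      have bl: "blocks [j, length xs - j] xs = [us, vs]" by (simp add: x)
      have sg: "B.sg (g us) = scal B (ksgn (sum_list ps + 1 - int (length us) - 1)) (g us)"
        by (rule B.sg_hom[OF sdegD[OF gg h(1) ne(1)]])
      have "(ksgn ((int j - 1) + (1 - int (length vs)) * sum_list ps) * (ksgn (int (length us) - 1 + esum ps) * ksgn (int (length vs) - 1 + esum qs)) :: 'f)
        = ksgn (int (length xs) - 1 + esum ks) * ksgn (sum_list ps + 1 - int (length us) - 1)"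
        unfolding ksgn_add[symmetric]
        by (rule ksgn_cong[where w = "int j - 1 - int (length vs) * sum_list ps"]) (use l in \<open>simp add: ks xs' esum_append algebra_simps\<close>)
      then show ?thesis
        unfolding ts bl by (simp add: x(1,2)[symmetric] sg shift_hom[OF g h(1)] shift_hom[OF g h(2)] B.scal_mult_left B.scal_mult_right mult.commute)
    qed
    then show ?thesis
      by (subst conv_alt0) (auto simp: g0 B.V.scale_sum_right intro!: sum.cong)
  qed
  finally show ?thesis by (simp add: B.V.scale_right_distrib)
qed

lemma ainf_morphismI:
  assumes g: "mlin (scal A) (scal B) g" and g0: "g [] = 0"
    and gg: "sdeg g"
    and E: "\<And>xs. Eop g xs = 0"
  shows "ainf_morphism A (ainf_mult A) B (ainf_mult B) (shift g)"
  unfolding ainf_morphism_def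
proof (intro conjI allI impI)
  fix xs ys
  show "Vector_Spaces.linear (scal A) (scal B) (\<lambda>x. shift g (xs @ x # ys))"
    by (rule mlin_at[OF mlin_shift[OF g]])
next
  fix ks and xs :: "'a list" assume "xs \<noteq> []" "list_all2 (\<lambda>k x. x \<in> gr A k) ks xs"
  then show "shift g xs \<in> gr B (sum_list ks + 1 - int (length xs))"
    by (intro shift_gr[OF g] sdegD[OF gg])
next
  fix ks and xs :: "'a list" assume xs: "xs \<noteq> []" "list_all2 (\<lambda>k x. x \<in> gr A k) ks xs"
  have "A.DD1 g xs + A.DD2 g xs = diff B (g xs) + conv (\<lambda>l. B.sg (g l)) g xs"
    using E[of xs] by (simp add: Eop_def Qop_def algebra_simps)
  then show "(\<Sum>(r, s) | 1 \<le> s \<and> r + s \<le> length xs.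
           scal B (ksgn (int r + int s * int (length xs - r - s) + (2 - int s) * sum_list (take r ks)))
             (shift g (take r xs @ ainf_mult A (take s (drop r xs)) # drop (r + s) xs)))
    = (\<Sum>js | sum_list js = length xs \<and> 0 \<notin> set js.
             scal B (ksgn (tensor_sign js ks)) (ainf_mult B (map (shift g) (blocks js xs))))"
    unfolding lhs_sum[OF g xs(2)] rhs_sum[OF g g0 xs(2,1) gg] by simp
qed

lemma ainf_morphismD:
  assumes f: "ainf_morphism A (ainf_mult A) B (ainf_mult B) f"
  obtains g where "mlin (scal A) (scal B) g" "g [] = 0"
    "sdeg g"
    "\<And>ks xs. list_all2 (\<lambda>k x. x \<in> gr A k) ks xs \<Longrightarrow> xs \<noteq> [] \<Longrightarrow> Eop g xs = 0"
    "\<And>x. f [x] = g [x]"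
proof
  \<comment> \<open>The value on the empty list is unconstrained in an A-infinity morphism, but the
    convolution formalism needs it to be 0.\<close>
  define f' where "f' = (\<lambda>xs. if xs = [] then 0 else f xs)"
  have lf: "mlin (scal A) (scal B) f'"
    using f by (simp add: ainf_morphism_def mlin_def f'_def)
  define g where "g = shift f'"
  show g: "mlin (scal A) (scal B) g" unfolding g_def by (rule mlin_shift[OF lf])
  show g0: "g [] = 0" by (simp add: g_def shift_def f'_def)
  show "f [x] = g [x]" for x by (simp add: g_def shift_def f'_def)
  show gg: "sdeg g"
    unfolding g_def sdeg_def
  proof (intro allI impI)
    fix ks and ys :: "'a list" assume *: "list_all2 (\<lambda>k x. x \<in> gr A k) ks ys" "ys \<noteq> []"
    then have "f ys \<in> gr B (sum_list ks + 1 - int (length ys))"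
      using f unfolding ainf_morphism_def by (elim conjE) blast
    then show "shift f' ys \<in> gr B (sum_list ks + 1 - int (length ys))"
      using * by (intro shift_gr[OF lf]) (simp_all add: f'_def)
  qed
  show "Eop g xs = 0" if xs: "list_all2 (\<lambda>k x. x \<in> gr A k) ks xs" and ne: "xs \<noteq> []" for ks xs
  proof -
    have f': "f' = shift g" by (simp add: g_def)
    have "(\<Sum>(r, s) | 1 \<le> s \<and> r + s \<le> length xs.
           scal B (ksgn (int r + int s * int (length xs - r - s) + (2 - int s) * sum_list (take r ks)))
             (f (take r xs @ ainf_mult A (take s (drop r xs)) # drop (r + s) xs)))
      = (\<Sum>js | sum_list js = length xs \<and> 0 \<notin> set js.
             scal B (ksgn (tensor_sign js ks)) (ainf_mult B (map f (blocks js xs))))"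
      using f xs ne unfolding ainf_morphism_def by blast
    \<comment> \<open>A composition without zeros has no empty block, so the change at the empty
      list is invisible.\<close>
    moreover have "map f (blocks js xs) = map f' (blocks js xs)"
      if "sum_list js = length xs" "0 \<notin> set js" for js
    proof -
      have "[] \<notin> set (blocks js xs)" using that
      proof (induction js arbitrary: xs)
        case (Cons j js)
        then have "xs \<noteq> []" "j \<le> length xs" by auto
        then show ?case using Cons by auto
      qed simp
      then show ?thesis by (auto simp: f'_def)
    qed
    ultimately have "(\<Sum>(r, s) | 1 \<le> s \<and> r + s \<le> length xs.
           scal B (ksgn (int r + int s * int (length xs - r - s) + (2 - int s) * sum_list (take r ks)))
             (f' (take r xs @ ainf_mult A (take s (drop r xs)) # drop (r + s) xs)))
      = (\<Sum>js | sum_list js = length xs \<and> 0 \<notin> set js.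
             scal B (ksgn (tensor_sign js ks)) (ainf_mult B (map f' (blocks js xs))))"
      by (simp add: f'_def)
    then have "scal B (ksgn (int (length xs) - 1 + esum ks)) (A.DD1 g xs + A.DD2 g xs)
      = scal B (ksgn (int (length xs) - 1 + esum ks)) (diff B (g xs) + conv (\<lambda>l. B.sg (g l)) g xs)"
      unfolding f' lhs_sum[OF g xs] rhs_sum[OF g g0 xs ne gg] .
    then have "A.DD1 g xs + A.DD2 g xs = diff B (g xs) + conv (\<lambda>l. B.sg (g l)) g xs"
      by (simp add: ksgn_def split: if_splits)
    then show ?thesis by (simp add: Eop_def Qop_def algebra_simps)
  qed
qed

end

section \<open>Cyclic equations in arities four and five\<close>

context cdga_pair
begin

lemma sg_deg2:
  assumes "Vector_Spaces.linear (scal A) (scal B) f" "\<And>k x. x \<in> gr A k \<Longrightarrow> f x \<in> gr B (k + q)"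
  shows "f (A.sg x) = scal B (ksgn q) (B.sg (f x))"
  by (rule A.lin_ext_hom[of "scal B" "\<lambda>x. f (A.sg x)" "\<lambda>x. scal B (ksgn q) (B.sg (f x))" x,
        OF lin_comp[OF A.lin_sg assms(1)] lin_scale_fun[OF lin_comp[OF assms(1) B.lin_sg]]])
     (auto simp: A.sg_hom B.sg_hom[OF assms(2)] lin_rules[OF assms(1)] ksgn_def)

end

context cdga
begin

lemma bilin_ext_hom:
  assumes "\<And>y. Vector_Spaces.linear (scal A) t (\<lambda>x. f x y)" "\<And>x. Vector_Spaces.linear (scal A) t (f x)"
    "\<And>y. Vector_Spaces.linear (scal A) t (\<lambda>x. g x y)" "\<And>x. Vector_Spaces.linear (scal A) t (g x)"
    and "\<And>k l x y. x \<in> gr A k \<Longrightarrow> y \<in> gr A l \<Longrightarrow> f x y = g x y"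
  shows "f x y = g x y"
proof -
  have *: "f x y = g x y" if "x \<in> gr A k" for x k
    by (rule lin_ext_hom[OF assms(2)[of x] assms(4)[of x]]) (rule assms(5)[OF that])
  show ?thesis by (rule lin_ext_hom[OF assms(1)[of y] assms(3)[of y]]) (rule *)
qed

end

context hodge
begin

text \<open>The shifted Koszul exponent for exchanging an element of degree k with one of degree n -
  k is (k - 1)(n - k - 1), which is even for odd n and congruent to k - 1 for even n. So rotating an
  argument to the end costs \<open>rho\<close>.\<close>

definition rho :: "'a \<Rightarrow> 'a" where "rho x = (if odd n then x else sg x)"

lemma lin_rho: "Vector_Spaces.linear (scal A) (scal A) rho"
  unfolding rho_def[abs_def] using lin_id[OF vs] lin_sg by (cases "odd n") simp_all

lemma rho_H [simp]: "x \<in> Hs \<Longrightarrow> rho x \<in> Hs"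
  by (simp add: rho_def)

lemma rho_gr: "x \<in> gr A k \<Longrightarrow> rho x \<in> gr A k"
  by (simp add: rho_def sg_gr)

lemma rho_pr: "rho (pr x) = pr (rho x)"
  by (simp add: rho_def sg_pr)

text \<open>Antisymmetry of the shifted pairing; the Koszul sign only depends on one argument because
  the degrees add up to \<open>n\<close>.\<close>

lemma pairing_anti: "J (sg u * v) = - J (sg v * rho u)"
proof (rule bilin_ext_hom[of "(*)" "\<lambda>u v. J (sg u * v)" "\<lambda>u v. - J (sg v * rho u)"])
  show "Vector_Spaces.linear (scal A) (*) (\<lambda>u. J (sg u * v))" for v
    by (rule lin_comp[OF lin_comp[OF lin_sg lin_mult_left] lin_J])
  show "Vector_Spaces.linear (scal A) (*) (\<lambda>v. J (sg u * v))" for u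
    by (rule lin_comp[OF lin_mult_right lin_J])
  show "Vector_Spaces.linear (scal A) (*) (\<lambda>u. - J (sg v * rho u))" for v
    by (rule lin_neg_fun[OF lin_comp[OF lin_comp[OF lin_rho lin_mult_right] lin_J]])
  show "Vector_Spaces.linear (scal A) (*) (\<lambda>v. - J (sg v * rho u))" for u
    by (rule lin_neg_fun[OF lin_comp[OF lin_comp[OF lin_sg lin_mult_left] lin_J]])
  fix k l u v assume uv: "u \<in> gr A k" "v \<in> gr A l"
  show "J (sg u * v) = - J (sg v * rho u)"
  proof (cases "k + l = int n")
    case False
    then show ?thesis
      using J_hom[OF mult_gr[OF sg_gr[OF uv(1)] uv(2)]] J_hom[OF mult_gr[OF sg_gr[OF uv(2)] rho_gr[OF uv(1)]]]
      by (simp add: add.commute)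
  next
    case True
    then have "odd n \<longleftrightarrow> odd (k + l)" by simp
    then show ?thesis using gcomm[OF uv]
      by (auto simp: rho_def sg_hom[OF uv(1)] sg_hom[OF uv(2)] scal_mult_left scal_mult_right ksgn_def)
  qed
qed

lemma J_sg_zero: "J (sg v) = 0 \<longleftrightarrow> J v = 0"
proof -
  have "J (sg v) = ksgn (int n - 1) * J v"
  proof (rule lin_ext_hom[OF lin_comp[OF lin_sg lin_J] lin_scale_fun[OF lin_J]])
    fix k x assume "x \<in> gr A k"
    then show "J (sg x) = ksgn (int n - 1) * J x"
      by (cases "k = int n") (simp_all add: sg_hom J_hom)
  qed
  then show ?thesis by (simp add: ksgn_def)
qed

end

section \<open>Isomorphisms between harmonic subspaces and Riesz vectors\<close>

locale hodge_morphism = hodge_pair A n I Hs Bs i r B I' Hs' Bs' i'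
  for A :: "('f::field_char_0, 'a::ring_1) dg_alg" and n I Hs Bs i r
    and B :: "('f, 'b::ring_1) dg_alg" and I' Hs' Bs' i' +
  fixes th :: "'a \<Rightarrow> 'b"
  assumes lin_th: "Vector_Spaces.linear (scal A) (scal B) th"
    and th_H [simp]: "th x \<in> Hs'" and th_pr [simp]: "th (A.pr x) = th x" and th_one [simp]: "th 1 = 1"
    and th_gr: "x \<in> gr A k \<Longrightarrow> th x \<in> gr B k" and th_bij: "bij_betw th Hs Hs'"
    and th_mult: "x \<in> Hs \<Longrightarrow> y \<in> Hs \<Longrightarrow> B.pr (th x * th y) = th (x * y)"
begin

lemmas th_simps [simp] = lin_rules[OF lin_th]

lemma th_sg: "th (A.sg x) = B.sg (th x)"
  using sg_deg2[OF lin_th, of 0] by (simp add: th_gr)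

lemma th_rho: "th (A.rho x) = B.rho (th x)"
  by (simp add: A.rho_def B.rho_def th_sg)

lemma th_hc: "B.hc k (th x) = th (A.hc k x)"
  by (rule A.lin_ext_hom[OF lin_comp[OF lin_th B.lin_hc] lin_comp[OF A.lin_hc lin_th]])
     (auto simp: A.hc_hom B.hc_hom[OF th_gr])

lemma th_d [simp]: "diff B (th x) = 0" by (simp add: B.d_H)

lemma pr_th [simp]: "B.pr (th x) = th x" by simp

definition thi :: "'b \<Rightarrow> 'a" where "thi u = inv_into Hs th (B.pr u)"

lemma thi_H [simp]: "thi u \<in> Hs" and th_thi: "th (thi u) = B.pr u"
proof -
  have "B.pr u \<in> th ` Hs" using th_bij by (simp add: bij_betw_def)
  then show "thi u \<in> Hs" "th (thi u) = B.pr u" by (simp_all add: thi_def inv_into_into f_inv_into_f)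
qed

lemma th_inj: "x \<in> Hs \<Longrightarrow> y \<in> Hs \<Longrightarrow> th x = th y \<Longrightarrow> x = y"
  using th_bij by (auto simp: bij_betw_def inj_on_def)

lemma thi_th: "x \<in> Hs \<Longrightarrow> thi (th x) = x"
  by (intro th_inj) (simp_all add: th_thi)

lemma lin_thi: "Vector_Spaces.linear (scal B) (scal A) thi"
  unfolding Vector_Spaces.linear_iff
  by (intro conjI A.vs B.vs allI; rule th_inj) (simp_all add: th_thi)

lemma riesz_th:
  assumes "Vector_Spaces.linear (scal A) (*) L"
  shows "\<exists>!v. v \<in> Hs' \<and> (\<forall>y\<in>Hs. B.J (B.sg v * th y) = L y)"
proof -
  have "(\<forall>y\<in>Hs. B.J (B.sg v * th y) = L y) \<longleftrightarrow> (\<forall>w\<in>Hs'. B.J (B.sg v * w) = L (thi w))" for v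
  proof
    assume a: "\<forall>y\<in>Hs. B.J (B.sg v * th y) = L y"
    show "\<forall>w\<in>Hs'. B.J (B.sg v * w) = L (thi w)"
    proof
      fix w assume "w \<in> Hs'"
      then show "B.J (B.sg v * w) = L (thi w)" using a[rule_format, of "thi w"] by (simp add: th_thi)
    qed
  next
    assume a: "\<forall>w\<in>Hs'. B.J (B.sg v * w) = L (thi w)"
    show "\<forall>y\<in>Hs. B.J (B.sg v * th y) = L y" using a by (simp add: thi_th)
  qed
  then show ?thesis using B.riesz_ex[OF lin_comp[OF lin_thi assms]] by simp
qed

definition rz :: "('a \<Rightarrow> 'f) \<Rightarrow> 'b" where
  "rz L = (THE v. v \<in> Hs' \<and> (\<forall>y\<in>Hs. B.J (B.sg v * th y) = L y))"

lemma
  assumes "Vector_Spaces.linear (scal A) (*) L"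
  shows rz_H: "rz L \<in> Hs'" and rz_pair: "y \<in> Hs \<Longrightarrow> B.J (B.sg (rz L) * th y) = L y"
    and rz_unique: "v \<in> Hs' \<Longrightarrow> (\<And>y. y \<in> Hs \<Longrightarrow> B.J (B.sg v * th y) = L y) \<Longrightarrow> rz L = v"
  using theI'[OF riesz_th[OF assms]] the1_equality[OF riesz_th[OF assms], of v] by (auto simp: rz_def)

lemma rz_add:
  assumes "Vector_Spaces.linear (scal A) (*) L" "Vector_Spaces.linear (scal A) (*) L'"
  shows "rz (\<lambda>y. L y + L' y) = rz L + rz L'"
  by (rule rz_unique) (simp_all add: lin_add_fun assms rz_H rz_pair distrib_right)

lemma rz_scale:
  assumes "Vector_Spaces.linear (scal A) (*) L"
  shows "rz (\<lambda>y. a * L y) = scal B a (rz L)"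
  by (rule rz_unique) (simp_all add: lin_scale_fun[OF assms] assms rz_H rz_pair B.scal_mult_left)

lemma rz_zero: "rz (\<lambda>y. 0) = 0"
  by (rule rz_unique) (simp_all add: lin_zero_fun A.vs vs_field)

lemma lin_rz:
  assumes "\<And>x. Vector_Spaces.linear (scal A) (*) (G x)" "\<And>y. Vector_Spaces.linear (scal A) (*) (\<lambda>x. G x y)"
  shows "Vector_Spaces.linear (scal A) (scal B) (\<lambda>x. rz (G x))"
  unfolding Vector_Spaces.linear_iff
proof (intro conjI A.vs B.vs allI)
  show "rz (G (x + y)) = rz (G x) + rz (G y)" for x y
  proof -
    have "G (x + y) = (\<lambda>v. G x v + G y v)" by (rule ext) (rule lin_add[OF assms(2)])
    then show ?thesis using rz_add[OF assms(1) assms(1), of x y] by simp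
  qed
  show "rz (G (scal A a x)) = scal B a (rz (G x))" for a x
  proof -
    have "G (scal A a x) = (\<lambda>v. a * G x v)" by (rule ext) (rule lin_scale[OF assms(2)])
    then show ?thesis using rz_scale[OF assms(1), of a x] by simp
  qed
qed

lemma rz_gr:
  assumes L: "Vector_Spaces.linear (scal A) (*) L" and "\<And>l y. y \<in> gr A l \<Longrightarrow> l \<noteq> int n - k \<Longrightarrow> L y = 0"
  shows "rz L \<in> gr B k"
proof -
  \<comment> \<open>A functional supported in degree n - k is already represented by the degree k
    component, so uniqueness excludes all others.\<close>
  have "rz L = B.hc k (rz L)"
  proof (rule rz_unique[OF L])
    fix y assume y: "y \<in> Hs"
    have "L y = (\<Sum>l\<in>{0..int n}. L (A.hc l y))" by (rule A.lin_expand[OF L])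
    also have "\<dots> = (\<Sum>l\<in>{0..int n}. if l = int n - k then L (A.hc (int n - k) y) else 0)"
      by (intro sum.cong) (auto intro: assms(2)[OF A.hc_gr])
    also have "\<dots> = L (A.hc (int n - k) y)" using A.hc_out[of "int n - k" y] lin_0[OF L] by auto
    finally have "L y = L (A.hc (int n - k) y)" .
    also have "\<dots> = B.J (B.sg (rz L) * th (A.hc (int n - k) y))" using rz_pair[OF L] y by simp
    also have "\<dots> = B.J (B.hc k (B.sg (rz L)) * th (A.hc (int n - k) y))"
      using B.J_left[OF th_gr[OF A.hc_gr], of "B.sg (rz L)" "int n - k" y] by simp
    also have "\<dots> = B.J (B.hc k (B.sg (rz L)) * th y)"
      using B.J_right[OF B.hc_gr, of k "B.sg (rz L)" "th y"] by (simp add: th_hc)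
    also have "B.hc k (B.sg (rz L)) = B.sg (B.hc k (rz L))"
      by (simp add: B.hc_sg B.sg_hom[OF B.hc_gr])
    finally show "B.J (B.sg (B.hc k (rz L)) * th y) = L y" by simp
  qed (use rz_H[OF L] in simp)
  then show ?thesis by (metis B.hc_gr)
qed

text \<open>\<open>S x y = \<phi>(\<xi>(\<plusminus>x, y))\<close> for a Hochschild cochain \<open>\<xi>\<close> bounding the difference of the ternary products.\<close>

definition cobounds :: "('a \<Rightarrow> 'a \<Rightarrow> 'b) \<Rightarrow> bool" where
  "cobounds S \<longleftrightarrow> (\<forall>x y. S x y \<in> Hs' \<and> S (A.pr x) y = S x y \<and> S x (A.pr y) = S x y) \<and>
    (\<forall>x. Vector_Spaces.linear (scal A) (scal B) (S x)) \<and>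
    (\<forall>y. Vector_Spaces.linear (scal A) (scal B) (\<lambda>x. S x y)) \<and>
    (\<forall>k l x y. x \<in> gr A k \<longrightarrow> y \<in> gr A l \<longrightarrow> S x y \<in> gr B (k + l - 1)) \<and>
    (\<forall>x\<in>Hs. \<forall>y\<in>Hs. \<forall>z\<in>Hs.
      B.pr (B.sg (th x) * S y z + B.sg (S x y) * th z) - S (A.sg x * y) z - S (A.sg x) (A.sg y * z)
      - B.pr (B.sg (th x) * B.hm (B.sg (th y) * th z) + B.sg (B.hm (B.sg (th x) * th y)) * th z)
      + th (A.sg (A.hm (A.sg x * y)) * z + A.sg x * A.hm (A.sg y * z)) = 0)"

lemma
  assumes "cobounds S"
  shows cobH: "S x y \<in> Hs'" and cobpr: "S (A.pr x) y = S x y" "S x (A.pr y) = S x y"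
    and coblin: "Vector_Spaces.linear (scal A) (scal B) (S x)" "Vector_Spaces.linear (scal A) (scal B) (\<lambda>x. S x y)"
    and cobgr: "x \<in> gr A k \<Longrightarrow> y \<in> gr A l \<Longrightarrow> S x y \<in> gr B (k + l - 1)"
    and cob3: "x \<in> Hs \<Longrightarrow> y \<in> Hs \<Longrightarrow> z \<in> Hs \<Longrightarrow>
      B.pr (B.sg (th x) * S y z + B.sg (S x y) * th z) - S (A.sg x * y) z - S (A.sg x) (A.sg y * z)
      - B.pr (B.sg (th x) * B.hm (B.sg (th y) * th z) + B.sg (B.hm (B.sg (th x) * th y)) * th z)
      + th (A.sg (A.hm (A.sg x * y)) * z + A.sg x * A.hm (A.sg y * z)) = 0"
  using assms unfolding cobounds_def by blast+

end

section \<open>Solution of the cyclic equations\<close>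

locale normalized_cobounding = hodge_morphism A n I Hs Bs i r B I' Hs' Bs' i' th
  for A :: "('f::field_char_0, 'a::ring_1) dg_alg" and n I Hs Bs i r
    and B :: "('f, 'b::ring_1) dg_alg" and I' Hs' Bs' i' th +
  fixes T :: "'a \<Rightarrow> 'a \<Rightarrow> 'b"
  assumes cob: "cobounds T" and J_T [simp]: "B.J (T x y) = 0"
begin

lemmas T_r [simp] = lin_rules[OF coblin(1)[OF cob]] and T_l [simp] = lin_rules[OF coblin(2)[OF cob]]
lemmas T_H [simp] = cobH[OF cob] and T_pr [simp] = cobpr[OF cob]

lemma T_sg: "T (A.sg x) (A.sg y) = B.sg (T x y)"
  by (rule A.bilin_ext_hom[of "scal B" "\<lambda>x y. T (A.sg x) (A.sg y)" "\<lambda>x y. B.sg (T x y)"])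
     (auto intro: lin_comp[OF _ B.lin_sg] coblin[OF cob] lin_comp[OF A.lin_sg coblin(1)[OF cob]] lin_comp[OF A.lin_sg coblin(2)[OF cob]]
       simp: A.sg_hom B.sg_hom[OF cobgr[OF cob]] ksgn_def)

lemma T_rho: "T (A.rho x) (A.rho y) = B.rho (T x y)"
  by (simp add: A.rho_def B.rho_def T_sg)

lemma T_11: "T 1 1 = 0"
  using cobgr[OF cob A.one_gr A.one_gr] B.gr_out[of "- 1"] by simp

text \<open>At 1, 1, x the homotopies are applied to harmonic elements and vanish; the cobounding
  equation reduces to - T 1 x = 0.\<close>

lemma T_1l [simp]: "T 1 x = 0"
proof -
  have "T 1 (A.pr x) = 0" using cob3[OF cob, of 1 1 "A.pr x"] T_11 by simp
  then show ?thesis by simp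
qed

lemma T_1r [simp]: "T x 1 = 0"
proof -
  have "B.sg (T (A.pr x) 1) = 0" using cob3[OF cob, of "A.pr x" 1 1] T_11 by simp
  then have "B.sg (B.sg (T x 1)) = 0" by simp
  then show ?thesis by (simp only: B.sg_sg)
qed

definition H4 :: "'a \<Rightarrow> 'a \<Rightarrow> 'a \<Rightarrow> 'a \<Rightarrow> 'f" where
  "H4 x y z w = B.J (B.sg (T x y) * T z w)"

lemma H4_lin:
  "Vector_Spaces.linear (scal A) (*) (\<lambda>x. H4 x y z w)" "Vector_Spaces.linear (scal A) (*) (\<lambda>y. H4 x y z w)"
  "Vector_Spaces.linear (scal A) (*) (\<lambda>z. H4 x y z w)" "Vector_Spaces.linear (scal A) (*) (\<lambda>w. H4 x y z w)"
  unfolding Vector_Spaces.linear_iff H4_def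
  by (auto simp: A.vs vs_field algebra_simps B.scal_mult_left B.scal_mult_right)

text \<open>Let t be the rotation that moves the first argument to the end through
  \<open>rho\<close>. Antisymmetry turns the cyclic equation for the functional G of the unknown map
  into G - t G = - \<open>H4\<close>. Since t^2 \<open>H4\<close> = - \<open>H4\<close>, the choice
  G = - (1 + t) \<open>H4\<close> / 2 solves it.\<close>

definition G3 :: "'a \<Rightarrow> 'a \<Rightarrow> 'a \<Rightarrow> 'a \<Rightarrow> 'f" where
  "G3 x y z w = - (1 / 2) * (H4 x y z w + H4 y z w (A.rho x))"

lemma G3_lin:
  "Vector_Spaces.linear (scal A) (*) (\<lambda>x. G3 x y z w)" "Vector_Spaces.linear (scal A) (*) (\<lambda>y. G3 x y z w)"
  "Vector_Spaces.linear (scal A) (*) (\<lambda>z. G3 x y z w)" "Vector_Spaces.linear (scal A) (*) (\<lambda>w. G3 x y z w)"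
  unfolding G3_def
  by (rule lin_scale_fun[OF lin_add_fun], (rule H4_lin lin_comp[OF A.lin_rho H4_lin(4)])+)+

text \<open>The solution of the cyclic equation \<open>\<omega>(x\<^sub>1, C(x\<^sub>2,x\<^sub>3,x\<^sub>4)) + \<omega>(T(x\<^sub>1,x\<^sub>2), T(x\<^sub>3,x\<^sub>4)) +
  \<omega>(C(x\<^sub>1,x\<^sub>2,x\<^sub>3), x\<^sub>4) = 0\<close>. It exists because the square of the rotation maps the middle term to its negative.\<close>

definition C3 :: "'a \<Rightarrow> 'a \<Rightarrow> 'a \<Rightarrow> 'b" where "C3 x y z = rz (G3 x y z)"

lemma C3_H [simp]: "C3 x y z \<in> Hs'" unfolding C3_def by (rule rz_H[OF G3_lin(4)])

lemma C3_pair: "w \<in> Hs \<Longrightarrow> B.J (B.sg (C3 x y z) * th w) = G3 x y z w"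
  unfolding C3_def by (rule rz_pair[OF G3_lin(4)])

lemma C3_lin:
  "Vector_Spaces.linear (scal A) (scal B) (\<lambda>x. C3 x y z)" "Vector_Spaces.linear (scal A) (scal B) (\<lambda>y. C3 x y z)"
  "Vector_Spaces.linear (scal A) (scal B) (\<lambda>z. C3 x y z)"
  unfolding C3_def by (rule lin_rz; rule G3_lin)+

lemmas C3_simps [simp] = lin_rules[OF C3_lin(1)] lin_rules[OF C3_lin(2)] lin_rules[OF C3_lin(3)]

lemma rho_1: "A.rho 1 = 1 \<or> A.rho 1 = - 1" by (simp add: A.rho_def)

lemma G3_pr: "G3 (A.pr x) y z = G3 x y z" "G3 x (A.pr y) z = G3 x y z" "G3 x y (A.pr z) = G3 x y z"
  by (simp_all add: fun_eq_iff G3_def H4_def A.rho_pr)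

lemma C3_pr [simp]: "C3 (A.pr x) y z = C3 x y z" "C3 x (A.pr y) z = C3 x y z" "C3 x y (A.pr z) = C3 x y z"
  by (simp_all add: C3_def G3_pr)

lemma C3_1 [simp]: "C3 1 y z = 0" "C3 x 1 z = 0" "C3 x y 1 = 0"
proof -
  have "G3 1 y z = (\<lambda>w. 0)" "G3 x 1 z = (\<lambda>w. 0)" "G3 x y 1 = (\<lambda>w. 0)"
    using rho_1 by (auto simp: fun_eq_iff G3_def H4_def)
  then show "C3 1 y z = 0" "C3 x 1 z = 0" "C3 x y 1 = 0" by (simp_all add: C3_def rz_zero)
qed

lemma C3_gr:
  assumes "x \<in> gr A j" "y \<in> gr A k" "z \<in> gr A l"
  shows "C3 x y z \<in> gr B (j + k + l - 2)"
  unfolding C3_def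
proof (rule rz_gr[OF G3_lin(4)])
  fix m w assume w: "w \<in> gr A m" "m \<noteq> int n - (j + k + l - 2)"
  have "H4 x y z w = 0" unfolding H4_def
    by (rule B.J_hom[OF B.mult_gr[OF B.sg_gr[OF cobgr[OF cob assms(1,2)]] cobgr[OF cob assms(3) w(1)]]])
       (use w in auto)
  moreover have "H4 y z w (A.rho x) = 0" unfolding H4_def
    by (rule B.J_hom[OF B.mult_gr[OF B.sg_gr[OF cobgr[OF cob assms(2,3)]] cobgr[OF cob w(1) A.rho_gr[OF assms(1)]]]])
       (use w in auto)
  ultimately show "G3 x y z w = 0" by (simp add: G3_def)
qed

text \<open>The integral of \<open>C3 x y z\<close> is, up to sign, its pairing with 1, and T
  vanishes on units.\<close>

lemma J_C3 [simp]: "B.J (C3 x y z) = 0"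
  using C3_pair[of 1 x y z] B.J_sg_zero[of "C3 x y z"] by (simp add: G3_def H4_def)

lemma cyc4:
  assumes "x \<in> Hs" "y \<in> Hs" "z \<in> Hs" "w \<in> Hs"
  shows "B.J (B.sg (th x) * C3 y z w) + H4 x y z w + B.J (B.sg (C3 x y z) * th w) = 0"
proof -
  have e1: "B.J (B.sg (th x) * C3 y z w) = - G3 y z w (A.rho x)"
    using B.pairing_anti[of "th x" "C3 y z w"] C3_pair[of "A.rho x"] assms by (simp add: th_rho[symmetric])
  have e2: "H4 z w (A.rho x) (A.rho y) = - H4 x y z w"
    using B.pairing_anti[of "T x y" "T z w"] by (simp add: H4_def T_rho)
  show ?thesis unfolding e1 C3_pair[OF assms(4)] G3_def e2 by (simp add: field_simps)
qed

definition H5 :: "'a \<Rightarrow> 'a \<Rightarrow> 'a \<Rightarrow> 'a \<Rightarrow> 'a \<Rightarrow> 'f" where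
  "H5 x y z w v = B.J (B.sg (C3 x y z) * T w v)"

lemma H5_lin:
  "Vector_Spaces.linear (scal A) (*) (\<lambda>x. H5 x y z w v)" "Vector_Spaces.linear (scal A) (*) (\<lambda>y. H5 x y z w v)"
  "Vector_Spaces.linear (scal A) (*) (\<lambda>z. H5 x y z w v)" "Vector_Spaces.linear (scal A) (*) (\<lambda>w. H5 x y z w v)"
  "Vector_Spaces.linear (scal A) (*) (\<lambda>v. H5 x y z w v)"
  unfolding Vector_Spaces.linear_iff H5_def
  by (auto simp: A.vs vs_field algebra_simps B.scal_mult_left B.scal_mult_right)

text \<open>With t the rotation, the two middle terms of the arity five equation are
  \<open>H5\<close> and - t^2 \<open>H5\<close>. Their sum (1 - t)(1 + t) \<open>H5\<close> is
  cancelled by G = - (1 + t) \<open>H5\<close>, without any division.\<close>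

definition G4 :: "'a \<Rightarrow> 'a \<Rightarrow> 'a \<Rightarrow> 'a \<Rightarrow> 'a \<Rightarrow> 'f" where
  "G4 x y z w v = - (H5 x y z w v + H5 y z w v (A.rho x))"

lemma G4_lin:
  "Vector_Spaces.linear (scal A) (*) (\<lambda>x. G4 x y z w v)" "Vector_Spaces.linear (scal A) (*) (\<lambda>y. G4 x y z w v)"
  "Vector_Spaces.linear (scal A) (*) (\<lambda>z. G4 x y z w v)" "Vector_Spaces.linear (scal A) (*) (\<lambda>w. G4 x y z w v)"
  "Vector_Spaces.linear (scal A) (*) (\<lambda>v. G4 x y z w v)"
  unfolding G4_def
  by (rule lin_neg_fun[OF lin_add_fun], (rule H5_lin lin_comp[OF A.lin_rho H5_lin(5)])+)+

definition C4 :: "'a \<Rightarrow> 'a \<Rightarrow> 'a \<Rightarrow> 'a \<Rightarrow> 'b" where "C4 x y z w = rz (G4 x y z w)"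

lemma C4_H [simp]: "C4 x y z w \<in> Hs'" unfolding C4_def by (rule rz_H[OF G4_lin(5)])

lemma C4_pair: "v \<in> Hs \<Longrightarrow> B.J (B.sg (C4 x y z w) * th v) = G4 x y z w v"
  unfolding C4_def by (rule rz_pair[OF G4_lin(5)])

lemma C4_lin:
  "Vector_Spaces.linear (scal A) (scal B) (\<lambda>x. C4 x y z w)" "Vector_Spaces.linear (scal A) (scal B) (\<lambda>y. C4 x y z w)"
  "Vector_Spaces.linear (scal A) (scal B) (\<lambda>z. C4 x y z w)" "Vector_Spaces.linear (scal A) (scal B) (\<lambda>w. C4 x y z w)"
  unfolding C4_def by (rule lin_rz; rule G4_lin)+

lemma G4_pr: "G4 (A.pr x) y z w = G4 x y z w" "G4 x (A.pr y) z w = G4 x y z w"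
   "G4 x y (A.pr z) w = G4 x y z w" "G4 x y z (A.pr w) = G4 x y z w"
  by (simp_all add: fun_eq_iff G4_def H5_def A.rho_pr)

lemma C4_pr [simp]: "C4 (A.pr x) y z w = C4 x y z w" "C4 x (A.pr y) z w = C4 x y z w"
   "C4 x y (A.pr z) w = C4 x y z w" "C4 x y z (A.pr w) = C4 x y z w"
  by (simp_all add: C4_def G4_pr)

lemma C4_1 [simp]: "C4 1 y z w = 0" "C4 x 1 z w = 0" "C4 x y 1 w = 0" "C4 x y z 1 = 0"
proof -
  have "G4 1 y z w = (\<lambda>v. 0)" "G4 x 1 z w = (\<lambda>v. 0)" "G4 x y 1 w = (\<lambda>v. 0)" "G4 x y z 1 = (\<lambda>v. 0)"
    using rho_1 by (auto simp: fun_eq_iff G4_def H5_def)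
  then show "C4 1 y z w = 0" "C4 x 1 z w = 0" "C4 x y 1 w = 0" "C4 x y z 1 = 0" by (simp_all add: C4_def rz_zero)
qed

lemma C4_gr:
  assumes "x \<in> gr A j" "y \<in> gr A k" "z \<in> gr A l" "w \<in> gr A m"
  shows "C4 x y z w \<in> gr B (j + k + l + m - 3)"
  unfolding C4_def
proof (rule rz_gr[OF G4_lin(5)])
  fix p v assume v: "v \<in> gr A p" "p \<noteq> int n - (j + k + l + m - 3)"
  have "H5 x y z w v = 0" unfolding H5_def
    by (rule B.J_hom[OF B.mult_gr[OF B.sg_gr[OF C3_gr[OF assms(1-3)]] cobgr[OF cob assms(4) v(1)]]])
       (use v in auto)
  moreover have "H5 y z w v (A.rho x) = 0" unfolding H5_def
    by (rule B.J_hom[OF B.mult_gr[OF B.sg_gr[OF C3_gr[OF assms(2-4)]] cobgr[OF cob v(1) A.rho_gr[OF assms(1)]]]])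
       (use v in auto)
  ultimately show "G4 x y z w v = 0" by (simp add: G4_def)
qed

lemma J_C4 [simp]: "B.J (C4 x y z w) = 0"
  using C4_pair[of 1 x y z w] B.J_sg_zero[of "C4 x y z w"] by (simp add: G4_def H5_def)

lemma cyc5:
  assumes "x \<in> Hs" "y \<in> Hs" "z \<in> Hs" "w \<in> Hs" "v \<in> Hs"
  shows "B.J (B.sg (th x) * C4 y z w v) + B.J (B.sg (T x y) * C3 z w v) + H5 x y z w v
    + B.J (B.sg (C4 x y z w) * th v) = 0"
proof -
  have "B.J (B.sg (th x) * C4 y z w v) = - G4 y z w v (A.rho x)"
    using B.pairing_anti[of "th x" "C4 y z w v"] C4_pair[of "A.rho x"] assms by (simp add: th_rho[symmetric])
  moreover have "H5 z w v (A.rho x) (A.rho y) = - B.J (B.sg (T x y) * C3 z w v)"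
    using B.pairing_anti[of "T x y" "C3 z w v"] by (simp add: H5_def T_rho)
  ultimately show ?thesis using C4_pair[OF assms(5), of x y z w]
    by (simp add: G4_def)
qed

text \<open>The free parts stop at arity four: the cyclic sums to be killed have four or five
  arguments, and their splits use components of arity at most four.\<close>

fun cc :: "'a list \<Rightarrow> 'b" where
  "cc [x] = th x"
| "cc [x, y] = T x y"
| "cc [x, y, z] = C3 x y z"
| "cc [x, y, z, w] = C4 x y z w"
| "cc _ = 0"

lemma mlin_cc: "mlin (scal A) (scal B) cc"
proof -
  have z: "mlin (scal A) (scal B) (\<lambda>l. 0)" by (rule mlin_zero[OF A.vs B.vs])
  have lz: "Vector_Spaces.linear (scal A) (scal B) (\<lambda>l. 0)" by (rule lin_zero_fun[OF A.vs B.vs])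
  have 4: "mlin (scal A) (scal B) (\<lambda>l. cc (x # y # v # w # l))" for x y v w
  proof (rule mlinI)
    show "Vector_Spaces.linear (scal A) (scal B) (\<lambda>u. cc (x # y # v # w # u # ys))" for ys
      using lz by simp
    show "mlin (scal A) (scal B) (\<lambda>l. cc (x # y # v # w # u # l))" for u
      using z by simp
  qed
  have 3: "mlin (scal A) (scal B) (\<lambda>l. cc (x # y # v # l))" for x y v
  proof (rule mlinI)
    show "Vector_Spaces.linear (scal A) (scal B) (\<lambda>u. cc (x # y # v # u # ys))" for ys
      by (cases ys) (simp_all add: lz C4_lin)
  qed (rule 4)
  have 2: "mlin (scal A) (scal B) (\<lambda>l. cc (x # y # l))" for x y
  proof (rule mlinI)
    show "Vector_Spaces.linear (scal A) (scal B) (\<lambda>u. cc (x # y # u # ys))" for ys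
      by (cases ys; cases "tl ys") (auto simp: lz C4_lin C3_lin)
  qed (rule 3)
  have 1: "mlin (scal A) (scal B) (\<lambda>l. cc (x # l))" for x
  proof (rule mlinI)
    show "Vector_Spaces.linear (scal A) (scal B) (\<lambda>u. cc (x # u # ys))" for ys
      by (cases ys; cases "tl ys"; cases "tl (tl ys)") (auto simp: lz C4_lin C3_lin coblin[OF cob])
  qed (rule 2)
  show ?thesis
  proof (rule mlinI)
    show "Vector_Spaces.linear (scal A) (scal B) (\<lambda>u. cc (u # ys))" for ys
      by (cases ys; cases "tl ys"; cases "tl (tl ys)"; cases "tl (tl (tl ys))")
        (auto simp: lz C4_lin C3_lin coblin[OF cob] lin_th)
  qed (rule 1)
qed

lemma cc_long: "length xs \<ge> 5 \<Longrightarrow> cc xs = 0"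
  by (cases xs rule: cc.cases) auto

sublocale E: ainf_extension A n I Hs Bs i r B I' Hs' Bs' i' cc
proof
  show "mlin (scal A) (scal B) cc" by (rule mlin_cc)
  show "cc [] = 0" by simp
  show "cc (map A.pr xs) = cc xs" for xs by (cases xs rule: cc.cases) auto
  show "cc xs \<in> Hs'" for xs by (cases xs rule: cc.cases) auto
  show "cc [1] = 1" by simp
  show "length xs \<ge> 2 \<Longrightarrow> 1 \<in> set xs \<Longrightarrow> cc xs = 0" for xs by (cases xs rule: cc.cases) auto
  show "cc xs \<in> gr B (sum_list ks + 1 - int (length xs))"
    if hom: "list_all2 (\<lambda>k x. x \<in> gr A k) ks xs" and ne: "xs \<noteq> []" for ks xs
  proof (cases "length xs \<ge> 5")
    case True
    then show ?thesis by (simp add: cc_long B.gr_0)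
  next
    case False
    then consider x where "xs = [x]" | x y where "xs = [x, y]" | x y z where "xs = [x, y, z]"
      | x y z w where "xs = [x, y, z, w]"
      using ne by (cases xs rule: cc.cases) auto
    then show ?thesis
    proof cases
      case 1
      then show ?thesis using hom by (auto simp: list_all2_Cons2 th_gr)
    next
      case 2
      then obtain k l where "ks = [k, l]" "x \<in> gr A k" "y \<in> gr A l" using hom by (auto simp: list_all2_Cons2)
      then show ?thesis using cobgr[OF cob, of x k y l] 2 by (simp add: algebra_simps)
    next
      case 3
      then obtain k l m where "ks = [k, l, m]" "x \<in> gr A k" "y \<in> gr A l" "z \<in> gr A m" using hom by (auto simp: list_all2_Cons2)
      then show ?thesis using C3_gr[of x k y l z m] 3 by (simp add: algebra_simps)
    next
      case 4
      then obtain k l m p where "ks = [k, l, m, p]" "x \<in> gr A k" "y \<in> gr A l" "z \<in> gr A m" "w \<in> gr A p"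
        using hom by (auto simp: list_all2_Cons2)
      then show ?thesis using C4_gr[of x k y l z m w p] 4 by (simp add: algebra_simps)
    qed
  qed
  show "x \<in> Hs \<Longrightarrow> y \<in> Hs \<Longrightarrow> B.pr (B.sg (cc [x]) * cc [y]) = cc [A.sg x * y]" for x y
    using th_mult[of "A.sg x" y] by (simp add: th_sg)
  show "x \<in> Hs \<Longrightarrow> y \<in> Hs \<Longrightarrow> z \<in> Hs \<Longrightarrow>
      B.pr (B.sg (cc [x]) * cc [y, z] + B.sg (cc [x, y]) * cc [z]) - cc [A.sg x * y, z] - cc [A.sg x, A.sg y * z]
      - B.pr (B.sg (cc [x]) * B.hm (B.sg (cc [y]) * cc [z]) + B.sg (B.hm (B.sg (cc [x]) * cc [y])) * cc [z])
      + cc [A.sg (A.hm (A.sg x * y)) * z + A.sg x * A.hm (A.sg y * z)] = 0" for x y z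
    using cob3[OF cob, of x y z] by (simp only: cc.simps)
  show "length xs \<ge> 2 \<Longrightarrow> B.J (cc xs) = 0" for xs by (cases xs rule: cc.cases) auto
  show "B.J (conv (\<lambda>l. B.sg (cc l)) cc xs) = 0" if "set xs \<subseteq> Hs" "length xs = 4 \<or> length xs = 5" for xs
    using that(2)
  proof
    assume "length xs = 4"
    then obtain x y z w where xs: "xs = [x, y, z, w]" by (auto simp: numeral_eq_Suc length_Suc_conv)
    then show ?thesis using cyc4[of x y z w] that(1) by (simp add: H4_def algebra_simps)
  next
    assume "length xs = 5"
    then obtain x y z w v where xs: "xs = [x, y, z, w, v]" by (auto simp: numeral_eq_Suc length_Suc_conv)
    then show ?thesis using cyc5[of x y z w v] that(1) by (simp add: H5_def algebra_simps)
  qed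
qed

lemma ex_ainf: "\<exists>f. ainf_morphism A (ainf_mult A) B (ainf_mult B) f \<and> (\<forall>x. f [x] = th x)"
proof (intro exI conjI allI)
  show "ainf_morphism A (ainf_mult A) B (ainf_mult B) (shift E.f)"
    by (rule ainf_morphismI[OF E.mlin_f E.f_Nil _ E.Eop_zero]) (simp add: sdeg_def E.f_gr)
  show "shift E.f [x] = th x" for x by (simp add: shift_def E.f_single)
qed

end

section \<open>The ternary product and normalized cochains\<close>

context hodge
begin

text \<open>Replacing a closed factor by its harmonic part changes the product by the exact element
  \<open>diff A (hm a * b)\<close>.\<close>

lemma pr_mult_l: "diff A a = 0 \<Longrightarrow> diff A b = 0 \<Longrightarrow> pr (pr a * b) = pr (a * b)"
proof -
  assume ab: "diff A a = 0" "diff A b = 0"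
  then have "a * b = pr a * b + diff A (hm a * b)" by (simp add: d_mult d_hm_closed algebra_simps)
  then show ?thesis by (metis add.right_neutral pr_d pr_simps(1))
qed

lemma pr_mult_r: "diff A a = 0 \<Longrightarrow> diff A b = 0 \<Longrightarrow> pr (a * pr b) = pr (a * b)"
proof -
  assume ab: "diff A a = 0" "diff A b = 0"
  then have "a * b = a * pr b + diff A (- (sg a * hm b))" by (simp add: d_mult d_hm_closed d_sg algebra_simps del: sg_d)
  then show ?thesis by (metis add.right_neutral pr_d pr_simps(1))
qed

lemma d_mult_closed: "diff A a = 0 \<Longrightarrow> diff A b = 0 \<Longrightarrow> diff A (a * b) = 0"
  by (simp add: d_mult)

lemma d_sg_closed: "diff A a = 0 \<Longrightarrow> diff A (sg a) = 0"
  by (simp add: d_sg del: sg_d)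

lemma pr_hc: "pr (hc k x) = hc k (pr x)"
  by (rule lin_ext_hom[OF lin_comp[OF lin_hc lin_pr] lin_comp[OF lin_pr lin_hc]])
     (auto simp: hc_hom hc_hom[OF pr_gr])

text \<open>The ternary product with its sign absorbed into \<open>sg\<close>, which makes it
  trilinear on the whole algebra; \<open>m3_N3\<close> gives the agreement with \<open>m3\<close>
  for a homogeneous first argument.\<close>

definition N3 :: "'a \<Rightarrow> 'a \<Rightarrow> 'a \<Rightarrow> 'a" where
  "N3 x y z = pr (hm (x * y) * z + sg x * hm (y * z))"

lemma N3_H [simp]: "N3 x y z \<in> Hs" by (simp add: N3_def)

lemma N3_gr: "x \<in> gr A k \<Longrightarrow> y \<in> gr A l \<Longrightarrow> z \<in> gr A m \<Longrightarrow> N3 x y z \<in> gr A (k + l + m - 1)"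
  unfolding N3_def
proof (intro pr_gr gr_add)
  assume *: "x \<in> gr A k" "y \<in> gr A l" "z \<in> gr A m"
  show "hm (x * y) * z \<in> gr A (k + l + m - 1)"
    using mult_gr[OF hm_gr[OF mult_gr[OF *(1,2)]] *(3)] by (simp add: algebra_simps)
  show "sg x * hm (y * z) \<in> gr A (k + l + m - 1)"
    using mult_gr[OF sg_gr[OF *(1)] hm_gr[OF mult_gr[OF *(2,3)]]] by (simp add: algebra_simps)
qed

lemma N3_lin:
  "N3 (x + x') y z = N3 x y z + N3 x' y z" "N3 x (y + y') z = N3 x y z + N3 x y' z"
  "N3 x y (z + z') = N3 x y z + N3 x y z'"
  "N3 (scal A a x) y z = scal A a (N3 x y z)" "N3 x (scal A a y) z = scal A a (N3 x y z)"
  "N3 x y (scal A a z) = scal A a (N3 x y z)"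
  by (simp_all add: N3_def algebra_simps scal_mult_left scal_mult_right V.scale_right_distrib)

lemma sg_hdeg: "x \<in> gr A k \<Longrightarrow> scal A (ksgn (hdeg A x)) x = - sg x"
proof (cases "x = 0")
  case False
  assume x: "x \<in> gr A k"
  have "hdeg A x = k" unfolding hdeg_def
    by (rule the_equality, rule x, rule gr_unique[OF _ x False])
  then show ?thesis using sg_hom[OF x] by (simp add: ksgn_diff)
qed simp

lemma m3_N3: "x \<in> gr A k \<Longrightarrow> m3 A Hs Bs x y z = N3 x y z"
proof -
  assume x: "x \<in> gr A k"
  have "scal A (ksgn (hdeg A x)) (x * hm (y * z)) = scal A (ksgn (hdeg A x)) x * hm (y * z)"
    by (simp add: scal_mult_left)
  then show ?thesis unfolding m3_def N3_def sg_hdeg[OF x] by simp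
qed

lemma mu3_eq: "X \<in> gpart HA k \<Longrightarrow> mu3 A Hs Bs i X Y Z = cls A (N3 (i X) (i Y) (i Z))"
  unfolding mu3_def by (subst m3_N3[OF i_gr]) auto

lemma mu3_part:
  assumes "X \<in> gpart HA k" "Y \<in> gpart HA l" "Z \<in> gpart HA m"
  shows "mu3 A Hs Bs i X Y Z \<in> gpart HA (k + l + m - 1)"
  by (subst mu3_eq[OF assms(1)]) (rule coh_partI'[OF N3_H N3_gr[OF i_gr[OF assms(1)] i_gr[OF assms(2)] i_gr[OF assms(3)]]])

lemma i_mu3:
  assumes "X \<in> gpart HA k" "Y \<in> gpart HA l" "Z \<in> gpart HA m"
  shows "i (mu3 A Hs Bs i X Y Z) = N3 (i X) (i Y) (i Z)"
  by (subst mu3_eq[OF assms(1)]) (rule i_cls[OF N3_H N3_gr[OF i_gr[OF assms(1)] i_gr[OF assms(2)] i_gr[OF assms(3)]]])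

lemma i_inj: "X \<in> gpart HA k \<Longrightarrow> Y \<in> gpart HA l \<Longrightarrow> i X = i Y \<Longrightarrow> X = Y"
  using cls_i by metis

lemma part_add: "X \<in> gpart HA k \<Longrightarrow> Y \<in> gpart HA k \<Longrightarrow> gadd HA X Y \<in> gpart HA k"
  by (elim coh_partE') (auto simp: coh_add intro!: coh_partI' gr_add)

lemma part_scale: "X \<in> gpart HA k \<Longrightarrow> gscale HA a X \<in> gpart HA k"
  by (elim coh_partE') (auto simp: coh_scale intro!: coh_partI' gr_scale)

lemma part_sub: "X \<in> gpart HA k \<Longrightarrow> Y \<in> gpart HA k \<Longrightarrow> gsub HA X Y \<in> gpart HA k"
  unfolding gsub_def by (intro part_add part_scale)

lemma part_mult: "X \<in> gpart HA k \<Longrightarrow> Y \<in> gpart HA l \<Longrightarrow> gmult HA X Y \<in> gpart HA (k + l)"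
  by (elim coh_partE) (auto simp: coh_mult intro!: coh_partI d_mult_closed mult_gr)

lemma part_zero: "gzero HA \<in> gpart HA k"
  unfolding coh_zero by (intro coh_partI) (simp_all add: gr_0)

lemma part_one: "gone HA \<in> gpart HA 0"
  unfolding coh_one by (intro coh_partI) (simp_all add: one_gr)

lemma i_sub: "X \<in> gpart HA k \<Longrightarrow> Y \<in> gpart HA k \<Longrightarrow> i (gsub HA X Y) = i X - i Y"
  unfolding gsub_def by (subst i_add[OF _ part_scale]) (auto simp: i_scale)

lemma i_mult: "X \<in> gpart HA k \<Longrightarrow> Y \<in> gpart HA l \<Longrightarrow> i (gmult HA X Y) = pr (i X * i Y)"
proof -
  assume XY: "X \<in> gpart HA k" "Y \<in> gpart HA l"
  have "gmult HA X Y = cls A (i X * i Y)"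
    using coh_mult[of "i X" "i Y"] d_H[OF i_H[OF XY(1)]] d_H[OF i_H[OF XY(2)]] XY by (simp add: cls_i)
  then show ?thesis
    using i_cls_closed[of "i X * i Y", OF d_mult_closed mult_gr[OF i_gr i_gr, OF XY]]
    by (simp add: d_H[OF i_H[OF XY(1)]] d_H[OF i_H[OF XY(2)]])
qed

lemma i_zero: "i (gzero HA) = 0" and i_one: "i (gone HA) = 1"
  using i_cls[of 0 0] i_cls[of 1 0] by (simp_all add: coh_zero coh_one gr_0 one_gr)

text \<open>The section i is injective on classes, so linearity of g can be checked on harmonic
  representatives, where it follows from that of G.\<close>

lemma part_linearI:
  assumes "\<And>x. x \<in> gpart HA k \<Longrightarrow> g x \<in> gpart HA l" and "\<And>x. x \<in> gpart HA k \<Longrightarrow> i (g x) = G (i x)"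
    and "\<And>x y. G (x + y) = G x + G y" and "\<And>a x. G (scal A a x) = scal A a (G x)"
  shows "part_linear HA k HA l g"
  unfolding part_linear_def
proof (intro conjI ballI allI)
  fix x y assume xy: "x \<in> gpart HA k" "y \<in> gpart HA k"
  have "i (g (gadd HA x y)) = i (gadd HA (g x) (g y))"
    using xy assms(2)[OF part_add[OF xy]] i_add[OF xy] i_add[OF assms(1)[OF xy(1)] assms(1)[OF xy(2)]]
    by (simp add: assms(2,3))
  then show "g (gadd HA x y) = gadd HA (g x) (g y)"
    by (intro i_inj[OF assms(1)[OF part_add[OF xy]] part_add[OF assms(1)[OF xy(1)] assms(1)[OF xy(2)]]])
next
  fix x a assume x: "x \<in> gpart HA k"
  have "i (g (gscale HA a x)) = i (gscale HA a (g x))"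
    using x assms(2)[OF part_scale[OF x]] i_scale[OF x] i_scale[OF assms(1)[OF x]]
    by (simp add: assms(2,4))
  then show "g (gscale HA a x) = gscale HA a (g x)"
    by (intro i_inj[OF assms(1)[OF part_scale[OF x]] part_scale[OF assms(1)[OF x]]])
qed (rule assms(1))

lemma mu3_trilinear: "trilinear_deg HA (- 1) (mu3 A Hs Bs i)"
  unfolding trilinear_deg_def
proof (intro allI ballI conjI)
  fix j k l X Y Z assume *: "X \<in> gpart HA j" "Y \<in> gpart HA k" "Z \<in> gpart HA l"
  have e: "j + k + l + - 1 = j + k + l - 1" by simp
  show "part_linear HA j HA (j + k + l + - 1) (\<lambda>x. mu3 A Hs Bs i x Y Z)"
    unfolding e by (rule part_linearI[where G = "\<lambda>u. N3 u (i Y) (i Z)"]) (use * in \<open>simp_all add: mu3_part i_mu3 N3_lin\<close>)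
  show "part_linear HA k HA (j + k + l + - 1) (\<lambda>x. mu3 A Hs Bs i X x Z)"
    unfolding e by (rule part_linearI[where G = "\<lambda>u. N3 (i X) u (i Z)"]) (use * in \<open>simp_all add: mu3_part i_mu3 N3_lin\<close>)
  show "part_linear HA l HA (j + k + l + - 1) (\<lambda>x. mu3 A Hs Bs i X Y x)"
    unfolding e by (rule part_linearI[where G = "\<lambda>u. N3 (i X) (i Y) u"]) (use * in \<open>simp_all add: mu3_part i_mu3 N3_lin\<close>)
qed

end

context hodge_morphism
begin

lemma th_mult': "diff A x = 0 \<Longrightarrow> diff A y = 0 \<Longrightarrow> th (x * y) = B.pr (th x * th y)"
proof -
  assume xy: "diff A x = 0" "diff A y = 0"
  have "th (x * y) = th (A.pr (A.pr x * A.pr y))"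
    using xy by (simp add: A.pr_mult_l A.pr_mult_r del: th_pr) simp
  also have "\<dots> = B.pr (th (A.pr x) * th (A.pr y))" by (simp add: th_mult del: th_pr) simp
  finally show ?thesis by simp
qed

text \<open>A cocycle correction \<open>\<delta>\<psi>\<close> removes the top-degree component of a graded symmetric cochain.\<close>

lemma normalize_cobounding:
  assumes S: "cobounds S"
    and sym: "\<And>k l x y. x \<in> gr A k \<Longrightarrow> y \<in> gr A l \<Longrightarrow> S y x = scal B (- ksgn ((k - 1) * (l - 1))) (S x y)"
  shows "\<exists>T. cobounds T \<and> (\<forall>x y. B.J (T x y) = 0)"
proof -
  note [simp] = lin_rules[OF coblin(1)[OF S]] lin_rules[OF coblin(2)[OF S]] cobH[OF S] cobpr[OF S]
  \<comment> \<open>The integral of the coboundary of \<open>psi\<close> consists of two pairings,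
    which agree by the symmetry of S and each equal \<open>G x y\<close>. So G has to be minus half
    of the integral of S.\<close>
  define G where "G x y = - (1 / 2) * B.J (S x y)" for x y
  have G1: "Vector_Spaces.linear (scal A) (*) (G x)" for x
    unfolding G_def[abs_def] by (rule lin_scale_fun[OF lin_comp[OF coblin(1)[OF S] B.lin_J]])
  have G2: "Vector_Spaces.linear (scal A) (*) (\<lambda>x. G x y)" for y
    unfolding G_def[abs_def] by (rule lin_scale_fun[OF lin_comp[OF coblin(2)[OF S] B.lin_J]])
  define psi where "psi x = rz (G x)" for x
  have lp: "Vector_Spaces.linear (scal A) (scal B) psi"
    unfolding psi_def[abs_def] by (rule lin_rz[OF G1 G2])
  note [simp] = lin_rules[OF lp]
  have psiH [simp]: "psi x \<in> Hs'" for x unfolding psi_def by (rule rz_H[OF G1])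
  have psi_pr [simp]: "psi (A.pr x) = psi x" for x by (simp add: psi_def G_def[abs_def])
  have psi_gr: "psi x \<in> gr B (k + (- 1))" if x: "x \<in> gr A k" for x k
    unfolding psi_def
  proof (rule rz_gr[OF G1])
    fix l y assume "y \<in> gr A l" "l \<noteq> int n - (k + - 1)"
    then show "G x y = 0" unfolding G_def
      by (simp add: B.J_hom[OF cobgr[OF S x]])
  qed
  have psi_sg: "psi (A.sg x) = - B.sg (psi x)" for x
    using sg_deg2[OF lp psi_gr, of x] by simp
  have dpsi [simp]: "diff B (psi x) = 0" for x by (simp add: B.d_H)
  \<comment> \<open>\<open>psi\<close> lowers the degree by one, so it could reach degree n only
    from degree n + 1, which is zero.\<close>
  have J_psi: "B.J (psi x) = 0" for x
  proof -
    have "B.J (psi x) = (\<Sum>l\<in>{0..int n}. B.J (psi (A.hc l x)))"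
      by (rule A.lin_expand[OF lin_comp[OF lp B.lin_J]])
    also have "\<dots> = 0"
      by (intro sum.neutral ballI B.J_hom[OF psi_gr[OF A.hc_gr]]) auto
    finally show ?thesis .
  qed
  have pair: "B.J (B.sg (psi x) * th y) = - (1 / 2) * B.J (S x y)" for x y
    using rz_pair[OF G1, of "A.pr y" x] by (simp add: psi_def G_def)
  \<comment> \<open>The second pairing arises from the first by graded commutativity, and the
    symmetry of S supplies the compensating sign.\<close>
  have pair': "B.J (th x * psi y) = - (1 / 2) * B.J (S x y)" for x y
  proof (rule A.bilin_ext_hom[of "(*)" "\<lambda>x y. B.J (th x * psi y)" "\<lambda>x y. - (1 / 2) * B.J (S x y)"])
    show "Vector_Spaces.linear (scal A) (*) (\<lambda>x. B.J (th x * psi y))" for y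
      by (rule lin_comp[OF lin_comp[OF lin_th B.lin_mult_left] B.lin_J])
    show "Vector_Spaces.linear (scal A) (*) (\<lambda>y. B.J (th x * psi y))" for x
      by (rule lin_comp[OF lin_comp[OF lp B.lin_mult_right] B.lin_J])
    show "Vector_Spaces.linear (scal A) (*) (\<lambda>x. - (1 / 2) * B.J (S x y))" for y
      using G2 by (simp add: G_def)
    show "Vector_Spaces.linear (scal A) (*) (\<lambda>y. - (1 / 2) * B.J (S x y))" for x
      using G1 by (simp add: G_def[abs_def])
    fix k l x y assume xy: "x \<in> gr A k" "y \<in> gr A l"
    have "B.J (th x * psi y) = ksgn (k * (l + - 1)) * B.J (psi y * th x)"
      using B.gcomm[OF th_gr[OF xy(1)] psi_gr[OF xy(2)]] by simp
    also have "B.J (psi y * th x) = ksgn l * B.J (B.sg (psi y) * th x)"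
      using B.sg_hom[OF psi_gr[OF xy(2)]] by (simp add: B.scal_mult_left ksgn_def)
    also have "\<dots> = ksgn l * (- (1 / 2) * (- ksgn ((k - 1) * (l - 1)) * B.J (S x y)))"
      unfolding pair sym[OF xy] by simp
    finally show "B.J (th x * psi y) = - (1 / 2) * B.J (S x y)"
      by (cases "even k"; cases "even l") (simp_all add: ksgn_def)
  qed
  \<comment> \<open>The shifted coboundary of \<open>psi\<close>; the projections on the arguments
    make it depend on harmonic parts only.\<close>
  define W where "W x y = B.pr (B.sg (psi x) * th y + th x * psi y) + psi (A.sg (A.pr x) * A.pr y)" for x y
  have W_gr: "W x y \<in> gr B (k + l - 1)" if xy: "x \<in> gr A k" "y \<in> gr A l" for k l x y
    unfolding W_def
  proof (intro B.gr_add B.pr_gr)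
    show "B.sg (psi x) * th y \<in> gr B (k + l - 1)"
      using B.mult_gr[OF B.sg_gr[OF psi_gr[OF xy(1)]] th_gr[OF xy(2)]] by (simp add: algebra_simps)
    show "th x * psi y \<in> gr B (k + l - 1)"
      using B.mult_gr[OF th_gr[OF xy(1)] psi_gr[OF xy(2)]] by (simp add: algebra_simps)
    show "psi (A.sg (A.pr x) * A.pr y) \<in> gr B (k + l - 1)"
      using psi_gr[OF A.mult_gr[OF A.sg_gr[OF A.pr_gr[OF xy(1)]] A.pr_gr[OF xy(2)]]] by simp
  qed
  have W_lin: "Vector_Spaces.linear (scal A) (scal B) (W x)" "Vector_Spaces.linear (scal A) (scal B) (\<lambda>x. W x y)" for x y
    unfolding Vector_Spaces.linear_iff W_def
    by (auto simp: A.vs B.vs algebra_simps A.scal_mult_left A.scal_mult_right B.scal_mult_left B.scal_mult_right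
        B.V.scale_right_distrib)
  have W_J: "B.J (W x y) = - B.J (S x y)" for x y
    by (simp add: W_def B.J_pr pair pair' J_psi)
  \<comment> \<open>The coboundary of a coboundary vanishes. Projections inside products are dropped
    first, which is possible because all factors are closed; then the terms of \<open>t1\<close> to
    \<open>t4\<close> cancel in pairs.\<close>
  have W3: "B.pr (B.sg (th x) * W y z + B.sg (W x y) * th z) - W (A.sg x * y) z - W (A.sg x) (A.sg y * z) = 0"
    if xyz: "x \<in> Hs" "y \<in> Hs" "z \<in> Hs" for x y z
  proof -
    have dx [simp]: "diff A x = 0" "diff A y = 0" "diff A z = 0" using xyz by (simp_all add: A.d_H)
    have cl [simp]: "diff A (A.sg x) = 0" "diff A (A.sg y) = 0" "diff A (A.sg x * y) = 0" "diff A (A.sg y * z) = 0"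
      by (simp_all add: A.d_sg A.d_mult del: A.sg_d)
    have clB [simp]: "diff B (B.sg (th u)) = 0" "diff B (B.sg (psi u)) = 0" "diff B (B.sg (psi u) * th v) = 0"
       "diff B (th u * psi v) = 0" "diff B (B.sg (th u) * th v) = 0" for u v
      by (simp_all add: B.d_sg B.d_mult del: B.sg_d)
    have psi_mult: "psi (A.sg (A.pr (A.sg x * y)) * z) = - psi (x * A.sg y * z)"
    proof -
      have "psi (A.sg (A.pr (A.sg x * y)) * z) = psi (A.pr (A.pr (A.sg (A.sg x * y)) * z))" by (simp add: A.sg_pr del: A.sg_mult)
      also have "\<dots> = psi (A.sg (A.sg x * y) * z)"
        by (subst A.pr_mult_l) (simp_all add: A.d_sg_closed del: A.sg_mult A.sg_d)
      finally show ?thesis by simp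
    qed
    have psi_mult2: "psi (x * A.pr (A.sg y * z)) = psi (x * A.sg y * z)"
    proof -
      have "psi (x * A.pr (A.sg y * z)) = psi (A.pr (x * A.pr (A.sg y * z)))" by simp
      also have "\<dots> = psi (x * (A.sg y * z))" by (subst A.pr_mult_r) simp_all
      finally show ?thesis by (simp add: mult.assoc)
    qed
    have t1: "B.pr (B.sg (th x) * W y z) = B.pr (B.sg (th x) * (B.sg (psi y) * th z) + B.sg (th x) * (th y * psi z))
      + B.pr (B.sg (th x) * psi (A.sg y * z))"
    proof -
      have "B.pr (B.sg (th x) * B.pr (B.sg (psi y) * th z + th y * psi z)) = B.pr (B.sg (th x) * (B.sg (psi y) * th z + th y * psi z))"
        by (rule B.pr_mult_r) simp_all
      then show ?thesis using xyz by (simp add: W_def distrib_left)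
    qed
    have t2: "B.pr (B.sg (W x y) * th z) = - B.pr (psi x * B.sg (th y) * th z) - B.pr (B.sg (th x) * B.sg (psi y) * th z)
      + B.pr (psi (x * A.sg y) * th z)"
    proof -
      have c: "diff B (B.sg (B.sg (psi x) * th y + th x * psi y)) = 0"
        by (rule B.d_sg_closed) (simp add: B.d_mult)
      have "B.pr (B.sg (B.pr (B.sg (psi x) * th y + th x * psi y)) * th z) = B.pr (B.sg (B.sg (psi x) * th y + th x * psi y) * th z)"
        unfolding B.sg_pr by (rule B.pr_mult_l[OF c]) simp
      also have "B.sg (B.sg (psi x) * th y + th x * psi y) * th z = - (psi x * B.sg (th y) * th z) - B.sg (th x) * B.sg (psi y) * th z"
        by (simp add: algebra_simps)
      finally have a: "B.pr (B.sg (B.pr (B.sg (psi x) * th y + th x * psi y)) * th z)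
        = B.pr (- (psi x * B.sg (th y) * th z) - B.sg (th x) * B.sg (psi y) * th z)" .
      have b: "B.sg (psi (A.sg x * y)) = psi (x * A.sg y)" using psi_sg[of "A.sg x * y"] by simp
      show ?thesis using xyz a b by (simp add: W_def distrib_right)
    qed
    have t3: "W (A.sg x * y) z = B.pr (psi (x * A.sg y) * th z) + B.pr (B.sg (th x) * th y * psi z) - psi (x * A.sg y * z)"
    proof -
      have "th (A.sg x * y) = B.pr (B.sg (th x) * th y)" by (simp add: th_mult' th_sg)
      moreover have "B.pr (B.pr (B.sg (th x) * th y) * psi z) = B.pr (B.sg (th x) * th y * psi z)"
        by (rule B.pr_mult_l) simp_all
      moreover have "B.sg (psi (A.sg x * y)) = psi (x * A.sg y)" using psi_sg[of "A.sg x * y"] by simp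
      ultimately show ?thesis using xyz psi_mult by (simp add: W_def)
    qed
    have t4: "W (A.sg x) (A.sg y * z) = - B.pr (psi x * (B.sg (th y) * th z)) + B.pr (B.sg (th x) * psi (A.sg y * z)) + psi (x * A.sg y * z)"
    proof -
      have "th (A.sg y * z) = B.pr (B.sg (th y) * th z)" by (simp add: th_mult' th_sg)
      moreover have "B.pr (psi x * B.pr (B.sg (th y) * th z)) = B.pr (psi x * (B.sg (th y) * th z))"
        by (rule B.pr_mult_r) simp_all
      ultimately show ?thesis using xyz psi_mult2 by (simp add: W_def psi_sg th_sg)
    qed
    show ?thesis using t1 t2 t3 t4 by (simp add: mult.assoc)
  qed
  let ?T = "\<lambda>x y. S x y + W x y"
  have "cobounds ?T" unfolding cobounds_def
  proof (intro conjI allI impI ballI)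
    fix x y z assume xyz: "x \<in> Hs" "y \<in> Hs" "z \<in> Hs"
    show "B.pr (B.sg (th x) * ?T y z + B.sg (?T x y) * th z) - ?T (A.sg x * y) z - ?T (A.sg x) (A.sg y * z)
      - B.pr (B.sg (th x) * B.hm (B.sg (th y) * th z) + B.sg (B.hm (B.sg (th x) * th y)) * th z)
      + th (A.sg (A.hm (A.sg x * y)) * z + A.sg x * A.hm (A.sg y * z)) = 0"
      using arg_cong2[of _ _ _ _ "(+)", OF cob3[OF S xyz] W3[OF xyz]]
      by (simp add: distrib_left distrib_right algebra_simps)
  next
    fix k l x y assume "x \<in> gr A k" "y \<in> gr A l"
    then show "?T x y \<in> gr B (k + l - 1)" by (intro B.gr_add cobgr[OF S] W_gr)
  next
    fix x
    show "Vector_Spaces.linear (scal A) (scal B) (?T x)"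
      by (rule lin_add_fun[OF coblin(1)[OF S] W_lin(1)])
    show "Vector_Spaces.linear (scal A) (scal B) (\<lambda>y. ?T y x)"
      by (rule lin_add_fun[OF coblin(2)[OF S] W_lin(2)])
  qed (simp_all add: W_def)
  then show ?thesis using W_J by (intro exI[of _ ?T]) simp
qed

end

section \<open>Isomorphisms in cohomology\<close>

context hodge
begin

lemma N3_cocycle:
  assumes "x \<in> Hs" "y \<in> Hs" "z \<in> Hs" "w \<in> Hs"
  shows "pr (N3 x y z * w) - pr (sg x * N3 y z w) - N3 (pr (x * y)) z w + N3 x (pr (y * z)) w - N3 x y (pr (z * w)) = 0"
proof -
  \<comment> \<open>The last two terms lie in \<open>Bs\<close> and do not change \<open>pr\<close>,
    but they make the expression closed, so that inside a product it may replace its harmonic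
    part.\<close>
  let ?n = "\<lambda>x y z. hm (x * y) * z + sg x * hm (y * z) + hm (pr (x * y) * z) - hm (x * pr (y * z))"
  have [simp]: "diff A x = 0" "diff A y = 0" "diff A z = 0" "diff A w = 0" using assms by (simp_all add: d_H)
  have cl: "diff A (?n x y z) = 0" if "x \<in> Hs" "y \<in> Hs" "z \<in> Hs" for x y z
  proof -
    have c: "diff A x = 0" "diff A y = 0" "diff A z = 0" using that by (simp_all add: d_H)
    have "pr (pr (x * y) * z) = pr (x * pr (y * z))"
      using c by (simp add: pr_mult_l pr_mult_r d_mult mult.assoc)
    then show ?thesis using c by (simp add: d_mult d_hm_closed d_sg algebra_simps del: sg_d)
  qed
  have N: "N3 x y z = pr (?n x y z)" for x y z by (simp add: N3_def)
  have 1: "pr (N3 x y z * w) = pr (?n x y z * w)"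
    unfolding N by (rule pr_mult_l[OF cl]) (use assms in simp_all)
  have 2: "pr (sg x * N3 y z w) = pr (sg x * ?n y z w)"
    unfolding N by (rule pr_mult_r[OF _ cl]) (use assms in \<open>simp_all add: d_sg del: sg_d\<close>)
  \<comment> \<open>The alternating sum is exact, with a primitive built from the two homotopies
    \<open>hm (x * y)\<close> and \<open>hm (z * w)\<close>; projecting it gives the cocycle
    identity.\<close>
  have e: "?n x y z * w - sg x * ?n y z w - (hm (pr (x * y) * z) * w + sg (pr (x * y)) * hm (z * w))
      + (hm (x * pr (y * z)) * w + sg x * hm (pr (y * z) * w)) - (hm (x * y) * pr (z * w) + sg x * hm (y * pr (z * w)))
    = diff A (- (sg (hm (x * y)) * hm (z * w)))"
    by (simp add: d_mult d_sg d_hm_closed sg_pr[symmetric] algebra_simps del: sg_d)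
  show ?thesis unfolding 1 2 using arg_cong[OF e, of pr] by (simp add: N3_def)
qed

lemma mu3_cocycle: "hoch_cocycle HA (mu3 A Hs Bs i)"
  unfolding hoch_cocycle_def
proof (intro conjI allI ballI)
  fix a b c e X Y Z W
  assume *: "X \<in> gpart HA a" "Y \<in> gpart HA b" "Z \<in> gpart HA c" "W \<in> gpart HA e"
  let ?m = "a + b + c + e - 1" and ?f = "mu3 A Hs Bs i"
  have 1: "gmult HA (?f X Y Z) W \<in> gpart HA ?m"
    using part_mult[OF mu3_part[OF *(1-3)] *(4)] by (simp add: algebra_simps)
  have 2: "gmult HA X (?f Y Z W) \<in> gpart HA ?m"
    using part_mult[OF *(1) mu3_part[OF *(2-4)]] by (simp add: algebra_simps)
  have 3: "?f (gmult HA X Y) Z W \<in> gpart HA ?m"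
    using mu3_part[OF part_mult[OF *(1,2)] *(3,4)] by simp
  have 4: "?f X (gmult HA Y Z) W \<in> gpart HA ?m"
    using mu3_part[OF *(1) part_mult[OF *(2,3)] *(4)] by (simp add: algebra_simps)
  have 5: "?f X Y (gmult HA Z W) \<in> gpart HA ?m"
    using mu3_part[OF *(1,2) part_mult[OF *(3,4)]] by (simp add: algebra_simps)
  have 6: "gadd HA (gmult HA (?f X Y Z) W) (gscale HA (ksgn a) (gmult HA X (?f Y Z W))) \<in> gpart HA ?m"
    by (intro part_add part_scale 1 2)
  have 7: "gsub HA (gadd HA (gmult HA (?f X Y Z) W) (gscale HA (ksgn a) (gmult HA X (?f Y Z W)))) (?f (gmult HA X Y) Z W) \<in> gpart HA ?m"
    by (intro part_sub 6 3)
  have 8: "gadd HA (gsub HA (gadd HA (gmult HA (?f X Y Z) W) (gscale HA (ksgn a) (gmult HA X (?f Y Z W)))) (?f (gmult HA X Y) Z W))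
     (?f X (gmult HA Y Z) W) \<in> gpart HA ?m"
    by (intro part_add 7 4)
  have s: "scal A (ksgn a) (pr (i X * u)) = - pr (sg (i X) * u)" for u
    using sg_hom[OF i_gr[OF *(1)]] by (simp add: scal_mult_left ksgn_diff)
  show "gsub HA (gadd HA (gsub HA (gadd HA (gmult HA (?f X Y Z) W) (gscale HA (ksgn a) (gmult HA X (?f Y Z W)))) (?f (gmult HA X Y) Z W))
     (?f X (gmult HA Y Z) W)) (?f X Y (gmult HA Z W)) = gzero HA"
  proof (rule i_inj[OF part_sub[OF 8 5] part_zero])
    show "i (gsub HA (gadd HA (gsub HA (gadd HA (gmult HA (?f X Y Z) W) (gscale HA (ksgn a) (gmult HA X (?f Y Z W)))) (?f (gmult HA X Y) Z W))
     (?f X (gmult HA Y Z) W)) (?f X Y (gmult HA Z W))) = i (gzero HA)"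
      unfolding i_sub[OF 8 5] i_add[OF 7 4] i_sub[OF 6 3] i_add[OF 1 part_scale[OF 2]] i_scale[OF 2]
        i_mult[OF mu3_part[OF *(1-3)] *(4)] i_mult[OF *(1) mu3_part[OF *(2-4)]]
        i_mu3[OF *(1-3)] i_mu3[OF *(2-4)] i_mu3[OF part_mult[OF *(1,2)] *(3,4)] i_mu3[OF *(1) part_mult[OF *(2,3)] *(4)]
        i_mu3[OF *(1,2) part_mult[OF *(3,4)]] i_mult[OF *(1,2)] i_mult[OF *(2,3)] i_mult[OF *(3,4)] i_zero s
      using N3_cocycle[OF i_H[OF *(1)] i_H[OF *(2)] i_H[OF *(3)] i_H[OF *(4)]] by simp
  qed
qed (rule mu3_trilinear)

lemma M3_N3: "pr (sg x * hm (sg y * z) + sg (hm (sg x * y)) * z) = N3 x (sg y) z"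
  using hm_sg[of "sg x * y"] by (simp add: N3_def add.commute)

text \<open>Graded commutativity exchanges the two summands of \<open>N3\<close> under reversal.
  This antisymmetry allows a cochain relating two ternary products to be symmetrized.\<close>

lemma N3_reverse:
  assumes x: "x \<in> gr A a" and y: "y \<in> gr A b" and z: "z \<in> gr A c"
  shows "N3 x y z = scal A (- ksgn (a * b + b * c + a * c)) (N3 z y x)"
proof -
  have 1: "hm (x * y) * z = scal A (ksgn (a * b) * ksgn ((a + b - 1) * c)) (z * hm (y * x))"
    using gcomm[OF x y] gcomm[OF hm_gr[OF mult_gr[OF y x]] z] by (simp add: scal_mult_left add.commute)
  have 2: "x * hm (y * z) = scal A (ksgn (b * c) * ksgn (a * (b + c - 1))) (hm (z * y) * x)"
    using gcomm[OF y z] gcomm[OF x hm_gr[OF mult_gr[OF z y]]] by (simp add: scal_mult_right add.commute)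
  show ?thesis unfolding N3_def sg_hom[OF x] sg_hom[OF z] scal_mult_left 1 2
    by (cases "even a"; cases "even b"; cases "even c") (simp_all add: ksgn_def)
qed

end

section \<open>Isomorphisms of cohomology algebras on harmonic representatives\<close>

locale coh_iso = hodge_pair A n I Hs Bs i r B I' Hs' Bs' i'
  for A :: "('f::field_char_0, 'a::ring_1) dg_alg" and n I Hs Bs i r
    and B :: "('f, 'b::ring_1) dg_alg" and I' Hs' Bs' i' +
  fixes phi :: "'a set \<Rightarrow> 'b set"
  assumes iso: "galg_iso A.HA B.HA phi"
begin

lemma phi_lin: "part_linear A.HA k B.HA k phi" and phi_bij: "bij_betw phi (gpart A.HA k) (gpart B.HA k)"
  and phi_mult: "X \<in> gpart A.HA k \<Longrightarrow> Y \<in> gpart A.HA l \<Longrightarrow> phi (gmult A.HA X Y) = gmult B.HA (phi X) (phi Y)"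
  and phi_one: "phi (gone A.HA) = gone B.HA"
  using iso unfolding galg_iso_def by blast+

lemma phi_part: "X \<in> gpart A.HA k \<Longrightarrow> phi X \<in> gpart B.HA k"
  and phi_add: "X \<in> gpart A.HA k \<Longrightarrow> Y \<in> gpart A.HA k \<Longrightarrow> phi (gadd A.HA X Y) = gadd B.HA (phi X) (phi Y)"
  and phi_scale: "X \<in> gpart A.HA k \<Longrightarrow> phi (gscale A.HA a X) = gscale B.HA a (phi X)"
  using phi_lin[of k] unfolding part_linear_def by blast+

definition Phi :: "'a set \<Rightarrow> 'b" where "Phi X = i' (phi X)"

lemma Phi_H: "X \<in> gpart A.HA k \<Longrightarrow> Phi X \<in> Hs'"
  and Phi_gr: "X \<in> gpart A.HA k \<Longrightarrow> Phi X \<in> gr B k"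
  unfolding Phi_def using phi_part B.i_H B.i_gr by metis+

lemma Phi_add: "X \<in> gpart A.HA k \<Longrightarrow> Y \<in> gpart A.HA k \<Longrightarrow> Phi (gadd A.HA X Y) = Phi X + Phi Y"
  by (simp add: Phi_def phi_add B.i_add[OF phi_part phi_part])

lemma Phi_scale: "X \<in> gpart A.HA k \<Longrightarrow> Phi (gscale A.HA a X) = scal B a (Phi X)"
  by (simp add: Phi_def phi_scale B.i_scale[OF phi_part])

lemma Phi_sub: "X \<in> gpart A.HA k \<Longrightarrow> Y \<in> gpart A.HA k \<Longrightarrow> Phi (gsub A.HA X Y) = Phi X - Phi Y"
  unfolding gsub_def by (subst Phi_add[OF _ A.part_scale]) (auto simp: Phi_scale)

lemma Phi_mult: "X \<in> gpart A.HA k \<Longrightarrow> Y \<in> gpart A.HA l \<Longrightarrow> Phi (gmult A.HA X Y) = B.pr (Phi X * Phi Y)"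
  by (simp add: Phi_def phi_mult B.i_mult[OF phi_part phi_part])

lemma Phi_inj: "X \<in> gpart A.HA k \<Longrightarrow> Y \<in> gpart A.HA k \<Longrightarrow> Phi X = Phi Y \<Longrightarrow> X = Y"
  unfolding Phi_def using B.i_inj[OF phi_part phi_part] phi_bij[of k]
  by (metis bij_betw_imp_inj_on inj_onD)

definition C :: "int \<Rightarrow> 'a \<Rightarrow> 'a set" where "C k x = cls A (A.pr (A.hc k x))"

lemma C_part [simp]: "C k x \<in> gpart A.HA k"
  unfolding C_def by (intro A.coh_partI' A.pr_gr) simp_all

lemma C_add: "C k (x + y) = gadd A.HA (C k x) (C k y)"
  and C_scale: "C k (scal A a x) = gscale A.HA a (C k x)"
  by (simp_all add: C_def A.coh_add A.coh_scale)

lemma lin_PhiC: "Vector_Spaces.linear (scal A) (scal B) (\<lambda>x. Phi (C k x))"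
  unfolding Vector_Spaces.linear_iff
  by (simp add: A.vs B.vs C_add C_scale Phi_add[OF C_part C_part] Phi_scale[OF C_part])

text \<open>The transport of \<open>phi\<close> to harmonic representatives is assembled component
  by component, because \<open>phi\<close> is only given on homogeneous classes.\<close>

definition th :: "'a \<Rightarrow> 'b" where "th x = (\<Sum>k\<in>{0..int n}. Phi (C k x))"

lemma lin_th: "Vector_Spaces.linear (scal A) (scal B) th"
  unfolding th_def[abs_def] by (rule lin_sum_fun[OF A.vs B.vs lin_PhiC])

text \<open>The degree k may lie outside the range 0 to n; then x = 0, and the last premise makes
  both sides vanish.\<close>

lemma sum_hom:
  fixes g :: "int \<Rightarrow> 'b"
  assumes "x \<in> gr A k" "\<And>j. j \<noteq> k \<Longrightarrow> g j = 0" "x = 0 \<Longrightarrow> g k = 0"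
  shows "(\<Sum>j\<in>{0..int n}. g j) = g k"
proof (cases "k \<in> {0..int n}")
  case True
  have "(\<Sum>j\<in>{0..int n}. g j) = (\<Sum>j\<in>{0..int n}. if j = k then g k else 0)"
    by (intro sum.cong) (auto simp: assms(2))
  then show ?thesis using True by simp
next
  case False
  then have "x = 0" using A.gr_out[of k] assms(1) by auto
  moreover have "(\<Sum>j\<in>{0..int n}. g j) = 0" using False by (intro sum.neutral) (auto simp: assms(2))
  ultimately show ?thesis using assms(3) by simp
qed

lemma C_hom: "x \<in> gr A k \<Longrightarrow> C j x = (if j = k then cls A (A.pr x) else cls A 0)"
  by (simp add: C_def A.hc_hom)

lemma Phi_zero: "Phi (cls A 0) = 0"
  using lin_0[OF lin_PhiC, of 0] by (simp add: C_def)

lemma th_hom: "x \<in> gr A k \<Longrightarrow> th x = Phi (cls A (A.pr x))"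
  unfolding th_def by (subst sum_hom[of x k]) (auto simp: C_hom Phi_zero)

lemma th_cls: "x \<in> Hs \<Longrightarrow> x \<in> gr A k \<Longrightarrow> th x = Phi (cls A x)"
  by (simp add: th_hom)

lemma th_i: "X \<in> gpart A.HA k \<Longrightarrow> th (i X) = Phi X"
  using th_cls[OF A.i_H A.i_gr] by (simp add: A.cls_i)

sublocale M: hodge_morphism A n I Hs Bs i r B I' Hs' Bs' i' th
proof
  show "th (x + y) = th x + th y" "th (scal A a x) = scal B a (th x)" for x y a
    by (rule lin_rules[OF lin_th])+
  show H: "th x \<in> Hs'" for x
    unfolding th_def by (rule B.V.subspace_sum[OF B.sH]) (rule Phi_H[OF C_part])
  show "th (A.pr x) = th x" for x
    by (simp add: th_def C_def A.pr_hc[symmetric])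
  show "th 1 = 1"
    using th_cls[OF A.one_H A.one_gr] phi_one by (simp add: Phi_def A.coh_one[symmetric] B.i_one)
  show gr: "th x \<in> gr B k" if "x \<in> gr A k" for x k
    unfolding th_hom[OF that] by (rule Phi_gr) (use that A.pr_gr in \<open>auto intro: A.coh_partI'\<close>)
  have hc: "B.hc k (th x) = th (A.hc k x)" for k x
    by (rule A.lin_ext_hom[OF lin_comp[OF lin_th B.lin_hc] lin_comp[OF A.lin_hc lin_th]])
       (auto simp: A.hc_hom B.hc_hom[OF gr] lin_0[OF lin_th])
  show "bij_betw th Hs Hs'"
    unfolding bij_betw_def
  proof
    show "inj_on th Hs"
    proof (rule inj_onI)
      fix x y assume xy: "x \<in> Hs" "y \<in> Hs" "th x = th y"
      have "A.hc k x = A.hc k y" for k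
      proof -
        have "Phi (cls A (A.hc k x)) = Phi (cls A (A.hc k y))"
          using xy hc[of k x] hc[of k y] th_cls[of "A.hc k x" k] th_cls[of "A.hc k y" k] by simp
        then have "cls A (A.hc k x) = cls A (A.hc k y)"
          using xy by (intro Phi_inj[of _ k] A.coh_partI') simp_all
        moreover have "i (cls A (A.hc k x)) = A.hc k x" "i (cls A (A.hc k y)) = A.hc k y"
          by (rule A.i_cls[of _ k]; use xy in simp)+
        ultimately show ?thesis by metis
      qed
      then show "x = y" by (rule A.hc_eqI)
    qed
    show "th ` Hs = Hs'"
    proof
      show "th ` Hs \<subseteq> Hs'" using H by auto
      show "Hs' \<subseteq> th ` Hs"
      proof
        fix w assume w: "w \<in> Hs'"
        have "\<exists>x\<in>Hs. th x = B.hc k w" for k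
        proof -
          have "cls B (B.hc k w) \<in> gpart B.HA k" using w by (intro B.coh_partI') simp_all
          then have "cls B (B.hc k w) \<in> phi ` gpart A.HA k"
            using bij_betw_imp_surj_on[OF phi_bij] by simp
          then obtain X where X: "X \<in> gpart A.HA k" "phi X = cls B (B.hc k w)" by auto
          then have "th (i X) = B.hc k w"
            using th_i[OF X(1)] B.i_cls[of "B.hc k w" k] w by (simp add: Phi_def)
          then show ?thesis using A.i_H[OF X(1)] by blast
        qed
        then obtain u where u: "\<And>k. u k \<in> Hs" "\<And>k. th (u k) = B.hc k w" by metis
        have "th (\<Sum>k\<in>{0..int n}. u k) = w"
          by (simp add: lin_sum[OF lin_th] u B.hc_sum_n)
        moreover have "(\<Sum>k\<in>{0..int n}. u k) \<in> Hs" using u by (intro A.V.subspace_sum[OF A.sH])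
        ultimately show "w \<in> th ` Hs" by blast
      qed
    qed
  qed
  \<comment> \<open>The projections on the right make both sides bilinear on all of A, so the check
    reduces to homogeneous elements, where \<open>phi\<close> is multiplicative.\<close>
  have m: "B.pr (th x * th y) = th (A.pr x * A.pr y)" for x y
  proof (rule A.bilin_ext_hom[of "scal B" "\<lambda>x y. B.pr (th x * th y)" "\<lambda>x y. th (A.pr x * A.pr y)"])
    show "Vector_Spaces.linear (scal A) (scal B) (\<lambda>x. B.pr (th x * th y))" for y
      by (rule lin_comp[OF lin_comp[OF lin_th B.lin_mult_left] B.lin_pr])
    show "Vector_Spaces.linear (scal A) (scal B) (\<lambda>y. B.pr (th x * th y))" for x
      by (rule lin_comp[OF lin_comp[OF lin_th B.lin_mult_right] B.lin_pr])
    show "Vector_Spaces.linear (scal A) (scal B) (\<lambda>x. th (A.pr x * A.pr y))" for y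
      by (rule lin_comp[OF lin_comp[OF A.lin_pr A.lin_mult_left] lin_th])
    show "Vector_Spaces.linear (scal A) (scal B) (\<lambda>y. th (A.pr x * A.pr y))" for x
      by (rule lin_comp[OF lin_comp[OF A.lin_pr A.lin_mult_right] lin_th])
    fix k l x y assume xy: "x \<in> gr A k" "y \<in> gr A l"
    let ?X = "cls A (A.pr x)" and ?Y = "cls A (A.pr y)"
    have XY: "?X \<in> gpart A.HA k" "?Y \<in> gpart A.HA l" using xy A.pr_gr by (auto intro: A.coh_partI')
    have "B.pr (th x * th y) = Phi (gmult A.HA ?X ?Y)" by (simp add: th_hom[OF xy(1)] th_hom[OF xy(2)] Phi_mult[OF XY])
    also have "\<dots> = th (i (gmult A.HA ?X ?Y))" using th_i[OF A.part_mult[OF XY]] by simp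
    also have "i (gmult A.HA ?X ?Y) = A.pr (A.pr x * A.pr y)"
      using A.i_mult[OF XY] A.i_cls[OF A.pr_H A.pr_gr[OF xy(1)]] A.i_cls[OF A.pr_H A.pr_gr[OF xy(2)]] by simp
    also have "th \<dots> = th (A.pr x * A.pr y)" by (simp add: th_def C_def A.pr_hc[symmetric])
    finally show "B.pr (th x * th y) = th (A.pr x * A.pr y)" .
  qed
  show "B.pr (th x * th y) = th (x * y)" if "x \<in> Hs" "y \<in> Hs" for x y
    using m[of x y] that by simp
qed

end

section \<open>Hochschild cochains relating the ternary products\<close>

lemma bilinear_degD:
  assumes "bilinear_deg H (- 1) xi" "X \<in> gpart H j" "Y \<in> gpart H k"
  shows "xi X Y \<in> gpart H (j + k - 1)"
    and "X' \<in> gpart H j \<Longrightarrow> xi (gadd H X X') Y = gadd H (xi X Y) (xi X' Y)"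
    and "Y' \<in> gpart H k \<Longrightarrow> xi X (gadd H Y Y') = gadd H (xi X Y) (xi X Y')"
    and "xi (gscale H a X) Y = gscale H a (xi X Y)" and "xi X (gscale H a Y) = gscale H a (xi X Y)"
proof -
  have 1: "part_linear H j H (j + k + - 1) (\<lambda>x. xi x Y)" and 2: "part_linear H k H (j + k + - 1) (\<lambda>y. xi X y)"
    using assms unfolding bilinear_deg_def by blast+
  show "xi X Y \<in> gpart H (j + k - 1)" using 1 assms(2) unfolding part_linear_def by simp
  show "X' \<in> gpart H j \<Longrightarrow> xi (gadd H X X') Y = gadd H (xi X Y) (xi X' Y)" "xi (gscale H a X) Y = gscale H a (xi X Y)"
    using 1 assms(2) unfolding part_linear_def by blast+
  show "Y' \<in> gpart H k \<Longrightarrow> xi X (gadd H Y Y') = gadd H (xi X Y) (xi X Y')" "xi X (gscale H a Y) = gscale H a (xi X Y)"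
    using 2 assms(3) unfolding part_linear_def by blast+
qed

context hodge
begin

lemma hoch_d_part:
  assumes "bilinear_deg HA (- 1) xi" "X \<in> gpart HA a" "Y \<in> gpart HA b" "Z \<in> gpart HA c"
  shows "hoch_d HA xi a X Y Z \<in> gpart HA (a + b + c - 1)"
    and "gmult HA (xi X Y) Z \<in> gpart HA (a + b + c - 1)" and "gmult HA X (xi Y Z) \<in> gpart HA (a + b + c - 1)"
    and "xi (gmult HA X Y) Z \<in> gpart HA (a + b + c - 1)" and "xi X (gmult HA Y Z) \<in> gpart HA (a + b + c - 1)"
proof -
  note D = bilinear_degD(1)[OF assms(1)]
  show 1: "gmult HA (xi X Y) Z \<in> gpart HA (a + b + c - 1)"
    using part_mult[OF D[OF assms(2,3)] assms(4)] by (simp add: algebra_simps)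
  show 2: "gmult HA X (xi Y Z) \<in> gpart HA (a + b + c - 1)"
    using part_mult[OF assms(2) D[OF assms(3,4)]] by (simp add: algebra_simps)
  show 3: "xi (gmult HA X Y) Z \<in> gpart HA (a + b + c - 1)"
    by (rule D[OF part_mult[OF assms(2,3)] assms(4)])
  show 4: "xi X (gmult HA Y Z) \<in> gpart HA (a + b + c - 1)"
    using D[OF assms(2) part_mult[OF assms(3,4)]] by (simp add: algebra_simps)
  show "hoch_d HA xi a X Y Z \<in> gpart HA (a + b + c - 1)"
    unfolding hoch_d_def by (intro part_sub part_add part_scale 1 2 3 4)
qed

end

context coh_iso
begin

text \<open>The cochain-level meaning of the equality of the two Hochschild classes under
  \<open>phi\<close>; it is the link between classes and morphisms.\<close>

definition related :: "('a set \<Rightarrow> 'a set \<Rightarrow> 'a set) \<Rightarrow> bool" where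
  "related xi \<longleftrightarrow> bilinear_deg A.HA (- 1) xi \<and>
    (\<forall>a b c. \<forall>X\<in>gpart A.HA a. \<forall>Y\<in>gpart A.HA b. \<forall>Z\<in>gpart A.HA c.
      mu3 B Hs' Bs' i' (phi X) (phi Y) (phi Z) = phi (gadd A.HA (mu3 A Hs Bs i X Y Z) (hoch_d A.HA xi a X Y Z)))"

lemma Phi_hoch_d:
  assumes "bilinear_deg A.HA (- 1) xi" "X \<in> gpart A.HA a" "Y \<in> gpart A.HA b" "Z \<in> gpart A.HA c"
  shows "Phi (hoch_d A.HA xi a X Y Z) = B.pr (Phi (xi X Y) * Phi Z) - scal B (ksgn a) (B.pr (Phi X * Phi (xi Y Z)))
    + Phi (xi (gmult A.HA X Y) Z) - Phi (xi X (gmult A.HA Y Z))"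
proof -
  note D = bilinear_degD(1)[OF assms(1)] and P = A.hoch_d_part[OF assms]
  show ?thesis unfolding hoch_d_def
    Phi_sub[OF A.part_add[OF A.part_sub[OF P(2) A.part_scale[OF P(3)]] P(4)] P(5)]
    Phi_add[OF A.part_sub[OF P(2) A.part_scale[OF P(3)]] P(4)] Phi_sub[OF P(2) A.part_scale[OF P(3)]]
    Phi_scale[OF P(3)] Phi_mult[OF D[OF assms(2,3)] assms(4)] Phi_mult[OF assms(2) D[OF assms(3,4)]] ..
qed

lemma related_iff:
  assumes xi: "bilinear_deg A.HA (- 1) xi"
  shows "related xi \<longleftrightarrow> (\<forall>a b c. \<forall>X\<in>gpart A.HA a. \<forall>Y\<in>gpart A.HA b. \<forall>Z\<in>gpart A.HA c.
     B.N3 (Phi X) (Phi Y) (Phi Z) = th (A.N3 (i X) (i Y) (i Z)) + Phi (hoch_d A.HA xi a X Y Z))"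
proof -
  have "mu3 B Hs' Bs' i' (phi X) (phi Y) (phi Z) = phi (gadd A.HA (mu3 A Hs Bs i X Y Z) (hoch_d A.HA xi a X Y Z))
    \<longleftrightarrow> B.N3 (Phi X) (Phi Y) (Phi Z) = th (A.N3 (i X) (i Y) (i Z)) + Phi (hoch_d A.HA xi a X Y Z)"
    if *: "X \<in> gpart A.HA a" "Y \<in> gpart A.HA b" "Z \<in> gpart A.HA c" for a b c X Y Z
  proof -
    note P = phi_part[OF *(1)] phi_part[OF *(2)] phi_part[OF *(3)]
    have s: "gadd A.HA (mu3 A Hs Bs i X Y Z) (hoch_d A.HA xi a X Y Z) \<in> gpart A.HA (a + b + c - 1)"
      by (rule A.part_add[OF A.mu3_part[OF *] A.hoch_d_part(1)[OF xi *]])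
    have "Phi (mu3 A Hs Bs i X Y Z) = th (A.N3 (i X) (i Y) (i Z))"
      using th_i[OF A.mu3_part[OF *]] A.i_mu3[OF *] by simp
    then have "i' (phi (gadd A.HA (mu3 A Hs Bs i X Y Z) (hoch_d A.HA xi a X Y Z)))
      = th (A.N3 (i X) (i Y) (i Z)) + Phi (hoch_d A.HA xi a X Y Z)"
      using Phi_add[OF A.mu3_part[OF *] A.hoch_d_part(1)[OF xi *]] by (simp add: Phi_def)
    moreover have "i' (mu3 B Hs' Bs' i' (phi X) (phi Y) (phi Z)) = B.N3 (Phi X) (Phi Y) (Phi Z)"
      using B.i_mu3[OF P] by (simp add: Phi_def)
    ultimately show ?thesis
      using B.i_inj[OF B.mu3_part[OF P] phi_part[OF s]] by metis
  qed
  then show ?thesis unfolding related_def using xi by (auto 0 3)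
qed

lemma cobounds_imp_related:
  assumes S: "M.cobounds S"
  shows "\<exists>xi. related xi"
proof -
  \<comment> \<open>The sign on the first argument undoes the shift, and \<open>M.thi\<close>
    carries the value back to harmonic elements of A.\<close>
  define xi where "xi X Y = cls A (M.thi (S (A.sg (i X)) (i Y)))" for X Y
  note SH [simp] = M.cobH[OF S] M.cobpr[OF S]
  have gr: "M.thi (S (A.sg (i X)) (i Y)) \<in> gr A (j + k - 1)" if "X \<in> gpart A.HA j" "Y \<in> gpart A.HA k" for X Y j k
  proof -
    let ?v = "M.thi (S (A.sg (i X)) (i Y))"
    have "th (A.hc (j + k - 1) ?v) = B.hc (j + k - 1) (S (A.sg (i X)) (i Y))"
      by (simp add: M.th_hc[symmetric] M.th_thi)
    also have "\<dots> = th ?v"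
      using B.hc_hom[OF M.cobgr[OF S A.sg_gr[OF A.i_gr[OF that(1)]] A.i_gr[OF that(2)]]] by (simp add: M.th_thi)
    finally have "A.hc (j + k - 1) ?v = ?v" by (intro M.th_inj) simp_all
    then show ?thesis by (metis A.hc_gr)
  qed
  have part: "xi X Y \<in> gpart A.HA (j + k - 1)" if "X \<in> gpart A.HA j" "Y \<in> gpart A.HA k" for X Y j k
    unfolding xi_def by (rule A.coh_partI'[OF M.thi_H gr[OF that]])
  have i_xi: "i (xi X Y) = M.thi (S (A.sg (i X)) (i Y))" if "X \<in> gpart A.HA j" "Y \<in> gpart A.HA k" for X Y j k
    unfolding xi_def by (rule A.i_cls[OF M.thi_H gr[OF that]])
  have Phi_xi: "Phi (xi X Y) = S (A.sg (i X)) (i Y)" if "X \<in> gpart A.HA j" "Y \<in> gpart A.HA k" for X Y j k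
    using th_i[OF part[OF that]] i_xi[OF that] by (simp add: M.th_thi)
  have xi: "bilinear_deg A.HA (- 1) xi"
    unfolding bilinear_deg_def
  proof (intro allI ballI conjI)
    fix j k X Y assume *: "X \<in> gpart A.HA j" "Y \<in> gpart A.HA k"
    have e: "j + k + - 1 = j + k - 1" by simp
    show "part_linear A.HA j A.HA (j + k + - 1) (\<lambda>x. xi x Y)"
      unfolding e
      by (rule A.part_linearI[where G = "\<lambda>u. M.thi (S (A.sg u) (i Y))"])
         (use * in \<open>simp_all add: part i_xi lin_rules[OF M.coblin(2)[OF S]] lin_rules[OF M.lin_thi]\<close>)
    show "part_linear A.HA k A.HA (j + k + - 1) (\<lambda>y. xi X y)"
      unfolding e
      by (rule A.part_linearI[where G = "\<lambda>u. M.thi (S (A.sg (i X)) u)"])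
         (use * in \<open>simp_all add: part i_xi lin_rules[OF M.coblin(1)[OF S]] lin_rules[OF M.lin_thi]\<close>)
  qed
  \<comment> \<open>S has shifted degree 0, so \<open>sg\<close> may be moved between its arguments
    and its value.\<close>
  have S_sg: "B.sg (S x (A.sg y)) = S (A.sg x) y" for x y
  proof -
    have "S (A.sg x) (A.sg (A.sg y)) = B.sg (S x (A.sg y))"
      by (rule A.bilin_ext_hom[of "scal B" "\<lambda>x y. S (A.sg x) (A.sg y)" "\<lambda>x y. B.sg (S x y)"])
         (auto intro: lin_comp[OF _ B.lin_sg] M.coblin[OF S] lin_comp[OF A.lin_sg M.coblin(1)[OF S]] lin_comp[OF A.lin_sg M.coblin(2)[OF S]]
           simp: A.sg_hom B.sg_hom[OF M.cobgr[OF S]] ksgn_def lin_rules[OF M.coblin(1)[OF S]] lin_rules[OF M.coblin(2)[OF S]])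
    then show ?thesis by simp
  qed
  have "B.N3 (Phi X) (Phi Y) (Phi Z) = th (A.N3 (i X) (i Y) (i Z)) + Phi (hoch_d A.HA xi a X Y Z)"
    if *: "X \<in> gpart A.HA a" "Y \<in> gpart A.HA b" "Z \<in> gpart A.HA c" for a b c X Y Z
  proof -
    note H = A.i_H[OF *(1)] A.i_H[OF *(2)] A.i_H[OF *(3)]
    have T: "Phi X = th (i X)" "Phi Y = th (i Y)" "Phi Z = th (i Z)" using th_i * by auto
    have s: "scal B (ksgn a) (B.pr (th (i X) * u)) = - B.pr (B.sg (th (i X)) * u)" for u
      using B.sg_hom[OF M.th_gr[OF A.i_gr[OF *(1)]]] by (simp add: B.scal_mult_left ksgn_diff)
    have p1: "S (A.sg (A.pr (i X * i Y))) (i Z) = - S (A.sg (i X) * A.sg (i Y)) (i Z)"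
      by (simp add: A.sg_pr lin_rules[OF M.coblin(2)[OF S]])
    \<comment> \<open>The cobounding equation is taken with \<open>sg\<close> on the middle
      argument: by \<open>M3_N3\<close> the homotopy terms carry that sign themselves, so the two
      cancel.\<close>
    have "B.pr (B.sg (th (i X)) * S (A.sg (i Y)) (i Z) + S (A.sg (i X)) (i Y) * th (i Z))
        - S (A.sg (i X) * A.sg (i Y)) (i Z) - S (A.sg (i X)) (i Y * i Z)
      - B.N3 (th (i X)) (th (i Y)) (th (i Z)) + th (A.N3 (i X) (i Y) (i Z)) = 0"
      using M.cob3[OF S, of "i X" "A.sg (i Y)" "i Z"] H
        B.M3_N3[of "th (i X)" "th (A.sg (i Y))" "th (i Z)"] A.M3_N3[of "i X" "A.sg (i Y)" "i Z"]
        M.th_pr[of "A.sg (A.hm (A.sg (i X) * A.sg (i Y))) * i Z + A.sg (i X) * A.hm (A.sg (A.sg (i Y)) * i Z)"]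
      by (simp add: S_sg M.th_sg add.commute)
    then show ?thesis
      unfolding Phi_hoch_d[OF xi *] Phi_xi[OF *(1,2)] Phi_xi[OF *(2,3)] Phi_xi[OF A.part_mult[OF *(1,2)] *(3)]
        Phi_xi[OF *(1) A.part_mult[OF *(2,3)]] A.i_mult[OF *(1,2)] A.i_mult[OF *(2,3)] T s p1
      by (simp add: algebra_simps)
  qed
  then have "related xi" using related_iff[OF xi] by blast
  then show ?thesis by blast
qed

end

context coh_iso
begin

text \<open>Symmetry is obtained by averaging. Reversing the arguments multiplies both ternary
  products by the same sign, so the relations at (x, y, z) and (z, y, x) bound the same difference;
  hence so does the half sum of the cochain and its graded transpose.\<close>

lemma related_imp_cobounds:
  assumes rel: "related xi"
  shows "\<exists>S. M.cobounds S \<and> (\<forall>k l x y. x \<in> gr A k \<longrightarrow> y \<in> gr A l \<longrightarrow>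
    S y x = scal B (- ksgn ((k - 1) * (l - 1))) (S x y))"
proof -
  have xi: "bilinear_deg A.HA (- 1) xi" using rel by (simp add: related_def)
  note D = bilinear_degD[OF xi]
  define E where "E k l x y = Phi (xi (C k x) (C l y))" for k l x y
  have E1: "Vector_Spaces.linear (scal A) (scal B) (E k l x)" for k l x
    unfolding Vector_Spaces.linear_iff E_def
    by (auto simp: A.vs B.vs C_add C_scale D(3,5)[OF C_part C_part] Phi_add[OF D(1)[OF C_part C_part] D(1)[OF C_part C_part]]
        Phi_scale[OF D(1)[OF C_part C_part]])
  have E2: "Vector_Spaces.linear (scal A) (scal B) (\<lambda>x. E k l x y)" for k l y
    unfolding Vector_Spaces.linear_iff E_def
    by (auto simp: A.vs B.vs C_add C_scale D(2,4)[OF C_part C_part] Phi_add[OF D(1)[OF C_part C_part] D(1)[OF C_part C_part]]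
        Phi_scale[OF D(1)[OF C_part C_part]])
  have E_H: "E k l x y \<in> Hs'" and E_gr: "E k l x y \<in> gr B (k + l - 1)" for k l x y
    unfolding E_def by (rule Phi_H[OF D(1)[OF C_part C_part]] Phi_gr[OF D(1)[OF C_part C_part]])+
  have E_pr: "E k l (A.pr x) y = E k l x y" "E k l x (A.pr y) = E k l x y" for k l x y
    by (simp_all add: E_def C_def A.pr_hc[symmetric])
  have E_0: "E k l 0 y = 0" "E k l x 0 = 0" for k l x y
    by (rule lin_0[OF E2] lin_0[OF E1])+
  have E_off: "E k l x y = 0" if "A.hc k x = 0 \<or> A.hc l y = 0" for k l x y
  proof -
    have "E k l x y = E k l (A.hc k x) (A.hc l y)" by (simp add: E_def C_def A.hc_hom[OF A.hc_gr])
    then show ?thesis using that E_0 by auto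
  qed
  \<comment> \<open>The factor \<open>ksgn (k - 1)\<close> is the shift of the first argument, and
    \<open>ksgn (k * l)\<close> the Koszul sign of the transposition.\<close>
  define s where "s k l x y = scal B (ksgn (k - 1) / 2) (E k l x y + scal B (ksgn (k * l)) (E l k y x))" for k l x y
  define S where "S x y = (\<Sum>k\<in>{0..int n}. \<Sum>l\<in>{0..int n}. s k l x y)" for x y
  have s_lin: "Vector_Spaces.linear (scal A) (scal B) (s k l x)" "Vector_Spaces.linear (scal A) (scal B) (\<lambda>x. s k l x y)" for k l x y
    unfolding s_def[abs_def] by (intro lin_scale_fun lin_add_fun E1 E2)+
  have S_lin: "Vector_Spaces.linear (scal A) (scal B) (S x)" "Vector_Spaces.linear (scal A) (scal B) (\<lambda>x. S x y)" for x y
    unfolding S_def[abs_def] by (intro lin_sum_fun A.vs B.vs s_lin)+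
  have S_hom: "S x y = s k l x y" if xy: "x \<in> gr A k" "y \<in> gr A l" for x y k l
  proof -
    have "(\<Sum>l'\<in>{0..int n}. s k l' x y) = s k l x y"
      by (rule sum_hom[OF xy(2)]) (use xy in \<open>auto simp: s_def E_off A.hc_hom E_0\<close>)
    moreover have "S x y = (\<Sum>l'\<in>{0..int n}. s k l' x y)" unfolding S_def
      by (rule sum_hom[OF xy(1)]) (use xy in \<open>auto simp: s_def E_off A.hc_hom E_0\<close>)
    ultimately show ?thesis by simp
  qed
  have S_H: "S x y \<in> Hs'" for x y
    unfolding S_def s_def by (intro B.V.subspace_sum[OF B.sH] B.V.subspace_scale[OF B.sH] B.V.subspace_add[OF B.sH] E_H)
  have S_pr: "S (A.pr x) y = S x y" "S x (A.pr y) = S x y" for x y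
    by (simp_all add: S_def s_def E_pr)
  have S_gr: "S x y \<in> gr B (k + l - 1)" if xy: "x \<in> gr A k" "y \<in> gr A l" for x y k l
    unfolding S_hom[OF xy] s_def using E_gr[of l k y x] by (intro B.gr_scale B.gr_add E_gr) (simp add: add.commute)
  have sym: "S y x = scal B (- ksgn ((k - 1) * (l - 1))) (S x y)" if xy: "x \<in> gr A k" "y \<in> gr A l" for x y k l
    unfolding S_hom[OF xy] S_hom[OF xy(2,1)] s_def
    by (cases "even k"; cases "even l") (simp_all add: ksgn_def algebra_simps)
  note [simp] = lin_rules[OF S_lin(1)] lin_rules[OF S_lin(2)]
  let ?X = "\<lambda>x y z. B.pr (B.sg (th x) * S y z + B.sg (S x y) * th z) - S (A.sg x * y) z - S (A.sg x) (A.sg y * z)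
      - B.pr (B.sg (th x) * B.hm (B.sg (th y) * th z) + B.sg (B.hm (B.sg (th x) * th y)) * th z)
      + th (A.sg (A.hm (A.sg x * y)) * z + A.sg x * A.hm (A.sg y * z))"
  have hom: "?X x y z = 0" if H: "x \<in> Hs" "y \<in> Hs" "z \<in> Hs" and g: "x \<in> gr A a" "y \<in> gr A b" "z \<in> gr A c" for x y z a b c
  proof -
    have closed: "diff A x = 0" "diff A y = 0" "diff A z = 0" using H by (simp_all add: A.d_H)
    let ?K = "cls A x" and ?L = "cls A y" and ?N = "cls A z"
    have P: "?K \<in> gpart A.HA a" "?L \<in> gpart A.HA b" "?N \<in> gpart A.HA c"
      using H g by (auto intro: A.coh_partI')
    have i: "i ?K = x" "i ?L = y" "i ?N = z" using H g by (auto intro!: A.i_cls)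
    have T: "Phi ?K = th x" "Phi ?L = th y" "Phi ?N = th z" using th_cls H g by metis+
    have mult: "cls A (A.pr (u * v)) = gmult A.HA (cls A u) (cls A v)" if "diff A u = 0" "diff A v = 0" for u v
      using that by (simp add: A.coh_mult A.cls_pr A.d_mult)
    have Ee: "E k l u v = Phi (xi (cls A (A.pr u)) (cls A (A.pr v)))" if "u \<in> gr A k" "v \<in> gr A l" for u v k l
      using that by (simp add: E_def C_hom)
    have comm: "gmult A.HA (cls A v) (cls A u) = gscale A.HA (ksgn (k * l)) (gmult A.HA (cls A u) (cls A v))"
      if "u \<in> gr A k" "v \<in> gr A l" "diff A u = 0" "diff A v = 0" for u v k l
      using A.gcomm[OF that(2,1)] that by (simp add: A.coh_mult A.coh_scale mult.commute)
    define u1 where "u1 = B.pr (Phi (xi ?K ?L) * th z)"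
    define u2 where "u2 = B.pr (th x * Phi (xi ?L ?N))"
    define u3 where "u3 = Phi (xi (gmult A.HA ?K ?L) ?N)"
    define u4 where "u4 = Phi (xi ?K (gmult A.HA ?L ?N))"
    define v1 where "v1 = B.pr (th x * Phi (xi ?N ?L))"
    define v2 where "v2 = B.pr (Phi (xi ?L ?K) * th z)"
    define v3 where "v3 = Phi (xi ?N (gmult A.HA ?K ?L))"
    define v4 where "v4 = Phi (xi (gmult A.HA ?L ?N) ?K)"
    define NA where "NA = th (A.N3 x y z)"
    define NB where "NB = B.N3 (th x) (th y) (th z)"
    define NA' where "NA' = th (A.N3 z y x)"
    define NB' where "NB' = B.N3 (th z) (th y) (th x)"
    have r: "\<forall>a b c. \<forall>X\<in>gpart A.HA a. \<forall>Y\<in>gpart A.HA b. \<forall>Z\<in>gpart A.HA c.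
     B.N3 (Phi X) (Phi Y) (Phi Z) = th (A.N3 (i X) (i Y) (i Z)) + Phi (hoch_d A.HA xi a X Y Z)"
      using rel related_iff[OF xi] by blast
    \<comment> \<open>\<open>R1\<close> and \<open>R2\<close> are the relation read forwards and
      backwards; \<open>q1\<close> to \<open>q4\<close> bring the backward terms into the original
      order of factors.\<close>
    have R1: "NB = NA + (u1 - scal B (ksgn a) u2 + u3 - u4)"
      using r[rule_format, OF P] unfolding Phi_hoch_d[OF xi P] i T NA_def NB_def u1_def u2_def u3_def u4_def .
    have q1: "B.pr (Phi (xi ?N ?L) * th x) = scal B (ksgn ((c + b - 1) * a)) v1"
      unfolding v1_def using B.gcomm[OF Phi_gr[OF D(1)[OF P(3,2)]] M.th_gr[OF g(1)]] by simp
    have q2: "B.pr (th z * Phi (xi ?L ?K)) = scal B (ksgn (c * (b + a - 1))) v2"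
      unfolding v2_def using B.gcomm[OF M.th_gr[OF g(3)] Phi_gr[OF D(1)[OF P(2,1)]]] by simp
    have q3: "Phi (xi (gmult A.HA ?N ?L) ?K) = scal B (ksgn (b * c)) v4"
      unfolding v4_def comm[OF g(2,3) closed(2,3)]
      by (simp add: D(4)[OF A.part_mult[OF P(2,3)] P(1)] Phi_scale[OF D(1)[OF A.part_mult[OF P(2,3)] P(1)]])
    have q4: "Phi (xi ?N (gmult A.HA ?L ?K)) = scal B (ksgn (a * b)) v3"
      unfolding v3_def comm[OF g(1,2) closed(1,2)]
      by (simp add: D(5)[OF P(3) A.part_mult[OF P(1,2)]] Phi_scale[OF D(1)[OF P(3) A.part_mult[OF P(1,2)]]])
    have R2: "NB' = NA' + (scal B (ksgn ((c + b - 1) * a)) v1 - scal B (ksgn c) (scal B (ksgn (c * (b + a - 1))) v2)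
       + scal B (ksgn (b * c)) v4 - scal B (ksgn (a * b)) v3)"
      using r[rule_format, OF P(3,2,1)] unfolding Phi_hoch_d[OF xi P(3,2,1)] i T NA'_def NB'_def q1 q2 q3 q4 .
    have R3: "NA = scal B (- ksgn (a * b + b * c + a * c)) NA'"
      unfolding NA_def NA'_def by (subst A.N3_reverse[OF g]) (simp del: A.V.scale_minus_left)
    have R4: "NB = scal B (- ksgn (a * b + b * c + a * c)) NB'"
      unfolding NB_def NB'_def by (rule B.N3_reverse[OF M.th_gr[OF g(1)] M.th_gr[OF g(2)] M.th_gr[OF g(3)]])
    have t1: "B.pr (B.sg (th x) * S y z) = scal B (ksgn (a - 1) * (ksgn (b - 1) / 2)) (u2 + scal B (ksgn (b * c)) v1)"
      unfolding S_hom[OF g(2,3)] s_def Ee[OF g(2,3)] Ee[OF g(3,2)] B.sg_hom[OF M.th_gr[OF g(1)]] u2_def v1_def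
      using H by (simp add: B.scal_mult_left B.scal_mult_right distrib_left B.V.scale_right_distrib mult_ac)
    have t2: "B.pr (B.sg (S x y) * th z) = scal B (ksgn (a + b - 1 - 1) * (ksgn (a - 1) / 2)) (u1 + scal B (ksgn (a * b)) v2)"
      unfolding B.sg_hom[OF S_gr[OF g(1,2)]]
      unfolding S_hom[OF g(1,2)] s_def Ee[OF g(1,2)] Ee[OF g(2,1)] u1_def v2_def
      using H by (simp add: B.scal_mult_left B.scal_mult_right distrib_right B.V.scale_right_distrib mult_ac)
    have t3: "S (A.sg x * y) z = scal B (ksgn (a - 1) * (ksgn (a + b - 1) / 2)) (u3 + scal B (ksgn ((a + b) * c)) v3)"
      using H closed unfolding A.sg_hom[OF g(1)] A.scal_mult_left
      by (simp add: S_hom[OF A.mult_gr[OF g(1,2)] g(3)] s_def Ee[OF A.mult_gr[OF g(1,2)] g(3)] Ee[OF g(3) A.mult_gr[OF g(1,2)]]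
          mult u3_def v3_def)
    have t4: "S (A.sg x) (A.sg y * z) = scal B (ksgn (a - 1) * ksgn (b - 1) * (ksgn (a - 1) / 2)) (u4 + scal B (ksgn (a * (b + c))) v4)"
      using H closed unfolding A.sg_hom[OF g(1)] A.sg_hom[OF g(2)] A.scal_mult_left
      by (simp add: S_hom[OF g(1) A.mult_gr[OF g(2,3)]] s_def Ee[OF g(1) A.mult_gr[OF g(2,3)]] Ee[OF A.mult_gr[OF g(2,3)] g(1)]
          mult u4_def v4_def mult_ac)
    have t5: "B.pr (B.sg (th x) * B.hm (B.sg (th y) * th z) + B.sg (B.hm (B.sg (th x) * th y)) * th z) = scal B (ksgn (b - 1)) NB"
      unfolding B.M3_N3 unfolding B.sg_hom[OF M.th_gr[OF g(2)]] NB_def by (rule B.N3_lin)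
    have "th (A.sg (A.hm (A.sg x * y)) * z + A.sg x * A.hm (A.sg y * z)) = th (A.N3 x (A.sg y) z)"
      unfolding A.M3_N3[symmetric] by (simp only: M.th_pr add.commute)
    also have "\<dots> = scal B (ksgn (b - 1)) NA"
      unfolding A.sg_hom[OF g(2)] NA_def by (simp only: A.N3_lin M.th_simps)
    finally have t6: "th (A.sg (A.hm (A.sg x * y)) * z + A.sg x * A.hm (A.sg y * z)) = scal B (ksgn (b - 1)) NA" .
    let ?h = "u1 - scal B (ksgn a) u2 + u3 - u4"
    let ?h' = "scal B (ksgn ((c + b - 1) * a)) v1 - scal B (ksgn c) (scal B (ksgn (c * (b + a - 1))) v2)
       + scal B (ksgn (b * c)) v4 - scal B (ksgn (a * b)) v3"
    let ?s = "- ksgn (a * b + b * c + a * c) :: 'f"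
    have "NB = NA + scal B ?s ?h'"
      unfolding R4 R3 R2 by (rule B.V.scale_right_distrib)
    \<comment> \<open>Averaging the forward and the backward expression for the difference matches
      the half in the definition of \<open>s\<close>.\<close>
    then have half: "NB - NA = scal B (1 / 2) (?h + scal B ?s ?h')"
    proof -
      assume a: "NB = NA + scal B ?s ?h'"
      have b: "?h = NB - NA" using R1 by simp
      have c: "scal B ?s ?h' = NB - NA" using a by simp
      show ?thesis unfolding b c by (simp flip: B.V.scale_left_distrib add: B.V.scale_right_distrib)
    qed
    have "B.pr (B.sg (th x) * S y z) + B.pr (B.sg (S x y) * th z) - S (A.sg x * y) z - S (A.sg x) (A.sg y * z)
      = scal B (ksgn (b - 1)) (scal B (1 / 2) (?h + scal B ?s ?h'))"
      unfolding t1 t2 t3 t4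
      by (cases "even a"; cases "even b"; cases "even c") (simp_all add: ksgn_def algebra_simps)
    then have "B.pr (B.sg (th x) * S y z) + B.pr (B.sg (S x y) * th z) - S (A.sg x * y) z - S (A.sg x) (A.sg y * z)
      = scal B (ksgn (b - 1)) (NB - NA)"
      unfolding half .
    then show ?thesis unfolding t5 t6 by (simp add: B.V.scale_right_diff_distrib)
  qed
  have all: "?X (A.pr x) (A.pr y) (A.pr z) = 0" for x y z
  proof -
    have z: "Vector_Spaces.linear (scal A) (scal B) (\<lambda>x. 0)" by (rule lin_zero_fun[OF A.vs B.vs])
    have lin: "Vector_Spaces.linear (scal A) (scal B) (\<lambda>x. ?X (A.pr x) (A.pr y) (A.pr z))"
      "Vector_Spaces.linear (scal A) (scal B) (\<lambda>y. ?X (A.pr x) (A.pr y) (A.pr z))"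
      "Vector_Spaces.linear (scal A) (scal B) (\<lambda>z. ?X (A.pr x) (A.pr y) (A.pr z))" for x y z
      unfolding Vector_Spaces.linear_iff
      by (auto simp: A.vs B.vs algebra_simps A.scal_mult_left A.scal_mult_right B.scal_mult_left B.scal_mult_right
          B.V.scale_right_distrib B.V.scale_right_diff_distrib)
    have 1: "?X (A.pr x) (A.pr y) (A.pr z) = 0" if "x \<in> gr A a" "y \<in> gr A b" for x y z a b
      by (rule A.lin_ext_hom[OF lin(3) z]) (rule hom[OF A.pr_H A.pr_H A.pr_H A.pr_gr[OF that(1)] A.pr_gr[OF that(2)] A.pr_gr])
    have 2: "?X (A.pr x) (A.pr y) (A.pr z) = 0" if "x \<in> gr A a" for x y z a
      by (rule A.lin_ext_hom[OF lin(2) z]) (rule 1[OF that])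
    show ?thesis by (rule A.lin_ext_hom[OF lin(1) z]) (rule 2)
  qed
  have "M.cobounds S" unfolding M.cobounds_def
  proof (intro conjI allI impI ballI)
    fix x y z assume H: "x \<in> Hs" "y \<in> Hs" "z \<in> Hs"
    show "?X x y z = 0" using all[of x y z] unfolding A.pr_id[OF H(1)] A.pr_id[OF H(2)] A.pr_id[OF H(3)] .
  qed (simp_all add: S_H S_pr S_lin S_gr)
  then show ?thesis using sym by blast
qed

lemma related_imp_ainf:
  assumes "related xi"
  shows "ainf_quasi_isomorphic A B"
proof -
  obtain S where S: "M.cobounds S" "\<And>k l x y. x \<in> gr A k \<Longrightarrow> y \<in> gr A l \<Longrightarrow>
    S y x = scal B (- ksgn ((k - 1) * (l - 1))) (S x y)"
    using related_imp_cobounds[OF assms] by blast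
  obtain T where T: "M.cobounds T" "\<And>x y. B.J (T x y) = 0"
    using M.normalize_cobounding[OF S] by blast
  interpret N: normalized_cobounding A n I Hs Bs i r B I' Hs' Bs' i' th T
    by unfold_locales (use T in auto)
  obtain f where f: "ainf_morphism A (ainf_mult A) B (ainf_mult B) f" "\<And>x. f [x] = th x"
    using N.ex_ainf by blast
  \<comment> \<open>The morphism induces \<open>phi\<close> itself, because its first component is
    \<open>th\<close>, which kills exact elements.\<close>
  have phi: "(\<Union>x\<in>X. cls B (f [x])) = phi X" if X: "X \<in> gpart A.HA k" for k X
  proof -
    obtain x where x: "X = cls A x" "x \<in> Hs" "x \<in> gr A k" using A.coh_partE'[OF X] by metis
    have "th (diff A y) = 0" for y using M.th_pr[of "diff A y"] by simp
    then have "cls B (f [x + diff A y]) = cls B (th x)" for y by (simp add: f(2))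
    then have "(\<Union>x\<in>X. cls B (f [x])) = cls B (th x)" unfolding x(1) by (rule A.UN_cls_const)
    also have "th x = Phi X" using th_cls x by simp
    also have "cls B (Phi X) = phi X" unfolding Phi_def by (rule B.cls_i[OF phi_part[OF X]])
    finally show ?thesis .
  qed
  have "bij_betw (\<lambda>X. \<Union>x\<in>X. cls B (f [x])) (gpart A.HA k) (gpart B.HA k)" for k
    using bij_betw_cong[of "gpart A.HA k" "\<lambda>X. \<Union>x\<in>X. cls B (f [x])" phi] phi phi_bij by blast
  then have "ainf_quasi_iso A B f" using f(1) by (simp add: ainf_quasi_iso_def)
  then show ?thesis unfolding ainf_quasi_isomorphic_def by blast
qed

end

section \<open>Cochains from A-infinity morphisms\<close>

context cdga_pair
begin

lemma mlin_Eop: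
  assumes "mlin (scal A) (scal B) g"
  shows "mlin (scal A) (scal B) (Eop g)"
  unfolding Eop_def[abs_def]
  by (intro mlin_add mlin_diff mlin_Qop A.mlin_DD1 mlin_comp[OF _ B.lin_d] assms)

end

locale ainf_map = hodge_pair A n I Hs Bs i r B I' Hs' Bs' i'
  for A :: "('f::field_char_0, 'a::ring_1) dg_alg" and n I Hs Bs i r
    and B :: "('f, 'b::ring_1) dg_alg" and I' Hs' Bs' i' +
  fixes g :: "'a list \<Rightarrow> 'b"
  assumes mlin_g: "mlin (scal A) (scal B) g" and g_Nil [simp]: "g [] = 0" and g_deg: "sdeg g"
    and E_hom: "list_all2 (\<lambda>k x. x \<in> gr A k) ks xs \<Longrightarrow> xs \<noteq> [] \<Longrightarrow> Eop g xs = 0"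
    and g_bij: "bij_betw (\<lambda>X. \<Union>x\<in>X. cls B (g [x])) (gpart A.HA k) (gpart B.HA k)"
begin

lemma E0: "Eop g xs = 0"
proof (cases "xs = []")
  case True
  then show ?thesis by (simp add: Eop_def Qop_def)
next
  case False
  show ?thesis
  proof (rule A.mlin_ext_hom[OF mlin_Eop[OF mlin_g] mlin_zero[OF A.vs B.vs]])
    fix ks and ys :: "'a list" assume *: "list_all2 (\<lambda>k x. x \<in> gr A k) ks ys" "length ys = length xs"
    then have "ys \<noteq> []" using False by auto
    with *(1) show "Eop g ys = 0" by (rule E_hom)
  qed
qed

lemma g1_lin: "Vector_Spaces.linear (scal A) (scal B) (\<lambda>x. g [x])"
  by (rule mlin_hd[OF mlin_g])

lemma g2_lin: "Vector_Spaces.linear (scal A) (scal B) (\<lambda>x. g [x, y])" "Vector_Spaces.linear (scal A) (scal B) (\<lambda>y. g [x, y])"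
  using mlin_hd[OF mlin_g, of "[y]"] mlin_at[OF mlin_g, of "[x]" "[]"] by simp_all

lemmas g1_simps [simp] = lin_rules[OF g1_lin]
lemmas g2_simps [simp] = lin_rules[OF g2_lin(1)] lin_rules[OF g2_lin(2)]

lemma g1_gr: "x \<in> gr A k \<Longrightarrow> g [x] \<in> gr B k"
  using sdegD[OF g_deg, of "[k]" "[x]"] by simp

lemma g2_gr: "x \<in> gr A k \<Longrightarrow> y \<in> gr A l \<Longrightarrow> g [x, y] \<in> gr B (k + l - 1)"
  using sdegD[OF g_deg, of "[k, l]" "[x, y]"] by (simp add: algebra_simps)

lemma g1_sg: "g [A.sg x] = B.sg (g [x])"
  using sg_deg2[OF g1_lin, of 0 x] by (simp add: g1_gr)

lemma d_g1: "diff B (g [x]) = g [diff A x]"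
  using E0[of "[x]"] by (simp add: Eop_def Qop_def)

lemma d_g2: "diff B (g [x, y]) = g [diff A x, y] + g [A.sg x, diff A y] + g [A.sg x * y] - B.sg (g [x]) * g [y]"
  using E0[of "[x, y]"] by (simp add: Eop_def Qop_def algebra_simps)

lemma d_g3:
  assumes "x \<in> Hs" "y \<in> Hs" "z \<in> Hs"
  shows "diff B (g [x, y, z]) = g [A.sg x * y, z] + g [A.sg x, A.sg y * z] - B.sg (g [x]) * g [y, z] - B.sg (g [x, y]) * g [z]"
  using E0[of "[x, y, z]"] mlin_zero_entry[OF mlin_g] assms
  by (simp add: Eop_def Qop_def A.d_H algebra_simps)

definition phi :: "'a set \<Rightarrow> 'b set" where "phi X = (\<Union>x\<in>X. cls B (g [x]))"

lemma phi_cls: "phi (cls A x) = cls B (g [x])"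
  unfolding phi_def
proof (rule A.UN_cls_const)
  fix y
  show "cls B (g [x + diff A y]) = cls B (g [x])"
    using B.cls_shift[of "g [x]" "g [y]"] by (simp add: d_g1)
qed

lemma g1_mult: "diff A x = 0 \<Longrightarrow> diff A y = 0 \<Longrightarrow> g [x * y] = g [x] * g [y] + diff B (g [A.sg x, y])"
  using d_g2[of "A.sg x" y] by (simp add: A.d_sg g1_sg del: A.sg_d)

lemma phi_iso: "galg_iso A.HA B.HA phi"
  unfolding galg_iso_def
proof (intro conjI allI ballI)
  fix k
  show bij: "bij_betw phi (gpart A.HA k) (gpart B.HA k)"
    using g_bij[of k] unfolding phi_def[abs_def] .
  show "part_linear A.HA k B.HA k phi"
    unfolding part_linear_def
    by (auto elim!: A.coh_partE simp: A.coh_add A.coh_scale phi_cls B.coh_add B.coh_scale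
        intro!: B.coh_partI g1_gr simp: d_g1)
next
  fix j k X Y assume XY: "X \<in> gpart A.HA j" "Y \<in> gpart A.HA k"
  obtain x where x: "X = cls A x" "diff A x = 0" using XY(1) by (rule A.coh_partE)
  obtain y where y: "Y = cls A y" "diff A y = 0" using XY(2) by (rule A.coh_partE)
  have "cls B (g [x * y]) = cls B (g [x] * g [y])"
    by (simp only: g1_mult[OF x(2) y(2)] B.cls_shift)
  then show "phi (gmult A.HA X Y) = gmult B.HA (phi X) (phi Y)"
    using x y by (simp add: A.coh_mult phi_cls B.coh_mult d_g1)
next
  \<comment> \<open>The first component need not send 1 to 1. By surjectivity some class X maps to
    the unit, and multiplicativity gives phi(1) = phi(1) phi(X) = phi(X) = 1.\<close>
  have "gone B.HA \<in> phi ` gpart A.HA 0"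
    using bij_betw_imp_surj_on[OF g_bij[of 0]] B.part_one unfolding phi_def[abs_def] by simp
  then obtain X where X: "X \<in> gpart A.HA 0" "gone B.HA = phi X" by blast
  obtain x where x: "X = cls A x" "diff A x = 0" using X(1) by (rule A.coh_partE)
  have "cls B (g [x]) = cls B 1" using X(2) x by (simp add: phi_cls B.coh_one)
  then have 1: "gmult B.HA (cls B (g [1])) (cls B (g [x])) = cls B (g [1])"
    by (simp add: B.coh_mult d_g1)
  have "gmult B.HA (cls B (g [1])) (cls B (g [x])) = cls B (g [1] * g [x])"
    using x by (simp add: B.coh_mult d_g1)
  also have "\<dots> = cls B (g [1 * x])" by (simp only: g1_mult[OF A.d_one x(2)] B.cls_shift)
  also have "\<dots> = cls B 1" using \<open>cls B (g [x]) = cls B 1\<close> by simp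
  finally show "phi (gone A.HA) = gone B.HA" using 1 by (simp add: A.coh_one B.coh_one phi_cls)
qed

sublocale Q: coh_iso A n I Hs Bs i r B I' Hs' Bs' i' phi
  by unfold_locales (rule phi_iso)

lemma th_g1: "x \<in> Hs \<Longrightarrow> Q.th x = B.pr (g [x])"
proof -
  have "Q.th x = B.pr (g [A.pr x])" for x
  proof (rule A.lin_ext_hom[OF Q.lin_th])
    show "Vector_Spaces.linear (scal A) (scal B) (\<lambda>x. B.pr (g [A.pr x]))"
      by (rule lin_comp[OF lin_comp[OF A.lin_pr g1_lin] B.lin_pr])
    fix k x assume x: "x \<in> gr A k"
    show "Q.th x = B.pr (g [A.pr x])"
      unfolding Q.th_hom[OF x] Q.Phi_def phi_cls
      by (rule B.i_cls_closed) (auto intro!: g1_gr A.pr_gr x simp: d_g1)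
  qed
  then show "x \<in> Hs \<Longrightarrow> Q.th x = B.pr (g [x])" by simp
qed

text \<open>On harmonic elements this is a primitive of the difference between the first component
  of the morphism and \<open>Q.th\<close>.\<close>

definition eta :: "'a \<Rightarrow> 'b" where "eta x = B.hm (g [x])"

lemma eta_lin: "Vector_Spaces.linear (scal A) (scal B) eta"
  unfolding eta_def[abs_def] by (rule lin_comp[OF g1_lin B.lin_hm])

lemmas eta_simps [simp] = lin_rules[OF eta_lin]

lemma d_eta: "x \<in> Hs \<Longrightarrow> diff B (eta x) = g [x] - Q.th x"
  by (simp add: eta_def B.d_hm_closed d_g1 A.d_H th_g1)

lemma eta_sg: "eta (A.sg x) = - B.sg (eta x)"
  by (simp add: eta_def g1_sg B.hm_sg)

lemma eta_gr: "x \<in> gr A k \<Longrightarrow> eta x \<in> gr B (k - 1)"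
  unfolding eta_def by (rule B.hm_gr[OF g1_gr])

text \<open>Two primitives of \<open>f\<^sub>1(xy) - f\<^sub>1(x) f\<^sub>1(y)\<close> (up to signs), one coming from the given morphism, the
  other from the homotopy on the target. Their difference is the cochain that relates the ternary products.\<close>

definition Y :: "'a \<Rightarrow> 'a \<Rightarrow> 'b" where
  "Y x y = g [x, y] - g [A.hm (A.sg x * y)]"

definition R :: "'a \<Rightarrow> 'a \<Rightarrow> 'b" where
  "R x y = eta (A.pr (A.sg x * y)) + B.sg (eta x) * g [y] + Q.th x * eta y - B.hm (B.sg (Q.th x) * Q.th y)"

lemma th_mult_sg: "x \<in> Hs \<Longrightarrow> y \<in> Hs \<Longrightarrow> B.pr (B.sg (Q.th x) * Q.th y) = Q.th (A.pr (A.sg x * y))"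
  using Q.M.th_mult[of "A.sg x" y] by (simp add: Q.M.th_sg)

lemma closed [simp]: "diff B (Q.th x) = 0" "diff B (B.sg (Q.th x)) = 0" "diff B (B.sg (Q.th x) * Q.th y) = 0"
  by (simp_all add: B.d_sg B.d_mult del: B.sg_d)

lemma d_Y: assumes "x \<in> Hs" "y \<in> Hs" shows "diff B (Y x y) = g [A.pr (A.sg x * y)] - B.sg (g [x]) * g [y]"
proof -
  have "A.sg x * y = A.pr (A.sg x * y) + diff A (A.hm (A.sg x * y))"
    using assms by (simp add: A.d_hm_closed A.d_mult A.d_H A.d_sg del: A.sg_d)
  then have "g [A.sg x * y] = g [A.pr (A.sg x * y)] + g [diff A (A.hm (A.sg x * y))]"
    by (metis g1_simps(1))
  then show ?thesis using assms by (simp add: Y_def d_g2 d_g1 A.d_H)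
qed

lemma d_R: assumes "x \<in> Hs" "y \<in> Hs" shows "diff B (R x y) = g [A.pr (A.sg x * y)] - B.sg (g [x]) * g [y]"
proof -
  have "diff B (B.hm (B.sg (Q.th x) * Q.th y)) = B.sg (Q.th x) * Q.th y - Q.th (A.pr (A.sg x * y))"
    using th_mult_sg[OF assms] by (simp add: B.d_hm_closed)
  then show ?thesis using assms
    by (simp add: R_def B.d_mult B.d_sg d_eta d_g1 A.d_H algebra_simps del: B.sg_d)
qed

text \<open>The arity three equation, combined with the arity two equations at the primitives u and
  v, makes the left-hand side exact up to the value of g on a closed element N whose harmonic part
  is the shifted ternary product of A.\<close>

lemma Y_hoch:
  assumes "x \<in> Hs" "y \<in> Hs" "z \<in> Hs"
  shows "B.pr (B.sg (g [x]) * Y y z + B.sg (Y x y) * g [z] - Y (A.pr (A.sg x * y)) z - Y (A.sg x) (A.pr (A.sg y * z)))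
    = - Q.th (A.sg (A.hm (A.sg x * y)) * z + A.sg x * A.hm (A.sg y * z))"
proof -
  note c = A.d_H[OF assms(1)] A.d_H[OF assms(2)] A.d_H[OF assms(3)]
  have cs: "diff A (A.sg x) = 0" "diff A (A.sg y) = 0" "diff A (A.sg x * y) = 0" "diff A (A.sg y * z) = 0"
    using c by (simp_all add: A.d_sg A.d_mult del: A.sg_d)
  define u where "u = A.hm (A.sg x * y)"
  define v where "v = A.hm (A.sg y * z)"
  have du: "diff A u = A.sg x * y - A.pr (A.sg x * y)" and dv: "diff A v = A.sg y * z - A.pr (A.sg y * z)"
    unfolding u_def v_def using cs by (simp_all add: A.d_hm_closed)
  \<comment> \<open>The last two terms lie in \<open>Bs\<close>; they make N closed, so that
    \<open>g [N]\<close> has the harmonic part \<open>Q.th (A.pr N)\<close>.\<close>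
  define N where "N = A.sg u * z + A.sg x * v - A.hm (A.sg (A.pr (A.sg x * y)) * z) - A.hm (x * A.pr (A.sg y * z))"
  have e1: "diff B (g [u, z]) = g [A.sg x * y, z] - g [A.pr (A.sg x * y), z] + g [A.sg u * z] - B.sg (g [u]) * g [z]"
    using d_g2[of u z] c by (simp add: du)
  have e2: "diff B (g [x, v]) = g [A.sg x, A.sg y * z] - g [A.sg x, A.pr (A.sg y * z)] + g [A.sg x * v] - B.sg (g [x]) * g [v]"
    using d_g2[of x v] c by (simp add: dv)
  have "B.sg (g [x]) * Y y z + B.sg (Y x y) * g [z] - Y (A.pr (A.sg x * y)) z - Y (A.sg x) (A.pr (A.sg y * z))
    = diff B (g [u, z] + g [x, v] - g [x, y, z]) - g [N]"
    unfolding N_def Y_def u_def[symmetric] v_def[symmetric]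
    by (simp add: e1 e2 d_g3[OF assms] algebra_simps)
  then have 1: "B.pr (B.sg (g [x]) * Y y z + B.sg (Y x y) * g [z] - Y (A.pr (A.sg x * y)) z - Y (A.sg x) (A.pr (A.sg y * z)))
    = - B.pr (g [N])"
    by (simp only: B.pr_simps B.pr_d) simp
  have p: "A.pr (A.sg (A.pr (A.sg x * y)) * z) + A.pr (x * A.pr (A.sg y * z)) = 0"
  proof -
    have "A.pr (A.sg (A.pr (A.sg x * y)) * z) = A.pr (A.sg (A.sg x * y) * z)"
      unfolding A.sg_pr by (rule A.pr_mult_l[OF A.d_sg_closed[OF cs(3)] c(3)])
    moreover have "A.pr (x * A.pr (A.sg y * z)) = A.pr (x * (A.sg y * z))" by (rule A.pr_mult_r[OF c(1) cs(4)])
    ultimately show ?thesis by (simp add: mult.assoc)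
  qed
  have dp: "diff A (A.sg (A.pr (A.sg x * y)) * z) = 0" "diff A (x * A.pr (A.sg y * z)) = 0"
    using c by (simp_all add: A.d_mult A.d_sg del: A.sg_d)
  have dN: "diff A N = 0"
  proof -
    have "diff A (A.sg u * z) = x * A.sg y * z + A.sg (A.pr (A.sg x * y)) * z"
      using c by (simp add: A.d_mult A.d_sg du algebra_simps del: A.sg_d)
    moreover have "diff A (A.sg x * v) = - (x * A.sg y * z) + x * A.pr (A.sg y * z)"
      using cs by (simp add: A.d_mult dv algebra_simps)
    ultimately show ?thesis using p unfolding N_def
      by (simp add: A.d_hm_closed[OF dp(1)] A.d_hm_closed[OF dp(2)])
  qed
  have "g [N] = g [A.pr N] + diff B (g [A.hm N])"
    unfolding d_g1 by (simp only: A.d_hm_closed[OF dN] g1_simps) simp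
  moreover have t: "Q.th (A.pr N) = B.pr (g [A.pr N])" by (rule th_g1) simp
  ultimately have "B.pr (g [N]) = Q.th (A.pr N)" unfolding t by simp
  also have "\<dots> = Q.th (A.sg u * z + A.sg x * v)"
    unfolding N_def by simp
  finally show ?thesis using 1 by (simp only: u_def v_def)
qed

text \<open>After expanding g as \<open>Q.th\<close> plus the differential of \<open>eta\<close>,
  what remains is the shifted ternary product of B, elements of \<open>Bs'\<close> and an exact
  element; \<open>pr\<close> removes the last two.\<close>

lemma R_hoch:
  assumes "x \<in> Hs" "y \<in> Hs" "z \<in> Hs"
  shows "B.pr (B.sg (g [x]) * R y z + B.sg (R x y) * g [z] - R (A.pr (A.sg x * y)) z - R (A.sg x) (A.pr (A.sg y * z)))
    = - B.pr (B.sg (Q.th x) * B.hm (B.sg (Q.th y) * Q.th z) + B.sg (B.hm (B.sg (Q.th x) * Q.th y)) * Q.th z)"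
proof -
  note c = A.d_H[OF assms(1)] A.d_H[OF assms(2)] A.d_H[OF assms(3)]
  define a0 b0 c0 where 0: "a0 = Q.th x" "b0 = Q.th y" "c0 = Q.th z"
  define al be ga where e: "al = eta x" "be = eta y" "ga = eta z"
  define p where "p = A.pr (A.sg x * y)"
  define q where "q = A.pr (A.sg y * z)"
  have pq: "p \<in> Hs" "q \<in> Hs" by (simp_all add: p_def q_def)
  have g1: "g [x] = a0 + diff B al" "g [y] = b0 + diff B be" "g [z] = c0 + diff B ga"
    unfolding 0 e using assms by (simp_all add: d_eta)
  have gq: "g [q] = Q.th q + diff B (eta q)" using pq by (simp add: d_eta)
  have cl: "diff B a0 = 0" "diff B b0 = 0" "diff B c0 = 0" by (simp_all add: 0)
  have Rxy: "R x y = eta p + B.sg al * g [y] + a0 * be - B.hm (B.sg a0 * b0)"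
    by (simp add: R_def p_def 0 e)
  have Ryz: "R y z = eta q + B.sg be * g [z] + b0 * ga - B.hm (B.sg b0 * c0)"
    by (simp add: R_def q_def 0 e)
  have Rpz: "R p z = eta (A.pr (A.sg p * z)) + B.sg (eta p) * g [z] + Q.th p * ga - B.hm (B.sg (Q.th p) * c0)"
    by (simp add: R_def 0 e)
  have Rxq: "R (A.sg x) q = eta (A.pr (x * q)) - al * g [q] + B.sg a0 * eta q - B.hm (a0 * Q.th q)"
    by (simp add: R_def 0 e eta_sg Q.M.th_sg)
  have dk: "diff B (B.hm (B.sg a0 * b0)) = B.sg a0 * b0 - Q.th p"
    using th_mult_sg[OF assms(1,2)] by (simp add: B.d_hm_closed 0 p_def)
  have dR: "diff B (R y z) = g [q] - B.sg (g [y]) * g [z]" using d_R[OF assms(2,3)] by (simp add: q_def)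
  \<comment> \<open>The primitive in the last line joins the correction \<open>eta\<close> of an
    outer argument with the rest: that of x with \<open>R y z\<close>, and that of z with the
    homotopy of the first two factors.\<close>
  have "B.sg (g [x]) * R y z + B.sg (R x y) * g [z] - R p z - R (A.sg x) q
    = - (B.sg a0 * B.hm (B.sg b0 * c0) + B.sg (B.hm (B.sg a0 * b0)) * c0)
      + B.hm (B.sg (Q.th p) * c0) + B.hm (a0 * Q.th q) - eta (A.pr (A.sg p * z)) - eta (A.pr (x * q))
      + diff B (- (B.sg al * R y z) + B.hm (B.sg a0 * b0) * ga)"
    unfolding B.d_simps B.d_mult dR dk
    unfolding Rxy Ryz Rpz Rxq g1 gq
    by (simp add: B.d_sg algebra_simps del: B.sg_d)
  then have "B.pr (B.sg (g [x]) * R y z + B.sg (R x y) * g [z] - R p z - R (A.sg x) q)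
    = B.pr (- (B.sg a0 * B.hm (B.sg b0 * c0) + B.sg (B.hm (B.sg a0 * b0)) * c0)
      + B.hm (B.sg (Q.th p) * c0) + B.hm (a0 * Q.th q) - eta (A.pr (A.sg p * z)) - eta (A.pr (x * q))
      + diff B (- (B.sg al * R y z) + B.hm (B.sg a0 * b0) * ga))"
    by (rule arg_cong)
  also have "\<dots> = - B.pr (B.sg a0 * B.hm (B.sg b0 * c0) + B.sg (B.hm (B.sg a0 * b0)) * c0)"
    by (simp only: B.pr_simps B.pr_d B.pr_B[OF B.hm_B] eta_def) simp
  finally show ?thesis by (simp only: 0 p_def q_def)
qed

lemma Y_lin: "Vector_Spaces.linear (scal A) (scal B) (Y x)" "Vector_Spaces.linear (scal A) (scal B) (\<lambda>x. Y x y)"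
  unfolding Vector_Spaces.linear_iff Y_def
  by (auto simp: A.vs B.vs algebra_simps A.scal_mult_left A.scal_mult_right B.V.scale_right_diff_distrib)

lemma R_lin: "Vector_Spaces.linear (scal A) (scal B) (R x)" "Vector_Spaces.linear (scal A) (scal B) (\<lambda>x. R x y)"
  unfolding Vector_Spaces.linear_iff R_def
  by (auto simp: A.vs B.vs algebra_simps A.scal_mult_left A.scal_mult_right B.scal_mult_left B.scal_mult_right
      B.V.scale_right_diff_distrib B.V.scale_right_distrib lin_rules[OF Q.lin_th])

lemma Y_gr: "x \<in> gr A k \<Longrightarrow> y \<in> gr A l \<Longrightarrow> Y x y \<in> gr B (k + l - 1)"
  unfolding Y_def by (intro B.gr_diff g2_gr g1_gr A.hm_gr A.mult_gr A.sg_gr)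

lemma R_gr:
  assumes "x \<in> gr A k" "y \<in> gr A l" shows "R x y \<in> gr B (k + l - 1)"
  unfolding R_def
proof (intro B.gr_diff B.gr_add)
  show "eta (A.pr (A.sg x * y)) \<in> gr B (k + l - 1)"
    by (intro eta_gr A.pr_gr A.mult_gr A.sg_gr assms)
  show "B.sg (eta x) * g [y] \<in> gr B (k + l - 1)"
    using B.mult_gr[OF B.sg_gr[OF eta_gr[OF assms(1)]] g1_gr[OF assms(2)]] by (simp add: algebra_simps)
  show "Q.th x * eta y \<in> gr B (k + l - 1)"
    using B.mult_gr[OF Q.M.th_gr[OF assms(1)] eta_gr[OF assms(2)]] by (simp add: algebra_simps)
  show "B.hm (B.sg (Q.th x) * Q.th y) \<in> gr B (k + l - 1)"
    by (intro B.hm_gr B.mult_gr B.sg_gr Q.M.th_gr assms)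
qed

lemma ex_related: "\<exists>xi. Q.related xi"
proof -
  define Z where "Z x y = Y x y - R x y" for x y
  have Z_lin: "Vector_Spaces.linear (scal A) (scal B) (Z x)" "Vector_Spaces.linear (scal A) (scal B) (\<lambda>x. Z x y)" for x y
    unfolding Z_def[abs_def] by (intro lin_diff_fun Y_lin R_lin)+
  \<comment> \<open>Y and R are primitives of the same element, so their difference is
    closed.\<close>
  have dZ: "diff B (Z x y) = 0" if "x \<in> Hs" "y \<in> Hs" for x y
    using that by (simp add: Z_def d_Y d_R)
  define S where "S x y = B.pr (Z (A.pr x) (A.pr y))" for x y
  have "Q.M.cobounds S" unfolding Q.M.cobounds_def
  proof (intro conjI allI impI ballI)
    fix x
    show "Vector_Spaces.linear (scal A) (scal B) (S x)"
      unfolding S_def[abs_def] by (rule lin_comp[OF lin_comp[OF A.lin_pr Z_lin(1)] B.lin_pr])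
    show "Vector_Spaces.linear (scal A) (scal B) (\<lambda>y. S y x)"
      unfolding S_def[abs_def] by (rule lin_comp[OF lin_comp[OF A.lin_pr Z_lin(2)] B.lin_pr])
  next
    fix k l x y assume "x \<in> gr A k" "y \<in> gr A l"
    then show "S x y \<in> gr B (k + l - 1)"
      unfolding S_def Z_def by (intro B.pr_gr B.gr_diff Y_gr R_gr A.pr_gr)
  next
    fix x y z assume H: "x \<in> Hs" "y \<in> Hs" "z \<in> Hs"
    note c = A.d_H[OF H(1)] A.d_H[OF H(2)] A.d_H[OF H(3)]
    have cl: "diff B (g [x]) = 0" "diff B (g [z]) = 0" "diff B (B.sg (g [x])) = 0" "diff B (B.sg (Z x y)) = 0"
      using c dZ[OF H(1,2)] by (simp_all add: d_g1 B.d_sg del: B.sg_d)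
    \<comment> \<open>Under \<open>pr\<close>, closed factors may be exchanged for their harmonic
      parts; this replaces \<open>Q.th\<close> by g.\<close>
    have 1: "B.pr (B.sg (Q.th x) * S y z) = B.pr (B.sg (g [x]) * Z y z)"
    proof -
      have "B.pr (B.sg (Q.th x) * S y z) = B.pr (B.pr (B.sg (g [x])) * Z y z)"
        using H dZ[OF H(2,3)] by (simp add: S_def th_g1 B.sg_pr B.pr_mult_r)
      then show ?thesis by (simp only: B.pr_mult_l[OF cl(3) dZ[OF H(2,3)]])
    qed
    have 2: "B.pr (B.sg (S x y) * Q.th z) = B.pr (B.sg (Z x y) * g [z])"
    proof -
      have "B.pr (B.sg (S x y) * Q.th z) = B.pr (B.sg (Z x y) * B.pr (g [z]))"
        using H cl(4) by (simp add: S_def th_g1 B.sg_pr B.pr_mult_l)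
      then show ?thesis by (simp only: B.pr_mult_r[OF cl(4) cl(2)])
    qed
    have "B.pr (B.sg (Q.th x) * S y z + B.sg (S x y) * Q.th z) - S (A.sg x * y) z - S (A.sg x) (A.sg y * z)
      = B.pr (B.sg (g [x]) * Y y z + B.sg (Y x y) * g [z] - Y (A.pr (A.sg x * y)) z - Y (A.sg x) (A.pr (A.sg y * z)))
       - B.pr (B.sg (g [x]) * R y z + B.sg (R x y) * g [z] - R (A.pr (A.sg x * y)) z - R (A.sg x) (A.pr (A.sg y * z)))"
    proof -
      have sS: "S (A.sg x * y) z = B.pr (Z (A.pr (A.sg x * y)) z)" "S (A.sg x) (A.sg y * z) = B.pr (Z (A.sg x) (A.pr (A.sg y * z)))"
        using H by (simp_all add: S_def)
      then show ?thesis unfolding B.pr_simps(1) 1 2 sS by (simp add: Z_def algebra_simps)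
    qed
    then show "B.pr (B.sg (Q.th x) * S y z + B.sg (S x y) * Q.th z) - S (A.sg x * y) z - S (A.sg x) (A.sg y * z)
      - B.pr (B.sg (Q.th x) * B.hm (B.sg (Q.th y) * Q.th z) + B.sg (B.hm (B.sg (Q.th x) * Q.th y)) * Q.th z)
      + Q.th (A.sg (A.hm (A.sg x * y)) * z + A.sg x * A.hm (A.sg y * z)) = 0"
      unfolding Y_hoch[OF H] R_hoch[OF H] by simp
  qed (simp_all add: S_def)
  then show ?thesis by (rule Q.cobounds_imp_related)
qed

end

lemma (in hodge_pair) ainf_imp_related:
  assumes "ainf_quasi_isomorphic A B"
  shows "\<exists>phi xi. galg_iso A.HA B.HA phi \<and> coh_iso.related A Hs Bs i B Hs' Bs' i' phi xi"
proof -
  obtain f where f: "ainf_morphism A (ainf_mult A) B (ainf_mult B) f"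
    "\<And>k. bij_betw (\<lambda>X. \<Union>x\<in>X. cls B (f [x])) (gpart A.HA k) (gpart B.HA k)"
    using assms unfolding ainf_quasi_isomorphic_def ainf_quasi_iso_def by blast
  obtain g where g: "mlin (scal A) (scal B) g" "g [] = 0" "sdeg g"
    "\<And>ks xs. list_all2 (\<lambda>k x. x \<in> gr A k) ks xs \<Longrightarrow> xs \<noteq> [] \<Longrightarrow> Eop g xs = 0" "\<And>x. f [x] = g [x]"
    using ainf_morphismD[OF f(1)] by metis
  interpret G: ainf_map A n I Hs Bs i r B I' Hs' Bs' i' g
    by unfold_locales (use g f(2) in auto)
  show ?thesis using G.phi_iso G.ex_related by blast
qed

section \<open>Transport of Hochschild classes\<close>

context hodge
begin

lemma part_linearI':
  assumes "\<And>x. x \<in> gpart K k \<Longrightarrow> g x \<in> gpart HA l"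
    and "\<And>x y. x \<in> gpart K k \<Longrightarrow> y \<in> gpart K k \<Longrightarrow> gadd K x y \<in> gpart K k \<and> i (g (gadd K x y)) = i (g x) + i (g y)"
    and "\<And>a x. x \<in> gpart K k \<Longrightarrow> gscale K a x \<in> gpart K k \<and> i (g (gscale K a x)) = scal A a (i (g x))"
  shows "part_linear K k HA l g"
  unfolding part_linear_def
proof (intro conjI ballI allI)
  fix x y assume xy: "x \<in> gpart K k" "y \<in> gpart K k"
  show "g (gadd K x y) = gadd HA (g x) (g y)"
    by (rule i_inj[OF assms(1) part_add[OF assms(1)[OF xy(1)] assms(1)[OF xy(2)]]])
       (simp_all add: assms(2)[OF xy] i_add[OF assms(1)[OF xy(1)] assms(1)[OF xy(2)]])
next
  fix x a assume x: "x \<in> gpart K k"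
  show "g (gscale K a x) = gscale HA a (g x)"
    by (rule i_inj[OF assms(1) part_scale[OF assms(1)[OF x]]])
       (simp_all add: assms(3)[OF x] i_scale[OF assms(1)[OF x]])
qed (rule assms(1))

lemma i_hoch_d:
  assumes "bilinear_deg HA (- 1) xi" "X \<in> gpart HA a" "Y \<in> gpart HA b" "Z \<in> gpart HA c"
  shows "i (hoch_d HA xi a X Y Z) = pr (i (xi X Y) * i Z) - scal A (ksgn a) (pr (i X * i (xi Y Z)))
    + i (xi (gmult HA X Y) Z) - i (xi X (gmult HA Y Z))"
proof -
  note D = bilinear_degD(1)[OF assms(1)] and P = hoch_d_part[OF assms]
  show ?thesis unfolding hoch_d_def
    i_sub[OF part_add[OF part_sub[OF P(2) part_scale[OF P(3)]] P(4)] P(5)]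
    i_add[OF part_sub[OF P(2) part_scale[OF P(3)]] P(4)] i_sub[OF P(2) part_scale[OF P(3)]]
    i_scale[OF P(3)] i_mult[OF D[OF assms(2,3)] assms(4)] i_mult[OF assms(2) D[OF assms(3,4)]] ..
qed

lemma mu3_in_class: "mu3 A Hs Bs i \<in> hoch_class HA (mu3 A Hs Bs i)"
  unfolding hoch_class_def
proof (intro CollectI conjI exI[of _ "\<lambda>x y. gzero HA"] allI ballI)
  show xi: "bilinear_deg HA (- 1) (\<lambda>x y. gzero HA)"
    unfolding bilinear_deg_def
    by (intro allI ballI conjI part_linearI') (auto simp: part_zero part_add part_scale i_zero)
  fix a b c X Y Z assume *: "X \<in> gpart HA a" "Y \<in> gpart HA b" "Z \<in> gpart HA c"
  show "mu3 A Hs Bs i X Y Z = gadd HA (mu3 A Hs Bs i X Y Z) (hoch_d HA (\<lambda>x y. gzero HA) a X Y Z)"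
    by (rule i_inj[OF mu3_part[OF *] part_add[OF mu3_part[OF *] hoch_d_part(1)[OF xi *]]])
       (simp add: i_add[OF mu3_part[OF *] hoch_d_part(1)[OF xi *]] i_hoch_d[OF xi *] i_zero)
qed (rule mu3_cocycle)

end

context coh_iso
begin

text \<open>This inverts \<open>phi\<close> on all homogeneous parts at once by way of harmonic
  representatives; \<open>phi\<close> itself is only bijective degree by degree.\<close>

definition psi :: "'b set \<Rightarrow> 'a set" where "psi U = cls A (M.thi (i' U))"

lemma assumes U: "U \<in> gpart B.HA k"
  shows psi_part: "psi U \<in> gpart A.HA k" and phi_psi: "phi (psi U) = U"
proof -
  let ?v = "M.thi (i' U)"
  have t: "th ?v = i' U" using B.i_H[OF U] by (simp add: M.th_thi)
  have "th (A.hc k ?v) = th ?v"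
    using B.hc_hom[OF B.i_gr[OF U], of k] by (simp add: M.th_hc[symmetric] t)
  then have "A.hc k ?v = ?v" by (intro M.th_inj) simp_all
  then have g: "?v \<in> gr A k" by (metis A.hc_gr)
  show p: "psi U \<in> gpart A.HA k" unfolding psi_def by (rule A.coh_partI'[OF M.thi_H g])
  have "Phi (psi U) = i' U" using th_cls[OF M.thi_H g] t by (simp add: psi_def)
  then show "phi (psi U) = U" unfolding Phi_def by (intro B.i_inj[OF phi_part[OF p] U])
qed

lemma phi_inj: "X \<in> gpart A.HA k \<Longrightarrow> Y \<in> gpart A.HA k \<Longrightarrow> phi X = phi Y \<Longrightarrow> X = Y"
  by (rule Phi_inj) (simp_all add: Phi_def)

lemma psi_phi: "X \<in> gpart A.HA k \<Longrightarrow> psi (phi X) = X"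
  by (rule phi_inj[OF psi_part[OF phi_part] _ phi_psi[OF phi_part]])

lemma gpart_phiE:
  assumes "U \<in> gpart B.HA k" obtains X where "X \<in> gpart A.HA k" "U = phi X"
  using psi_part[OF assms] phi_psi[OF assms] by metis

lemma psi_add: "U \<in> gpart B.HA k \<Longrightarrow> V \<in> gpart B.HA k \<Longrightarrow> psi (gadd B.HA U V) = gadd A.HA (psi U) (psi V)"
  by (elim gpart_phiE) (simp add: phi_add[symmetric] psi_phi[of _ k] A.part_add)

lemma psi_scale: "U \<in> gpart B.HA k \<Longrightarrow> psi (gscale B.HA a U) = gscale A.HA a (psi U)"
  by (elim gpart_phiE) (simp add: phi_scale[symmetric] psi_phi[of _ k] A.part_scale)

lemma psi_iso: "galg_iso B.HA A.HA psi"
  unfolding galg_iso_def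
proof (intro conjI allI ballI)
  fix k
  show "part_linear B.HA k A.HA k psi"
    unfolding part_linear_def by (simp add: psi_part psi_add psi_scale)
  show "bij_betw psi (gpart B.HA k) (gpart A.HA k)"
    by (rule bij_betw_byWitness[where f' = phi]) (auto simp: phi_psi psi_phi psi_part phi_part)
next
  fix j k U V assume UV: "U \<in> gpart B.HA j" "V \<in> gpart B.HA k"
  obtain X where X: "X \<in> gpart A.HA j" "U = phi X" using UV(1) by (rule gpart_phiE)
  obtain Y where Y: "Y \<in> gpart A.HA k" "V = phi Y" using UV(2) by (rule gpart_phiE)
  show "psi (gmult B.HA U V) = gmult A.HA (psi U) (psi V)"
    unfolding X(2) Y(2) phi_mult[OF X(1) Y(1), symmetric] psi_phi[OF X(1)] psi_phi[OF Y(1)]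
    by (rule psi_phi[OF A.part_mult[OF X(1) Y(1)]])
next
  show "psi (gone B.HA) = gone A.HA"
    unfolding phi_one[symmetric] by (rule psi_phi[OF A.part_one])
qed

lemma phi_sub: "X \<in> gpart A.HA k \<Longrightarrow> Y \<in> gpart A.HA k \<Longrightarrow> phi (gsub A.HA X Y) = gsub B.HA (phi X) (phi Y)"
  unfolding gsub_def by (subst phi_add[OF _ A.part_scale]) (auto simp: phi_scale)

lemma phi_zero: "phi (gzero A.HA) = gzero B.HA"
  by (rule B.i_inj[OF phi_part[OF A.part_zero] B.part_zero]) (simp add: B.i_zero Phi_zero[unfolded Phi_def] A.coh_zero)

lemma cocycle_transport:
  assumes f: "hoch_cocycle A.HA f"
    and g: "\<And>a b c X Y Z. X \<in> gpart A.HA a \<Longrightarrow> Y \<in> gpart A.HA b \<Longrightarrow> Z \<in> gpart A.HA c \<Longrightarrow> g (phi X) (phi Y) (phi Z) = phi (f X Y Z)"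
  shows "hoch_cocycle B.HA g"
proof -
  have tri: "trilinear_deg A.HA (- 1) f" using f by (simp add: hoch_cocycle_def)
  have fl: "part_linear A.HA a A.HA (a + b + c + - 1) (\<lambda>x. f x Y Z)" "part_linear A.HA b A.HA (a + b + c + - 1) (\<lambda>y. f X y Z)"
    "part_linear A.HA c A.HA (a + b + c + - 1) (\<lambda>z. f X Y z)"
    if "X \<in> gpart A.HA a" "Y \<in> gpart A.HA b" "Z \<in> gpart A.HA c" for X Y Z a b c
    using tri that unfolding trilinear_deg_def by blast+
  have fp: "f X Y Z \<in> gpart A.HA (a + b + c - 1)" if "X \<in> gpart A.HA a" "Y \<in> gpart A.HA b" "Z \<in> gpart A.HA c" for X Y Z a b c
    using fl(1)[OF that] that(1) unfolding part_linear_def by simp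
  have lin: "part_linear B.HA a B.HA m G"
    if F: "part_linear A.HA a A.HA m F'" and G: "\<And>X. X \<in> gpart A.HA a \<Longrightarrow> G (phi X) = phi (F' X)" for a m F' G
    unfolding part_linear_def
  proof (intro conjI ballI allI)
    have Fp: "F' X \<in> gpart A.HA m" and Fa: "Y \<in> gpart A.HA a \<Longrightarrow> F' (gadd A.HA X Y) = gadd A.HA (F' X) (F' Y)"
      and Fs: "F' (gscale A.HA e X) = gscale A.HA e (F' X)" if "X \<in> gpart A.HA a" for X Y e
      using F that unfolding part_linear_def by blast+
    fix U V e assume U: "U \<in> gpart B.HA a"
    obtain X where X: "X \<in> gpart A.HA a" "U = phi X" using U by (rule gpart_phiE)
    show "G U \<in> gpart B.HA m" unfolding X(2) G[OF X(1)] by (rule phi_part[OF Fp[OF X(1)]])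
    show "G (gscale B.HA e U) = gscale B.HA e (G U)"
      unfolding X(2) phi_scale[OF X(1), symmetric] G[OF X(1)] G[OF A.part_scale[OF X(1)]] Fs[OF X(1)]
      by (rule phi_scale[OF Fp[OF X(1)]])
    assume V: "V \<in> gpart B.HA a"
    obtain Y where Y: "Y \<in> gpart A.HA a" "V = phi Y" using V by (rule gpart_phiE)
    show "G (gadd B.HA U V) = gadd B.HA (G U) (G V)"
      unfolding X(2) Y(2) phi_add[OF X(1) Y(1), symmetric] G[OF X(1)] G[OF Y(1)] G[OF A.part_add[OF X(1) Y(1)]] Fa[OF X(1) Y(1)]
      by (rule phi_add[OF Fp[OF X(1)] Fp[OF Y(1)]])
  qed
  show ?thesis unfolding hoch_cocycle_def trilinear_deg_def
  proof (intro conjI allI ballI)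
    fix a b c U V W assume *: "U \<in> gpart B.HA a" "V \<in> gpart B.HA b" "W \<in> gpart B.HA c"
    obtain X where X: "X \<in> gpart A.HA a" "U = phi X" using *(1) by (rule gpart_phiE)
    obtain Y where Y: "Y \<in> gpart A.HA b" "V = phi Y" using *(2) by (rule gpart_phiE)
    obtain Z where Z: "Z \<in> gpart A.HA c" "W = phi Z" using *(3) by (rule gpart_phiE)
    show "part_linear B.HA a B.HA (a + b + c + - 1) (\<lambda>x. g x V W)"
      unfolding Y(2) Z(2) by (rule lin[OF fl(1)[OF X(1) Y(1) Z(1)]]) (rule g[OF _ Y(1) Z(1)])
    show "part_linear B.HA b B.HA (a + b + c + - 1) (\<lambda>y. g U y W)"
      unfolding X(2) Z(2) by (rule lin[OF fl(2)[OF X(1) Y(1) Z(1)]]) (rule g[OF X(1) _ Z(1)])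
    show "part_linear B.HA c B.HA (a + b + c + - 1) (\<lambda>z. g U V z)"
      unfolding X(2) Y(2) by (rule lin[OF fl(3)[OF X(1) Y(1) Z(1)]]) (rule g[OF X(1) Y(1)])
  next
    fix a b c e U V W T assume *: "U \<in> gpart B.HA a" "V \<in> gpart B.HA b" "W \<in> gpart B.HA c" "T \<in> gpart B.HA e"
    obtain X where X: "X \<in> gpart A.HA a" "U = phi X" using *(1) by (rule gpart_phiE)
    obtain Y where Y: "Y \<in> gpart A.HA b" "V = phi Y" using *(2) by (rule gpart_phiE)
    obtain Z where Z: "Z \<in> gpart A.HA c" "W = phi Z" using *(3) by (rule gpart_phiE)
    obtain Q where Q: "Q \<in> gpart A.HA e" "T = phi Q" using *(4) by (rule gpart_phiE)
    let ?m = "a + b + c + e - 1"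
    have 1: "gmult A.HA (f X Y Z) Q \<in> gpart A.HA ?m"
      using A.part_mult[OF fp[OF X(1) Y(1) Z(1)] Q(1)] by (simp add: algebra_simps)
    have 2: "gmult A.HA X (f Y Z Q) \<in> gpart A.HA ?m"
      using A.part_mult[OF X(1) fp[OF Y(1) Z(1) Q(1)]] by (simp add: algebra_simps)
    have 3: "f (gmult A.HA X Y) Z Q \<in> gpart A.HA ?m" by (rule fp[OF A.part_mult[OF X(1) Y(1)] Z(1) Q(1)])
    have 4: "f X (gmult A.HA Y Z) Q \<in> gpart A.HA ?m"
      using fp[OF X(1) A.part_mult[OF Y(1) Z(1)] Q(1)] by (simp add: algebra_simps)
    have 5: "f X Y (gmult A.HA Z Q) \<in> gpart A.HA ?m"
      using fp[OF X(1) Y(1) A.part_mult[OF Z(1) Q(1)]] by (simp add: algebra_simps)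
    note 6 = A.part_add[OF 1 A.part_scale[OF 2, of "ksgn a"]]
    note 7 = A.part_sub[OF 6 3]
    note 8 = A.part_add[OF 7 4]
    have coc: "gsub A.HA (gadd A.HA (gsub A.HA (gadd A.HA (gmult A.HA (f X Y Z) Q) (gscale A.HA (ksgn a) (gmult A.HA X (f Y Z Q))))
       (f (gmult A.HA X Y) Z Q)) (f X (gmult A.HA Y Z) Q)) (f X Y (gmult A.HA Z Q)) = gzero A.HA"
      using f X(1) Y(1) Z(1) Q(1) unfolding hoch_cocycle_def by blast
    have "gsub B.HA (gadd B.HA (gsub B.HA (gadd B.HA (gmult B.HA (g U V W) T) (gscale B.HA (ksgn a) (gmult B.HA U (g V W T))))
       (g (gmult B.HA U V) W T)) (g U (gmult B.HA V W) T)) (g U V (gmult B.HA W T))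
     = phi (gsub A.HA (gadd A.HA (gsub A.HA (gadd A.HA (gmult A.HA (f X Y Z) Q) (gscale A.HA (ksgn a) (gmult A.HA X (f Y Z Q))))
       (f (gmult A.HA X Y) Z Q)) (f X (gmult A.HA Y Z) Q)) (f X Y (gmult A.HA Z Q)))"
      unfolding X(2) Y(2) Z(2) Q(2) phi_mult[OF X(1) Y(1), symmetric] phi_mult[OF Y(1) Z(1), symmetric] phi_mult[OF Z(1) Q(1), symmetric]
        g[OF X(1) Y(1) Z(1)] g[OF Y(1) Z(1) Q(1)] g[OF A.part_mult[OF X(1) Y(1)] Z(1) Q(1)]
        g[OF X(1) A.part_mult[OF Y(1) Z(1)] Q(1)] g[OF X(1) Y(1) A.part_mult[OF Z(1) Q(1)]]
        phi_sub[OF 8 5] phi_add[OF 7 4] phi_sub[OF 6 3] phi_add[OF 1 A.part_scale[OF 2]] phi_scale[OF 2]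
        phi_mult[OF fp[OF X(1) Y(1) Z(1)] Q(1)] phi_mult[OF X(1) fp[OF Y(1) Z(1) Q(1)]] ..
    then show "gsub B.HA (gadd B.HA (gsub B.HA (gadd B.HA (gmult B.HA (g U V W) T) (gscale B.HA (ksgn a) (gmult B.HA U (g V W T))))
       (g (gmult B.HA U V) W T)) (g U (gmult B.HA V W) T)) (g U V (gmult B.HA W T)) = gzero B.HA"
      unfolding coc phi_zero .
  qed
qed

abbreviation "muA \<equiv> mu3 A Hs Bs i"
abbreviation "muB \<equiv> mu3 B Hs' Bs' i'"

text \<open>If f is \<open>muA\<close> plus the coboundary of \<open>zeta\<close>, and
  \<open>muB\<close> is the push-forward of \<open>muA\<close> plus the coboundary of
  \<open>xi\<close>, then the push-forward of f differs from \<open>muB\<close> by the coboundary of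
  this cochain.\<close>

definition pushed :: "('a set \<Rightarrow> 'a set \<Rightarrow> 'a set) \<Rightarrow> ('a set \<Rightarrow> 'a set \<Rightarrow> 'a set) \<Rightarrow> 'b set \<Rightarrow> 'b set \<Rightarrow> 'b set" where
  "pushed zeta xi U V = phi (gsub A.HA (zeta (psi U) (psi V)) (xi (psi U) (psi V)))"

lemma pushed:
  assumes zeta: "bilinear_deg A.HA (- 1) zeta" and xi: "bilinear_deg A.HA (- 1) xi"
  shows "bilinear_deg B.HA (- 1) (pushed zeta xi)"
    and "X \<in> gpart A.HA a \<Longrightarrow> Y \<in> gpart A.HA b \<Longrightarrow> Z \<in> gpart A.HA c \<Longrightarrow>
      i' (hoch_d B.HA (pushed zeta xi) a (phi X) (phi Y) (phi Z))
        = Phi (hoch_d A.HA zeta a X Y Z) - Phi (hoch_d A.HA xi a X Y Z)"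
proof -
  note D = bilinear_degD[OF zeta] and D' = bilinear_degD[OF xi]
  have ip: "i' (pushed zeta xi U V) = Phi (zeta (psi U) (psi V)) - Phi (xi (psi U) (psi V))"
    if "U \<in> gpart B.HA j" "V \<in> gpart B.HA k" for U V j k
    unfolding pushed_def Phi_def[symmetric]
    by (rule Phi_sub[OF D(1)[OF psi_part[OF that(1)] psi_part[OF that(2)]] D'(1)[OF psi_part[OF that(1)] psi_part[OF that(2)]]])
  have pp: "pushed zeta xi U V \<in> gpart B.HA (j + k - 1)" if "U \<in> gpart B.HA j" "V \<in> gpart B.HA k" for U V j k
    unfolding pushed_def
    by (rule phi_part[OF A.part_sub[OF D(1)[OF psi_part[OF that(1)] psi_part[OF that(2)]] D'(1)[OF psi_part[OF that(1)] psi_part[OF that(2)]]]])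
  show bl: "bilinear_deg B.HA (- 1) (pushed zeta xi)"
    unfolding bilinear_deg_def
  proof (intro allI ballI conjI)
    fix j k U V assume UV: "U \<in> gpart B.HA j" "V \<in> gpart B.HA k"
    have e: "j + k + - 1 = j + k - 1" by simp
    note pU = psi_part[OF UV(1)] and pV = psi_part[OF UV(2)]
    show "part_linear B.HA j B.HA (j + k + - 1) (\<lambda>x. pushed zeta xi x V)" unfolding e
    proof (rule B.part_linearI'; (intro conjI)?)
      fix U U' a assume U: "U \<in> gpart B.HA j"
      note p = psi_part[OF U]
      show "pushed zeta xi U V \<in> gpart B.HA (j + k - 1)" by (rule pp[OF U UV(2)])
      show "gscale B.HA a U \<in> gpart B.HA j" by (rule B.part_scale[OF U])
      show "i' (pushed zeta xi (gscale B.HA a U) V) = scal B a (i' (pushed zeta xi U V))"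
        unfolding ip[OF B.part_scale[OF U] UV(2)] ip[OF U UV(2)] psi_scale[OF U] D(4)[OF p pV] D'(4)[OF p pV]
          Phi_scale[OF D(1)[OF p pV]] Phi_scale[OF D'(1)[OF p pV]] by (simp add: B.V.scale_right_diff_distrib)
      assume U': "U' \<in> gpart B.HA j"
      note p' = psi_part[OF U']
      show "gadd B.HA U U' \<in> gpart B.HA j" by (rule B.part_add[OF U U'])
      show "i' (pushed zeta xi (gadd B.HA U U') V) = i' (pushed zeta xi U V) + i' (pushed zeta xi U' V)"
        unfolding ip[OF B.part_add[OF U U'] UV(2)] ip[OF U UV(2)] ip[OF U' UV(2)] psi_add[OF U U'] D(2)[OF p pV p'] D'(2)[OF p pV p']
          Phi_add[OF D(1)[OF p pV] D(1)[OF p' pV]] Phi_add[OF D'(1)[OF p pV] D'(1)[OF p' pV]] by simp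
    qed
    show "part_linear B.HA k B.HA (j + k + - 1) (\<lambda>y. pushed zeta xi U y)" unfolding e
    proof (rule B.part_linearI'; (intro conjI)?)
      fix V V' a assume V: "V \<in> gpart B.HA k"
      note p = psi_part[OF V]
      show "pushed zeta xi U V \<in> gpart B.HA (j + k - 1)" by (rule pp[OF UV(1) V])
      show "gscale B.HA a V \<in> gpart B.HA k" by (rule B.part_scale[OF V])
      show "i' (pushed zeta xi U (gscale B.HA a V)) = scal B a (i' (pushed zeta xi U V))"
        unfolding ip[OF UV(1) B.part_scale[OF V]] ip[OF UV(1) V] psi_scale[OF V] D(5)[OF pU p] D'(5)[OF pU p]
          Phi_scale[OF D(1)[OF pU p]] Phi_scale[OF D'(1)[OF pU p]] by (simp add: B.V.scale_right_diff_distrib)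
      assume V': "V' \<in> gpart B.HA k"
      note p' = psi_part[OF V']
      show "gadd B.HA V V' \<in> gpart B.HA k" by (rule B.part_add[OF V V'])
      show "i' (pushed zeta xi U (gadd B.HA V V')) = i' (pushed zeta xi U V) + i' (pushed zeta xi U V')"
        unfolding ip[OF UV(1) B.part_add[OF V V']] ip[OF UV(1) V] ip[OF UV(1) V'] psi_add[OF V V'] D(3)[OF pU p p'] D'(3)[OF pU p p']
          Phi_add[OF D(1)[OF pU p] D(1)[OF pU p']] Phi_add[OF D'(1)[OF pU p] D'(1)[OF pU p']] by simp
    qed
  qed
  assume *: "X \<in> gpart A.HA a" "Y \<in> gpart A.HA b" "Z \<in> gpart A.HA c"
  note ph = phi_part[OF *(1)] phi_part[OF *(2)] phi_part[OF *(3)]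
  note ps = psi_phi[OF *(1)] psi_phi[OF *(2)] psi_phi[OF *(3)]
  show "i' (hoch_d B.HA (pushed zeta xi) a (phi X) (phi Y) (phi Z))
        = Phi (hoch_d A.HA zeta a X Y Z) - Phi (hoch_d A.HA xi a X Y Z)"
    unfolding B.i_hoch_d[OF bl ph] Phi_hoch_d[OF zeta *] Phi_hoch_d[OF xi *] phi_mult[OF *(1,2), symmetric] phi_mult[OF *(2,3), symmetric]
      ip[OF ph(1,2)] ip[OF ph(2,3)] ip[OF phi_part[OF A.part_mult[OF *(1,2)]] ph(3)] ip[OF ph(1) phi_part[OF A.part_mult[OF *(2,3)]]]
      ps psi_phi[OF A.part_mult[OF *(1,2)]] psi_phi[OF A.part_mult[OF *(2,3)]] Phi_def[symmetric]
    by (simp add: left_diff_distrib right_diff_distrib B.V.scale_right_diff_distrib)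
qed

lemma push_subset:
  assumes rel: "related xi"
  shows "hoch_push A.HA phi (hoch_class A.HA muA) \<subseteq> hoch_class B.HA muB"
proof
  fix g assume "g \<in> hoch_push A.HA phi (hoch_class A.HA muA)"
  then obtain f where f: "f \<in> hoch_class A.HA muA"
    "\<forall>a b c. \<forall>X\<in>gpart A.HA a. \<forall>Y\<in>gpart A.HA b. \<forall>Z\<in>gpart A.HA c. g (phi X) (phi Y) (phi Z) = phi (f X Y Z)"
    unfolding hoch_push_def by blast
  obtain zeta where zeta: "hoch_cocycle A.HA f" "bilinear_deg A.HA (- 1) zeta"
    "\<forall>a b c. \<forall>X\<in>gpart A.HA a. \<forall>Y\<in>gpart A.HA b. \<forall>Z\<in>gpart A.HA c. f X Y Z = gadd A.HA (muA X Y Z) (hoch_d A.HA zeta a X Y Z)"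
    using f(1) unfolding hoch_class_def by blast
  have xi: "bilinear_deg A.HA (- 1) xi" using rel by (simp add: related_def)
  have g: "hoch_cocycle B.HA g"
    by (rule cocycle_transport[OF zeta(1)]) (use f(2) in blast)
  have "g U V W = gadd B.HA (muB U V W) (hoch_d B.HA (pushed zeta xi) a U V W)"
    if *: "U \<in> gpart B.HA a" "V \<in> gpart B.HA b" "W \<in> gpart B.HA c" for a b c U V W
  proof -
    obtain X where X: "X \<in> gpart A.HA a" "U = phi X" using *(1) by (rule gpart_phiE)
    obtain Y where Y: "Y \<in> gpart A.HA b" "V = phi Y" using *(2) by (rule gpart_phiE)
    obtain Z where Z: "Z \<in> gpart A.HA c" "W = phi Z" using *(3) by (rule gpart_phiE)
    note P = X(1) Y(1) Z(1)
    have s: "gadd A.HA (muA X Y Z) (hoch_d A.HA zeta a X Y Z) \<in> gpart A.HA (a + b + c - 1)"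
      by (rule A.part_add[OF A.mu3_part[OF P] A.hoch_d_part(1)[OF zeta(2) P]])
    have gU: "g U V W = phi (gadd A.HA (muA X Y Z) (hoch_d A.HA zeta a X Y Z))"
      unfolding X(2) Y(2) Z(2) using f(2) zeta(3) P by metis
    have mu: "muB (phi X) (phi Y) (phi Z) = phi (gadd A.HA (muA X Y Z) (hoch_d A.HA xi a X Y Z))"
      using rel P unfolding related_def by metis
    have "i' (gadd B.HA (muB U V W) (hoch_d B.HA (pushed zeta xi) a U V W)) = i' (g U V W)"
      unfolding B.i_add[OF B.mu3_part[OF *] B.hoch_d_part(1)[OF pushed(1)[OF zeta(2) xi] *]] gU
      unfolding X(2) Y(2) Z(2)
      unfolding mu pushed(2)[OF zeta(2) xi P] Phi_def[symmetric]
        Phi_add[OF A.mu3_part[OF P] A.hoch_d_part(1)[OF zeta(2) P]] Phi_add[OF A.mu3_part[OF P] A.hoch_d_part(1)[OF xi P]]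
      by simp
    moreover have "g U V W \<in> gpart B.HA (a + b + c - 1)" unfolding gU by (rule phi_part[OF s])
    ultimately show ?thesis
      by (intro B.i_inj[OF _ B.part_add[OF B.mu3_part[OF *] B.hoch_d_part(1)[OF pushed(1)[OF zeta(2) xi] *]]]) simp_all
  qed
  then show "g \<in> hoch_class B.HA muB"
    unfolding hoch_class_def using g pushed(1)[OF zeta(2) xi] by blast
qed

lemma push_eq:
  assumes rel: "related xi"
  shows "hoch_push A.HA phi (hoch_class A.HA muA) = hoch_class B.HA muB"
proof
  show "hoch_push A.HA phi (hoch_class A.HA muA) \<subseteq> hoch_class B.HA muB" by (rule push_subset[OF rel])
  interpret J: coh_iso B n I' Hs' Bs' i' r A I Hs Bs i psi
    by unfold_locales (rule psi_iso)
  have xi: "bilinear_deg A.HA (- 1) xi" using rel by (simp add: related_def)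
  have z: "bilinear_deg A.HA (- 1) (\<lambda>x y. gzero A.HA)"
    unfolding bilinear_deg_def
    by (intro allI ballI conjI A.part_linearI') (auto simp: A.part_zero A.part_add A.part_scale A.i_zero)
  \<comment> \<open>The relation is inverted by pushing forward the negative of \<open>xi\<close>,
    so the inclusion already shown applies to \<open>psi\<close> as well.\<close>
  have Jrel: "J.related (pushed (\<lambda>x y. gzero A.HA) xi)"
    unfolding J.related_def
  proof (intro conjI allI ballI)
    show bl: "bilinear_deg B.HA (- 1) (pushed (\<lambda>x y. gzero A.HA) xi)" by (rule pushed(1)[OF z xi])
    fix a b c U V W assume *: "U \<in> gpart B.HA a" "V \<in> gpart B.HA b" "W \<in> gpart B.HA c"
    obtain X where X: "X \<in> gpart A.HA a" "U = phi X" using *(1) by (rule gpart_phiE)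
    obtain Y where Y: "Y \<in> gpart A.HA b" "V = phi Y" using *(2) by (rule gpart_phiE)
    obtain Z where Z: "Z \<in> gpart A.HA c" "W = phi Z" using *(3) by (rule gpart_phiE)
    note P = X(1) Y(1) Z(1)
    have mu: "muB (phi X) (phi Y) (phi Z) = phi (gadd A.HA (muA X Y Z) (hoch_d A.HA xi a X Y Z))"
      using rel P unfolding related_def by metis
    have z0: "Phi (hoch_d A.HA (\<lambda>x y. gzero A.HA) a X Y Z) = 0"
      unfolding Phi_hoch_d[OF z P] by (simp add: A.coh_zero Phi_zero)
    have "i' (gadd B.HA (muB U V W) (hoch_d B.HA (pushed (\<lambda>x y. gzero A.HA) xi) a U V W)) = i' (phi (muA X Y Z))"
      unfolding B.i_add[OF B.mu3_part[OF *] B.hoch_d_part(1)[OF bl *]]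
      unfolding X(2) Y(2) Z(2)
      unfolding mu pushed(2)[OF z xi P] Phi_def[symmetric] z0
        Phi_add[OF A.mu3_part[OF P] A.hoch_d_part(1)[OF xi P]]
      by simp
    then have "gadd B.HA (muB U V W) (hoch_d B.HA (pushed (\<lambda>x y. gzero A.HA) xi) a U V W) = phi (muA X Y Z)"
      by (rule B.i_inj[OF B.part_add[OF B.mu3_part[OF *] B.hoch_d_part(1)[OF bl *]] phi_part[OF A.mu3_part[OF P]]])
    then show "muA (psi U) (psi V) (psi W) = psi (gadd B.HA (muB U V W) (hoch_d B.HA (pushed (\<lambda>x y. gzero A.HA) xi) a U V W))"
      by (simp add: X(2) Y(2) Z(2) psi_phi[OF P(1)] psi_phi[OF P(2)] psi_phi[OF P(3)] psi_phi[OF A.mu3_part[OF P]])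
  qed
  show "hoch_class B.HA muB \<subseteq> hoch_push A.HA phi (hoch_class A.HA muA)"
  proof
    fix g assume g: "g \<in> hoch_class B.HA muB"
    then have gt: "trilinear_deg B.HA (- 1) g" unfolding hoch_class_def hoch_cocycle_def by blast
    have gp: "g U V W \<in> gpart B.HA (a + b + c - 1)" if "U \<in> gpart B.HA a" "V \<in> gpart B.HA b" "W \<in> gpart B.HA c" for U V W a b c
    proof -
      have "part_linear B.HA a B.HA (a + b + c + - 1) (\<lambda>x. g x V W)"
        using gt that unfolding trilinear_deg_def by blast
      then show ?thesis using that(1) unfolding part_linear_def by simp
    qed
    \<comment> \<open>Pull g back along \<open>phi\<close>; the inclusion for \<open>psi\<close>
      places the result in the class of \<open>muA\<close>.\<close>
    define f where "f X Y Z = psi (g (phi X) (phi Y) (phi Z))" for X Y Z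
    have "f (psi U) (psi V) (psi W) = psi (g U V W)"
      if "U \<in> gpart B.HA a" "V \<in> gpart B.HA b" "W \<in> gpart B.HA c" for U V W a b c
      by (simp add: f_def phi_psi[OF that(1)] phi_psi[OF that(2)] phi_psi[OF that(3)])
    then have "f \<in> hoch_push B.HA psi (hoch_class B.HA muB)"
      unfolding hoch_push_def using g by blast
    then have "f \<in> hoch_class A.HA muA" using J.push_subset[OF Jrel] by blast
    moreover have "g (phi X) (phi Y) (phi Z) = phi (f X Y Z)"
      if "X \<in> gpart A.HA a" "Y \<in> gpart A.HA b" "Z \<in> gpart A.HA c" for X Y Z a b c
      unfolding f_def by (rule phi_psi[OF gp[OF phi_part[OF that(1)] phi_part[OF that(2)] phi_part[OF that(3)]], symmetric])
    ultimately show "g \<in> hoch_push A.HA phi (hoch_class A.HA muA)"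
      unfolding hoch_push_def by blast
  qed
qed

text \<open>The class of \<open>muB\<close> contains \<open>muB\<close> itself, which is therefore
  the push-forward of a cocycle differing from \<open>muA\<close> by a coboundary.\<close>

lemma push_imp_related:
  assumes "hoch_push A.HA phi (hoch_class A.HA muA) = hoch_class B.HA muB"
  shows "\<exists>xi. related xi"
proof -
  have "muB \<in> hoch_push A.HA phi (hoch_class A.HA muA)" unfolding assms by (rule B.mu3_in_class)
  then obtain f where f: "f \<in> hoch_class A.HA muA"
    "\<forall>a b c. \<forall>X\<in>gpart A.HA a. \<forall>Y\<in>gpart A.HA b. \<forall>Z\<in>gpart A.HA c. muB (phi X) (phi Y) (phi Z) = phi (f X Y Z)"
    unfolding hoch_push_def by blast
  obtain xi where xi: "bilinear_deg A.HA (- 1) xi"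
    "\<forall>a b c. \<forall>X\<in>gpart A.HA a. \<forall>Y\<in>gpart A.HA b. \<forall>Z\<in>gpart A.HA c. f X Y Z = gadd A.HA (muA X Y Z) (hoch_d A.HA xi a X Y Z)"
    using f(1) unfolding hoch_class_def by blast
  have "related xi"
    unfolding related_def
  proof (intro conjI allI ballI xi(1))
    fix a b c X Y Z assume "X \<in> gpart A.HA a" "Y \<in> gpart A.HA b" "Z \<in> gpart A.HA c"
    then show "muB (phi X) (phi Y) (phi Z) = phi (gadd A.HA (muA X Y Z) (hoch_d A.HA xi a X Y Z))"
      using f(2) xi(2) by metis
  qed
  then show ?thesis by blast
qed

end

theorem theorem4p7:
  fixes A :: "('f::field_char_0, 'a::ring_1) dg_alg" and intA :: "'a set \<Rightarrow> 'f"
    and HA BA :: "'a set" and iA :: "'a set \<Rightarrow> 'a"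
    and A' :: "('f, 'b::ring_1) dg_alg" and intA' :: "'b set \<Rightarrow> 'f"
    and HA' BA' :: "'b set" and iA' :: "'b set \<Rightarrow> 'b"
    and r n :: nat
  assumes "r > 1" and "n \<le> 5 * r - 3"
    and "poincare_dgca A n intA" and "s_connected A (r - 1)" and "hodge_type A n intA"
    and "adapted_hodge_decomposition A n intA HA BA iA"
    and "poincare_dgca A' n intA'" and "s_connected A' (r - 1)" and "hodge_type A' n intA'"
    and "adapted_hodge_decomposition A' n intA' HA' BA' iA'"
  shows "ainf_quasi_isomorphic A A' \<longleftrightarrow>
    (\<exists>\<phi>. galg_iso (cohomology A) (cohomology A') \<phi> \<and>
         hoch_push (cohomology A) \<phi> (hoch_class (cohomology A) (mu3 A HA BA iA))
           = hoch_class (cohomology A') (mu3 A' HA' BA' iA'))"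
proof -
  have dgca: "dgca A" "dgca A'" using assms(3,7) unfolding poincare_dgca_def by auto
  interpret A: hodge A n intA HA BA iA r
    by unfold_locales (use dgca(1) assms in auto)
  interpret B: hodge A' n intA' HA' BA' iA' r
    by unfold_locales (use dgca(2) assms in auto)
  interpret P: hodge_pair A n intA HA BA iA r A' intA' HA' BA' iA' ..
  have P: "coh_iso A n intA HA BA iA r A' intA' HA' BA' iA' phi"
    if "galg_iso (cohomology A) (cohomology A') phi" for phi
    by unfold_locales (rule that)
  show ?thesis
  proof
    assume "ainf_quasi_isomorphic A A'"
    then obtain phi xi where "galg_iso (cohomology A) (cohomology A') phi" "coh_iso.related A HA BA iA A' HA' BA' iA' phi xi"
      using P.ainf_imp_related by blast
    then show "\<exists>\<phi>. galg_iso (cohomology A) (cohomology A') \<phi> \<and>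
         hoch_push (cohomology A) \<phi> (hoch_class (cohomology A) (mu3 A HA BA iA))
           = hoch_class (cohomology A') (mu3 A' HA' BA' iA')"
      using coh_iso.push_eq[OF P] by blast
  next
    assume "\<exists>\<phi>. galg_iso (cohomology A) (cohomology A') \<phi> \<and>
         hoch_push (cohomology A) \<phi> (hoch_class (cohomology A) (mu3 A HA BA iA))
           = hoch_class (cohomology A') (mu3 A' HA' BA' iA')"
    then obtain phi where phi: "galg_iso (cohomology A) (cohomology A') phi"
      "hoch_push (cohomology A) phi (hoch_class (cohomology A) (mu3 A HA BA iA)) = hoch_class (cohomology A') (mu3 A' HA' BA' iA')"
      by blast
    obtain xi where "coh_iso.related A HA BA iA A' HA' BA' iA' phi xi"
      using coh_iso.push_imp_related[OF P[OF phi(1)] phi(2)] by blast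
    then show "ainf_quasi_isomorphic A A'"
      by (rule coh_iso.related_imp_ainf[OF P[OF phi(1)]])
  qed
qed

end
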